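(* Let $k$ be a field, let $Q$ be a finite quiver without sources, let $A=kQ/J^2$ be regarded as a dg algebra concentrated in degree zero, and let $B=L_k(Q^{\rm op})$ be the Leavitt path algebra of the opposite quiver with its natural $\mathbb{Z}$-grading, viewed as a dg algebra with trivial differential. Then the dg $A$-$B$-bimodule $\mathcal{P}^{\bullet}$ (the projective Leavitt complex of $Q$ with the right $B$-action described in the context) is right quasi-balanced, i.e. the canonical homomorphism of dg algebras $B\to\mathrm{End}_A(\mathcal{P}^\bullet)^{\rm opp}$, $b\mapsto r_b$ with $r_b(z)=(-1)^{|b||z|}z\cdot b$ for homogeneous $b,z$, is a quasi-isomorphism. In particular, the opposite dg endomorphism algebra $\mathrm{End}_A(\mathcal{P}^\bullet)^{\rm opp}$ of the projective Leavitt complex of $Q$ is quasi-isomorphic to the Leavitt path algebra $L_k(Q^{\rm op})$.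
   Context: **Quivers and the algebra $A$.** A quiver $Q=(Q_0,Q_1;s,t)$ has vertex set $Q_0$, arrow set $Q_1$, and start/terminal maps $s,t$; it is finite if $Q_0,Q_1$ are finite, and has no sources if every vertex is the terminal vertex of some arrow. A path of length $l(p)=m\ge 1$ is $p=\alpha_m\cdots\alpha_1$ with $t(\alpha_r)=s(\alpha_{r+1})$ (written right to left), $s(p)=s(\alpha_1)$, $t(p)=t(\alpha_m)$; trivial paths $e_i$ have length $0$ and $s(e_i)=t(e_i)=i$. For $m\geq2$ put $\widehat p=\alpha_{m-1}\cdots\alpha_1$, $\widetilde p=\alpha_m\cdots\alpha_2$; for an arrow $\alpha$ put $\widehat\alpha=e_{s(\alpha)}$, $\widetilde\alpha=e_{t(\alpha)}$. $kQ$ is the path algebra ($pq$ is concatenation if $s(p)=t(q)$, else $0$), $J$ the ideal generated by arrows, $A=kQ/J^2$ with basis $\{e_i\}\cup Q_1$. $P_i=Ae_i$ has basis $e_i$ and the arrows starting at $i$. **Associated pairs.** For each vertex $i$ fix one arrow terminating at $i$, called the associated arrow terminating at $i$. For an associated arrow $\alpha$, $T(\alpha)=\{\beta\in Q_1\mid t(\beta)=t(\alpha),\beta\ne\alpha\}$. For paths $p=\alpha_m\cdots\alpha_1$, $q=\beta_n\cdots\beta_1$ with $m,n\ge1$, $(p,q)$ is an associated pair if $s(p)=s(q)$ and either $\alpha_1\ne\beta_1$, or $\alpha_1=\beta_1$ is not associated; also $(p,e_{s(p)})$ and $(e_{s(p)},p)$ are associated pairs for all paths $p$. $\mathbf{\Lambda}^l_i$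 is the set of associated pairs $(p,q)$ with $l(q)-l(p)=l$, $t(p)=i$. **Projective Leavitt complex.** $M^{(X)}=\bigoplus_{x\in X}M\zeta_x$ with each $M\zeta_x$ a copy of $M$. $\mathcal{P}^l=\bigoplus_{i\in Q_0}P_i^{(\mathbf{\Lambda}^l_i)}$, and for $(p,q)\in\mathbf{\Lambda}^l_i$, $\alpha\in Q_1$ with $s(\alpha)=i$: $\delta^l(\alpha\zeta_{(p,q)})=0$; $\delta^l(e_i\zeta_{(p,q)})=\beta\zeta_{(\widehat p,q)}$ if $p=\beta\widehat p$, and $=\sum_{t(\beta)=i}\beta\zeta_{(e_{s(\beta)},q\beta)}$ if $l(p)=0$. **Leavitt path algebra.** For a finite quiver $\Gamma$, $L_k(\Gamma)$ is the $k$-algebra generated by $e_i$ ($i\in\Gamma_0$), $\alpha,\alpha^*$ ($\alpha\in\Gamma_1$) with relations $e_ie_j=\delta_{i,j}e_i$; $e_{t(\alpha)}\alpha=\alpha e_{s(\alpha)}=\alpha$; $e_{s(\alpha)}\alpha^*=\alpha^*e_{t(\alpha)}=\alpha^*$; $\alpha\beta^*=\delta_{\alpha,\beta}e_{t(\alpha)}$; $\sum_{s(\alpha)=i}\alpha^*\alpha=e_i$ for $i$ not a sink. Grading: $|e_i|=0$, $|\alpha|=1$, $|\alpha^*|=-1$. $Q^{\rm op}$ has reversed arrows $\alpha^{\rm op}$ ($s(\alpha^{\rm op})=t(\alpha)$, $t(\alpha^{\rm op})=s(\alpha)$). **Right $B$-action.** For $x\zeta_{(p,q)}\in P_i\zeta_{(p,q)}$,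 $(p,q)\in\mathbf{\Lambda}^l_i$, $j\in Q_0$, $\alpha\in Q_1$: $x\zeta_{(p,q)}\cdot e_j=\delta_{j,t(q)}x\zeta_{(p,q)}$; $x\zeta_{(p,q)}\cdot\alpha^{\rm op}=x\zeta_{(\widetilde p,e_{t(\alpha)})}-\sum_{\beta\in T(\alpha)}x\zeta_{(\widetilde p\beta,\beta)}$ if $l(q)=0$, $p=\widetilde p\alpha$ and $\alpha$ is associated, and $=\delta_{s(\alpha),t(q)}x\zeta_{(p,\alpha q)}$ otherwise; $x\zeta_{(p,q)}\cdot(\alpha^{\rm op})^*=\delta_{\alpha,\alpha_1}x\zeta_{(p,\widehat q)}$ if $q=\alpha_1\widehat q$ with $\alpha_1\in Q_1$, and $=\delta_{s(p),t(\alpha)}x\zeta_{(p\alpha,e_{s(\alpha)})}$ if $l(q)=0$. With this action $\mathcal P^\bullet$ is a dg $A$-$B$-bimodule. **Dg endomorphism algebra.** $\mathrm{End}_A(\mathcal P^\bullet)$ has as degree $n$ elements the $A$-linear maps $f$ with $f(\mathcal P^l)\subseteq\mathcal P^{l+n}$ for all $l$; differential $f\mapsto\delta\circ f-(-1)^nf\circ\delta$; multiplication is composition. The opposite dg algebra $C^{\rm opp}$ is the same complex with multiplication $a\circ b=(-1)^{|a||b|}ba$. *)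

theory Defs
  imports
    "HOL-Algebra.QuotRing"
    "HOL-Algebra.Module"
    "HOL-Algebra.Ideal_Product"
    "HOL-Library.Poly_Mapping"
    "HOL-Library.FuncSet"
    "Graph_Theory.Arc_Walk"
begin

section \<open>Vector spaces with a basis\<close>

text \<open>The type \<open>'b \<Rightarrow>\<^sub>0 'k\<close> is the \<open>'k\<close>-vector space with basis \<open>'b\<close>;
  \<open>pm_extend \<phi>\<close> is the linear map with value \<open>\<phi> b\<close> on the basis vector \<open>b\<close>.\<close>

abbreviation basis_vec :: "'b \<Rightarrow> ('b \<Rightarrow>\<^sub>0 'k::field)" where
  "basis_vec b \<equiv> Poly_Mapping.single b 1"

definition pm_scale :: "'k::field \<Rightarrow> ('b \<Rightarrow>\<^sub>0 'k) \<Rightarrow> ('b \<Rightarrow>\<^sub>0 'k)" where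
  "pm_scale c f = Poly_Mapping.map ((*) c) f"

definition pm_extend :: "('b \<Rightarrow> ('c \<Rightarrow>\<^sub>0 'k::field)) \<Rightarrow> ('b \<Rightarrow>\<^sub>0 'k) \<Rightarrow> ('c \<Rightarrow>\<^sub>0 'k)" where
  "pm_extend \<phi> f = (\<Sum>b\<in>Poly_Mapping.keys f. pm_scale (Poly_Mapping.lookup f b) (\<phi> b))"

definition pm_mult :: "('b \<Rightarrow> 'b \<Rightarrow> ('b \<Rightarrow>\<^sub>0 'k::field)) \<Rightarrow> ('b \<Rightarrow>\<^sub>0 'k) \<Rightarrow> ('b \<Rightarrow>\<^sub>0 'k) \<Rightarrow> ('b \<Rightarrow>\<^sub>0 'k)" where
  "pm_mult m f g = pm_extend (\<lambda>u. pm_extend (\<lambda>v. m u v) g) f"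

definition pm_span :: "'b set \<Rightarrow> ('b \<Rightarrow>\<^sub>0 'k::field) set" where
  "pm_span X = {f. Poly_Mapping.keys f \<subseteq> X}"

lemma lookup_pm_scale [simp]: "Poly_Mapping.lookup (pm_scale c f) b = c * Poly_Mapping.lookup f b"
  by (simp add: pm_scale_def map.rep_eq when_def)

lemma pm_scale_add: "pm_scale c (f + g) = pm_scale c f + pm_scale c g"
  by (rule poly_mapping_eqI) (simp add: lookup_add algebra_simps)

lemma pm_scale_add_left: "pm_scale (c + d) f = pm_scale c f + pm_scale d f"
  by (rule poly_mapping_eqI) (simp add: lookup_add algebra_simps)

lemma pm_scale_zero [simp]: "pm_scale c 0 = 0" "pm_scale 0 f = 0"
  by (rule poly_mapping_eqI; simp)+

lemma pm_scale_one [simp]: "pm_scale 1 f = f"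
  by (rule poly_mapping_eqI) simp

lemma pm_scale_scale: "pm_scale c (pm_scale d f) = pm_scale (c * d) f"
  by (rule poly_mapping_eqI) (simp add: algebra_simps)

lemma pm_scale_sum: "pm_scale c (sum F X) = (\<Sum>x\<in>X. pm_scale c (F x))"
  by (induction X rule: infinite_finite_induct) (simp_all add: pm_scale_add)

lemma pm_scale_single [simp]: "pm_scale c (Poly_Mapping.single b d) = Poly_Mapping.single b (c * d)"
  by (rule poly_mapping_eqI) (simp add: lookup_single when_def)

lemma pm_extend_superset:
  assumes "finite X" "Poly_Mapping.keys f \<subseteq> X"
  shows "pm_extend \<phi> f = (\<Sum>b\<in>X. pm_scale (Poly_Mapping.lookup f b) (\<phi> b))"
  unfolding pm_extend_def using assms
  by (intro sum.mono_neutral_left) (auto simp: in_keys_iff)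

lemma pm_extend_zero [simp]: "pm_extend \<phi> 0 = 0"
  by (simp add: pm_extend_def)

lemma pm_extend_add: "pm_extend \<phi> (f + g) = pm_extend \<phi> f + pm_extend \<phi> g"
proof -
  let ?X = "Poly_Mapping.keys f \<union> Poly_Mapping.keys g"
  have *: "Poly_Mapping.keys (f + g) \<subseteq> ?X" by (rule keys_add)
  show ?thesis
    by (simp add: pm_extend_superset[of ?X f] pm_extend_superset[of ?X g]
        pm_extend_superset[OF _ *] lookup_add pm_scale_add_left sum.distrib)
qed

lemma pm_extend_scale: "pm_extend \<phi> (pm_scale c f) = pm_scale c (pm_extend \<phi> f)"
proof -
  have *: "Poly_Mapping.keys (pm_scale c f) \<subseteq> Poly_Mapping.keys f"
    by (auto simp: in_keys_iff)
  show ?thesis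
    unfolding pm_extend_superset[OF finite_keys *]
    by (simp add: pm_extend_def pm_scale_sum pm_scale_scale)
qed

lemma pm_extend_sum: "pm_extend \<phi> (sum F X) = (\<Sum>x\<in>X. pm_extend \<phi> (F x))"
  by (induction X rule: infinite_finite_induct) (simp_all add: pm_extend_add)

lemma pm_extend_single [simp]: "pm_extend \<phi> (Poly_Mapping.single b c) = pm_scale c (\<phi> b)"
  by (simp add: pm_extend_superset[of "{b}"])

lemma pm_extend_comp: "pm_extend \<phi> (pm_extend \<psi> f) = pm_extend (\<lambda>b. pm_extend \<phi> (\<psi> b)) f"
  by (simp add: pm_extend_def[of \<psi>] pm_extend_def[of _ f] pm_extend_sum pm_extend_scale)

lemma pm_extend_cong:
  "\<lbrakk>\<And>b. b \<in> Poly_Mapping.keys f \<Longrightarrow> \<phi> b = \<psi> b\<rbrakk> \<Longrightarrow> pm_extend \<phi> f = pm_extend \<psi> f"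
  by (simp add: pm_extend_def)

lemma pm_extend_basis: "pm_extend basis_vec f = f"
proof (rule poly_mapping_eqI)
  fix b show "Poly_Mapping.lookup (pm_extend basis_vec f) b = Poly_Mapping.lookup f b"
    by (simp add: pm_extend_def lookup_sum lookup_single when_def in_keys_iff)
qed

lemma pm_extend_add_fun: "pm_extend (\<lambda>b. \<phi> b + \<psi> b) f = pm_extend \<phi> f + pm_extend \<psi> f"
  by (simp add: pm_extend_def pm_scale_add sum.distrib)

lemma pm_extend_zero_fun [simp]: "pm_extend (\<lambda>b. 0) f = 0"
  by (simp add: pm_extend_def)

lemma pm_span_zero [simp]: "0 \<in> pm_span X" by (simp add: pm_span_def)

lemma pm_span_add: "f \<in> pm_span X \<Longrightarrow> g \<in> pm_span X \<Longrightarrow> f + g \<in> pm_span X"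
  unfolding pm_span_def using keys_add[of f g] by auto

lemma pm_span_uminus: "f \<in> pm_span X \<Longrightarrow> - f \<in> pm_span X"
  unfolding pm_span_def by (auto simp: in_keys_iff)

lemma pm_span_scale: "f \<in> pm_span X \<Longrightarrow> pm_scale c f \<in> pm_span X"
  unfolding pm_span_def by (auto simp: in_keys_iff)

lemma pm_span_sum: "(\<And>x. x \<in> Y \<Longrightarrow> F x \<in> pm_span X) \<Longrightarrow> sum F Y \<in> pm_span X"
  by (induction Y rule: infinite_finite_induct) (auto intro: pm_span_add)

lemma pm_span_single: "b \<in> X \<Longrightarrow> Poly_Mapping.single b c \<in> pm_span X"
  by (auto simp: pm_span_def)

lemma pm_span_extend:
  "f \<in> pm_span X \<Longrightarrow> (\<And>b. b \<in> X \<Longrightarrow> \<phi> b \<in> pm_span Y) \<Longrightarrow> pm_extend \<phi> f \<in> pm_span Y"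
  unfolding pm_extend_def
  by (intro pm_span_sum pm_span_scale) (auto simp: pm_span_def[of X])

lemma pm_mult_span:
  assumes "\<And>u v. u \<in> X \<Longrightarrow> v \<in> Y \<Longrightarrow> m u v \<in> pm_span Z" "f \<in> pm_span X" "g \<in> pm_span Y"
  shows "pm_mult m f g \<in> pm_span Z"
  unfolding pm_mult_def using assms by (blast intro: pm_span_extend)

lemma pm_mult_add_left: "pm_mult m (f + g) h = pm_mult m f h + pm_mult m g h"
  by (simp add: pm_mult_def pm_extend_add)

lemma pm_mult_add_right: "pm_mult m h (f + g) = pm_mult m h f + pm_mult m h g"
  by (simp add: pm_mult_def pm_extend_add pm_extend_add_fun)

lemma pm_mult_single: "pm_mult m (Poly_Mapping.single u c) (Poly_Mapping.single v d) =
    pm_scale (c * d) (m u v)"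
  by (simp add: pm_mult_def pm_scale_scale)

lemma pm_extend_swap:
  fixes F :: "'a \<Rightarrow> 'b \<Rightarrow> ('c \<Rightarrow>\<^sub>0 'k::field)"
  shows "pm_extend (\<lambda>u. pm_extend (F u) h) x = pm_extend (\<lambda>w. pm_extend (\<lambda>u. F u w) x) h"
proof -
  have "pm_extend (\<lambda>u. pm_extend (F u) h) x =
     (\<Sum>u\<in>Poly_Mapping.keys x. \<Sum>w\<in>Poly_Mapping.keys h.
        pm_scale (Poly_Mapping.lookup x u * Poly_Mapping.lookup h w) (F u w))"
    by (simp add: pm_extend_def pm_scale_sum pm_scale_scale)
  also have "\<dots> = (\<Sum>w\<in>Poly_Mapping.keys h. \<Sum>u\<in>Poly_Mapping.keys x.
        pm_scale (Poly_Mapping.lookup x u * Poly_Mapping.lookup h w) (F u w))"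
    by (rule sum.swap)
  also have "\<dots> = pm_extend (\<lambda>w. pm_extend (\<lambda>u. F u w) x) h"
    by (simp add: pm_extend_def pm_scale_sum pm_scale_scale mult.commute)
  finally show ?thesis .
qed

lemma pm_mult_assoc:
  assumes m: "\<And>u v w. u \<in> X \<Longrightarrow> v \<in> X \<Longrightarrow> w \<in> X \<Longrightarrow>
      pm_extend (\<lambda>x. m x w) (m u v) = pm_extend (m u) (m v w)"
    and "f \<in> pm_span X" "g \<in> pm_span X" "h \<in> pm_span X"
  shows "pm_mult m (pm_mult m f g) h = pm_mult m f (pm_mult m g h)"
proof -
  have "pm_mult m (pm_mult m f g) h =
      pm_extend (\<lambda>u. pm_extend (\<lambda>v. pm_extend (\<lambda>w. pm_extend (\<lambda>x. m x w) (m u v)) h) g) f"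
    unfolding pm_mult_def pm_extend_comp
    by (intro pm_extend_cong) (rule pm_extend_swap)
  also have "\<dots> = pm_extend (\<lambda>u. pm_extend (\<lambda>v. pm_extend (\<lambda>w. pm_extend (m u) (m v w)) h) g) f"
    by (intro pm_extend_cong m) (use assms(2-4) in \<open>auto simp: pm_span_def\<close>)
  also have "\<dots> = pm_mult m f (pm_mult m g h)"
    by (simp add: pm_mult_def pm_extend_comp)
  finally show ?thesis .
qed

lemma ring_pm_mult:
  fixes m :: "'b \<Rightarrow> 'b \<Rightarrow> ('b \<Rightarrow>\<^sub>0 'k::field)" and e :: "'b \<Rightarrow>\<^sub>0 'k"
  assumes closed: "\<And>u v. u \<in> X \<Longrightarrow> v \<in> X \<Longrightarrow> m u v \<in> pm_span X"
    and assoc: "\<And>u v w. u \<in> X \<Longrightarrow> v \<in> X \<Longrightarrow> w \<in> X \<Longrightarrow>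
      pm_extend (\<lambda>x. m x w) (m u v) = pm_extend (m u) (m v w)"
    and one: "e \<in> pm_span X" "\<And>u. u \<in> X \<Longrightarrow> pm_extend (\<lambda>x. m x u) e = basis_vec u"
       "\<And>u. u \<in> X \<Longrightarrow> pm_extend (m u) e = basis_vec u"
    and R: "carrier R = pm_span X" "mult R = pm_mult m" "one R = e" "zero R = 0" "add R = (+)"
  shows "ring R"
proof (rule ringI)
  show "abelian_group R"
  proof (rule abelian_groupI)
    fix x assume "x \<in> carrier R"
    then show "\<exists>y\<in>carrier R. y \<oplus>\<^bsub>R\<^esub> x = \<zero>\<^bsub>R\<^esub>"
      by (intro bexI[of _ "- x"]) (auto simp: R pm_span_uminus)
  qed (auto simp: R pm_span_add algebra_simps)
  show "Group.monoid R"
  proof (rule monoidI)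
    fix x assume x: "x \<in> carrier R"
    have "pm_mult m e x = pm_extend basis_vec x"
      unfolding pm_mult_def pm_extend_swap[of m x] using x one by (intro pm_extend_cong) (auto simp: R pm_span_def)
    then show "\<one>\<^bsub>R\<^esub> \<otimes>\<^bsub>R\<^esub> x = x" by (simp add: R pm_extend_basis)
    have "pm_mult m x e = pm_extend basis_vec x"
      unfolding pm_mult_def using x one by (intro pm_extend_cong) (auto simp: R pm_span_def)
    then show "x \<otimes>\<^bsub>R\<^esub> \<one>\<^bsub>R\<^esub> = x" by (simp add: R pm_extend_basis)
  qed (auto simp: R one intro: pm_mult_span closed pm_mult_assoc[of X] assoc)
qed (auto simp: R pm_mult_add_left pm_mult_add_right)

definition scalars :: "'k::field ring" where
  "scalars = \<lparr>carrier = UNIV, mult = (*), one = 1, zero = 0, add = (+)\<rparr>"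


section \<open>Differential graded algebras and bimodules\<close>

text \<open>As with \<open>module\<close> itself, the fields \<open>mult\<close> and \<open>one\<close>
  are meaningless for a record that is not an algebra.\<close>

record ('k, 'a) dg = "('k, 'a) module" +
  grade :: "int \<Rightarrow> 'a set"
  differential :: "'a \<Rightarrow> 'a"

definition koszul_sign :: "int \<Rightarrow> 'k::field" where
  "koszul_sign n = (- 1) powi n"

definition hom_decomp :: "('k::field, 'a, 'm) dg_scheme \<Rightarrow> 'a \<Rightarrow> (int \<Rightarrow> 'a) \<Rightarrow> bool" where
  "hom_decomp C x c \<longleftrightarrow>
     (\<forall>n. c n \<in> grade C n) \<and> finite {n. c n \<noteq> \<zero>\<^bsub>C\<^esub>} \<and>
     x = finsum C c {n. c n \<noteq> \<zero>\<^bsub>C\<^esub>}"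

definition hom_comp :: "('k::field, 'a, 'm) dg_scheme \<Rightarrow> 'a \<Rightarrow> int \<Rightarrow> 'a" where
  "hom_comp C x = (THE c. hom_decomp C x c)"

definition degrees :: "('k::field, 'a, 'm) dg_scheme \<Rightarrow> 'a \<Rightarrow> int set" where
  "degrees C x = {n. hom_comp C x n \<noteq> \<zero>\<^bsub>C\<^esub>}"

text \<open>The biadditive map sending homogeneous \<open>x\<close>, \<open>y\<close> to \<open>(-1)\<^bsup>\<bar>x\<bar>\<bar>y\<bar>\<^esup> f x y\<close>.\<close>

definition signed_extension ::
    "('k::field, 'a, 'm) dg_scheme \<Rightarrow> ('k, 'b, 'n) dg_scheme \<Rightarrow> ('k, 'c, 'o) dg_scheme \<Rightarrow>
     ('a \<Rightarrow> 'b \<Rightarrow> 'c) \<Rightarrow> 'a \<Rightarrow> 'b \<Rightarrow> 'c" where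
  "signed_extension C D E f x y =
     finsum E (\<lambda>(m, n). koszul_sign (m * n) \<odot>\<^bsub>E\<^esub> f (hom_comp C x m) (hom_comp D y n))
       (degrees C x \<times> degrees D y)"

locale dg_space = Module.module scalars C for C :: "('k::field, 'a, 'm) dg_scheme" (structure) +
  assumes grade_submodule: "submodule (grade C n) scalars C"
    and grade_direct_sum: "x \<in> carrier C \<Longrightarrow> \<exists>!c. hom_decomp C x c"
    and differential_closed: "x \<in> carrier C \<Longrightarrow> differential C x \<in> carrier C"
    and differential_add: "\<lbrakk>x \<in> carrier C; y \<in> carrier C\<rbrakk> \<Longrightarrow>
          differential C (x \<oplus> y) = differential C x \<oplus> differential C y"
    and differential_smult: "x \<in> carrier C \<Longrightarrow> differential C (c \<odot> x) = c \<odot> differential C x"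
    and differential_grade: "x \<in> grade C n \<Longrightarrow> differential C x \<in> grade C (n + 1)"
    and differential_square: "x \<in> carrier C \<Longrightarrow> differential C (differential C x) = \<zero>"

locale dg_algebra = dg_space C + ring C for C :: "('k::field, 'a, 'm) dg_scheme" (structure) +
  assumes smult_mult_left: "\<lbrakk>x \<in> carrier C; y \<in> carrier C\<rbrakk> \<Longrightarrow> (c \<odot> x) \<otimes> y = c \<odot> (x \<otimes> y)"
    and smult_mult_right: "\<lbrakk>x \<in> carrier C; y \<in> carrier C\<rbrakk> \<Longrightarrow> x \<otimes> (c \<odot> y) = c \<odot> (x \<otimes> y)"
    and one_grade: "\<one> \<in> grade C 0"
    and mult_grade: "\<lbrakk>x \<in> grade C m; y \<in> grade C n\<rbrakk> \<Longrightarrow> x \<otimes> y \<in> grade C (m + n)"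
    and leibniz: "\<lbrakk>x \<in> grade C m; y \<in> carrier C\<rbrakk> \<Longrightarrow>
          differential C (x \<otimes> y) =
            (differential C x \<otimes> y) \<oplus> (koszul_sign m \<odot> (x \<otimes> differential C y))"

definition dg_opposite :: "('k::field, 'a) dg \<Rightarrow> ('k, 'a) dg" where
  "dg_opposite C = C\<lparr>mult := signed_extension C C C (\<lambda>x y. y \<otimes>\<^bsub>C\<^esub> x)\<rparr>"

definition dg_concentrated :: "('k::field, 'a) module \<Rightarrow> ('k, 'a) dg" where
  "dg_concentrated A = module.extend A
     (dg.fields (\<lambda>n. if n = 0 then carrier A else {\<zero>\<^bsub>A\<^esub>}) (\<lambda>_. \<zero>\<^bsub>A\<^esub>))"

record ('k, 'a, 'b, 'm) dg_bimod = "('k, 'm) dg" +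
  lact :: "'a \<Rightarrow> 'm \<Rightarrow> 'm"
  ract :: "'m \<Rightarrow> 'b \<Rightarrow> 'm"

locale dg_bimodule =
  A: dg_algebra A + B: dg_algebra B + dg_space M
  for A :: "('k::field, 'a) dg" and B :: "('k, 'b) dg"
    and M :: "('k, 'a, 'b, 'm) dg_bimod" (structure) +
  assumes lact_closed: "\<lbrakk>a \<in> carrier A; x \<in> carrier M\<rbrakk> \<Longrightarrow> lact M a x \<in> carrier M"
    and lact_add_left: "\<lbrakk>a \<in> carrier A; a' \<in> carrier A; x \<in> carrier M\<rbrakk> \<Longrightarrow>
          lact M (a \<oplus>\<^bsub>A\<^esub> a') x = lact M a x \<oplus> lact M a' x"
    and lact_add_right: "\<lbrakk>a \<in> carrier A; x \<in> carrier M; y \<in> carrier M\<rbrakk> \<Longrightarrow>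
          lact M a (x \<oplus> y) = lact M a x \<oplus> lact M a y"
    and lact_smult_left: "\<lbrakk>a \<in> carrier A; x \<in> carrier M\<rbrakk> \<Longrightarrow>
          lact M (c \<odot>\<^bsub>A\<^esub> a) x = c \<odot> lact M a x"
    and lact_smult_right: "\<lbrakk>a \<in> carrier A; x \<in> carrier M\<rbrakk> \<Longrightarrow>
          lact M a (c \<odot> x) = c \<odot> lact M a x"
    and lact_one: "x \<in> carrier M \<Longrightarrow> lact M \<one>\<^bsub>A\<^esub> x = x"
    and lact_mult: "\<lbrakk>a \<in> carrier A; a' \<in> carrier A; x \<in> carrier M\<rbrakk> \<Longrightarrow>
          lact M (a \<otimes>\<^bsub>A\<^esub> a') x = lact M a (lact M a' x)"
    and lact_grade: "\<lbrakk>a \<in> grade A m; x \<in> grade M n\<rbrakk> \<Longrightarrow> lact M a x \<in> grade M (m + n)"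
    and lact_leibniz: "\<lbrakk>a \<in> grade A m; x \<in> carrier M\<rbrakk> \<Longrightarrow>
          differential M (lact M a x) =
            lact M (differential A a) x \<oplus> (koszul_sign m \<odot> lact M a (differential M x))"
    and ract_closed: "\<lbrakk>x \<in> carrier M; b \<in> carrier B\<rbrakk> \<Longrightarrow> ract M x b \<in> carrier M"
    and ract_add_left: "\<lbrakk>x \<in> carrier M; y \<in> carrier M; b \<in> carrier B\<rbrakk> \<Longrightarrow>
          ract M (x \<oplus> y) b = ract M x b \<oplus> ract M y b"
    and ract_add_right: "\<lbrakk>x \<in> carrier M; b \<in> carrier B; b' \<in> carrier B\<rbrakk> \<Longrightarrow>
          ract M x (b \<oplus>\<^bsub>B\<^esub> b') = ract M x b \<oplus> ract M x b'"
    and ract_smult_left: "\<lbrakk>x \<in> carrier M; b \<in> carrier B\<rbrakk> \<Longrightarrow>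
          ract M (c \<odot> x) b = c \<odot> ract M x b"
    and ract_smult_right: "\<lbrakk>x \<in> carrier M; b \<in> carrier B\<rbrakk> \<Longrightarrow>
          ract M x (c \<odot>\<^bsub>B\<^esub> b) = c \<odot> ract M x b"
    and ract_one: "x \<in> carrier M \<Longrightarrow> ract M x \<one>\<^bsub>B\<^esub> = x"
    and ract_mult: "\<lbrakk>x \<in> carrier M; b \<in> carrier B; b' \<in> carrier B\<rbrakk> \<Longrightarrow>
          ract M x (b \<otimes>\<^bsub>B\<^esub> b') = ract M (ract M x b) b'"
    and ract_grade: "\<lbrakk>x \<in> grade M m; b \<in> grade B n\<rbrakk> \<Longrightarrow> ract M x b \<in> grade M (m + n)"
    and ract_leibniz: "\<lbrakk>x \<in> grade M m; b \<in> carrier B\<rbrakk> \<Longrightarrow>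
          differential M (ract M x b) =
            ract M (differential M x) b \<oplus> (koszul_sign m \<odot> ract M x (differential B b))"
    and lact_ract: "\<lbrakk>a \<in> carrier A; x \<in> carrier M; b \<in> carrier B\<rbrakk> \<Longrightarrow>
          ract M (lact M a x) b = lact M a (ract M x b)"

text \<open>The homogeneous \<open>A\<close>-linear maps of degree \<open>n\<close>. The sign is the usual one
  for graded \<open>A\<close>; it is trivial if \<open>A\<close> is concentrated in degree zero. Maps are
  extensional, so that equality of maps is equality of functions.\<close>

definition dg_End_grade ::
    "('k::field, 'a) dg \<Rightarrow> ('k, 'a, 'b, 'm) dg_bimod \<Rightarrow> int \<Rightarrow> ('m \<Rightarrow> 'm) set" where
  "dg_End_grade A M n = {f \<in> extensional (carrier M).
     (\<forall>x\<in>carrier M. f x \<in> carrier M) \<and>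
     (\<forall>x\<in>carrier M. \<forall>y\<in>carrier M. f (x \<oplus>\<^bsub>M\<^esub> y) = f x \<oplus>\<^bsub>M\<^esub> f y) \<and>
     (\<forall>c. \<forall>x\<in>carrier M. f (c \<odot>\<^bsub>M\<^esub> x) = c \<odot>\<^bsub>M\<^esub> f x) \<and>
     (\<forall>m. \<forall>a\<in>grade A m. \<forall>x\<in>carrier M.
        f (lact M a x) = koszul_sign (n * m) \<odot>\<^bsub>M\<^esub> lact M a (f x)) \<and>
     (\<forall>l. \<forall>x\<in>grade M l. f x \<in> grade M (l + n))}"

text \<open>The carrier consists of the finite sums of homogeneous maps. The differential
  is placed in a second step because it refers to the homogeneous components of \<open>f\<close>.\<close>

definition dg_End_underlying ::
    "('k::field, 'a) dg \<Rightarrow> ('k, 'a, 'b, 'm) dg_bimod \<Rightarrow> ('k, 'm \<Rightarrow> 'm) dg" where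
  "dg_End_underlying A M =
     \<lparr>carrier = {f. \<exists>N c. finite N \<and> (\<forall>n\<in>N. c n \<in> dg_End_grade A M n) \<and>
                  f = (\<lambda>x\<in>carrier M. finsum M (\<lambda>n. c n x) N)},
      mult = compose (carrier M),
      one = (\<lambda>x\<in>carrier M. x),
      zero = (\<lambda>x\<in>carrier M. \<zero>\<^bsub>M\<^esub>),
      add = (\<lambda>f g. \<lambda>x\<in>carrier M. f x \<oplus>\<^bsub>M\<^esub> g x),
      smult = (\<lambda>c f. \<lambda>x\<in>carrier M. c \<odot>\<^bsub>M\<^esub> f x),
      grade = dg_End_grade A M,
      differential = undefined\<rparr>"

definition dg_End ::
    "('k::field, 'a) dg \<Rightarrow> ('k, 'a, 'b, 'm) dg_bimod \<Rightarrow> ('k, 'm \<Rightarrow> 'm) dg" where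
  "dg_End A M = (let E = dg_End_underlying A M in
     E\<lparr>differential := (\<lambda>f. \<lambda>x\<in>carrier M.
        finsum M (\<lambda>n. differential M (hom_comp E f n x) \<ominus>\<^bsub>M\<^esub>
                       (koszul_sign n \<odot>\<^bsub>M\<^esub> hom_comp E f n (differential M x)))
          (degrees E f))\<rparr>)"


section \<open>Quasi-isomorphisms\<close>

definition cocycles :: "('k::field, 'a, 'm) dg_scheme \<Rightarrow> int \<Rightarrow> 'a set" where
  "cocycles C n = {x \<in> grade C n. differential C x = \<zero>\<^bsub>C\<^esub>}"

definition coboundaries :: "('k::field, 'a, 'm) dg_scheme \<Rightarrow> int \<Rightarrow> 'a set" where
  "coboundaries C n = differential C ` grade C (n - 1)"

definition cohomology :: "('k::field, 'a, 'm) dg_scheme \<Rightarrow> int \<Rightarrow> 'a set monoid" where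
  "cohomology C n =
     \<lparr>carrier = cocycles C n, mult = add C, one = \<zero>\<^bsub>C\<^esub>\<rparr> Mod coboundaries C n"

text \<open>For a coset \<open>X\<close> in the cohomology of the source, \<open>f ` X\<close> lies in
  one coset in the cohomology of \<open>D\<close>, which is recovered by adding the coboundaries.\<close>

definition cohomology_map ::
    "('k::field, 'b, 'n) dg_scheme \<Rightarrow> ('a \<Rightarrow> 'b) \<Rightarrow> int \<Rightarrow> 'a set \<Rightarrow> 'b set" where
  "cohomology_map D f n X = coboundaries D n <+>\<^bsub>D\<^esub> f ` X"

locale dg_algebra_hom = C: dg_algebra C + D: dg_algebra D
  for C :: "('k::field, 'a) dg" and D :: "('k, 'b) dg" and f :: "'a \<Rightarrow> 'b" +
  assumes ring_hom: "f \<in> ring_hom C D"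
    and hom_smult: "x \<in> carrier C \<Longrightarrow> f (c \<odot>\<^bsub>C\<^esub> x) = c \<odot>\<^bsub>D\<^esub> f x"
    and hom_grade: "x \<in> grade C n \<Longrightarrow> f x \<in> grade D n"
    and hom_differential: "x \<in> carrier C \<Longrightarrow> f (differential C x) = differential D (f x)"

definition dg_quasi_iso ::
    "('k::field, 'a) dg \<Rightarrow> ('k, 'b) dg \<Rightarrow> ('a \<Rightarrow> 'b) \<Rightarrow> bool" where
  "dg_quasi_iso C D f \<longleftrightarrow> dg_algebra_hom C D f \<and>
     (\<forall>n. cohomology_map D f n \<in> iso (cohomology C n) (cohomology D n))"

text \<open>Quasi-isomorphic dg algebras: connected by a finite zigzag of quasi-isomorphisms.
  The intermediate dg algebras are required to live on the sum of the two types, which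
  contains copies of both end points.\<close>

definition dg_quasi_isomorphic :: "('k::field, 'a) dg \<Rightarrow> ('k, 'b) dg \<Rightarrow> bool" where
  "dg_quasi_isomorphic C D \<longleftrightarrow>
     (\<exists>(E :: ('k, 'a + 'b) dg) E'.
        (\<exists>f. dg_quasi_iso C E f) \<and>
        (symclp (\<lambda>X Y. \<exists>g. dg_quasi_iso X Y g))\<^sup>*\<^sup>* E E' \<and>
        (\<exists>h. dg_quasi_iso E' D h))"

definition right_mult_map ::
    "('k::field, 'b) dg \<Rightarrow> ('k, 'a, 'b, 'm) dg_bimod \<Rightarrow> 'b \<Rightarrow> 'm \<Rightarrow> 'm" where
  "right_mult_map B M b = (\<lambda>z\<in>carrier M. signed_extension B M M (\<lambda>b z. ract M z b) b z)"

definition right_quasi_balanced ::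
    "('k::field, 'a) dg \<Rightarrow> ('k, 'b) dg \<Rightarrow> ('k, 'a, 'b, 'm) dg_bimod \<Rightarrow> bool" where
  "right_quasi_balanced A B M \<longleftrightarrow> dg_bimodule A B M \<and>
     dg_quasi_iso B (dg_opposite (dg_End A M)) (right_mult_map B M)"


section \<open>Paths and the algebra with radical square zero\<close>

text \<open>Quivers are \<open>pre_digraph\<close>s with start \<open>tail\<close> and terminal \<open>head\<close>. The path
  \<open>\<alpha>\<^sub>m \<cdots> \<alpha>\<^sub>1\<close> starting at \<open>i\<close> is the pair \<open>(i, [\<alpha>\<^sub>1, \<dots>, \<alpha>\<^sub>m])\<close>: the list
  is in the order of traversal. The trivial path \<open>e\<^sub>i\<close> is \<open>(i, [])\<close>.\<close>

type_synonym ('v, 'e) qpath = "'v \<times> 'e list"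

definition paths :: "('v, 'e) pre_digraph \<Rightarrow> ('v, 'e) qpath set" where
  "paths Q = {(i, p). \<exists>j. pre_digraph.awalk Q i p j}"

definition path_start :: "('v, 'e) qpath \<Rightarrow> 'v" where
  "path_start p = fst p"

definition path_end :: "('v, 'e) pre_digraph \<Rightarrow> ('v, 'e) qpath \<Rightarrow> 'v" where
  "path_end Q p = (if snd p = [] then fst p else head Q (last (snd p)))"

abbreviation path_length :: "('v, 'e) qpath \<Rightarrow> nat" where
  "path_length p \<equiv> length (snd p)"

abbreviation trivial_path :: "'v \<Rightarrow> ('v, 'e) qpath" where
  "trivial_path i \<equiv> (i, [])"

definition arrow_path :: "('v, 'e) pre_digraph \<Rightarrow> 'e \<Rightarrow> ('v, 'e) qpath" where
  "arrow_path Q \<alpha> = (tail Q \<alpha>, [\<alpha>])"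

text \<open>\<open>path_comp p q\<close> is the concatenation \<open>pq\<close> (first \<open>q\<close>, then \<open>p\<close>).\<close>

definition path_comp :: "('v, 'e) qpath \<Rightarrow> ('v, 'e) qpath \<Rightarrow> ('v, 'e) qpath" where
  "path_comp p q = (fst q, snd q @ snd p)"

definition path_hat :: "('v, 'e) qpath \<Rightarrow> ('v, 'e) qpath" where
  "path_hat p = (fst p, butlast (snd p))"

definition path_tilde :: "('v, 'e) pre_digraph \<Rightarrow> ('v, 'e) qpath \<Rightarrow> ('v, 'e) qpath" where
  "path_tilde Q p = (head Q (hd (snd p)), tl (snd p))"

definition path_algebra ::
    "('v, 'e) pre_digraph \<Rightarrow> ('k::field, ('v, 'e) qpath \<Rightarrow>\<^sub>0 'k) module" where
  "path_algebra Q =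
     \<lparr>carrier = pm_span (paths Q),
      mult = pm_mult (\<lambda>p q. if path_start p = path_end Q q
                            then basis_vec (path_comp p q) else 0),
      one = (\<Sum>i\<in>verts Q. basis_vec (trivial_path i)),
      zero = 0, add = (+), smult = pm_scale\<rparr>"

definition arrow_ideal :: "('v, 'e) pre_digraph \<Rightarrow> (('v, 'e) qpath \<Rightarrow>\<^sub>0 'k::field) set" where
  "arrow_ideal Q = genideal (path_algebra Q) ((\<lambda>\<alpha>. basis_vec (arrow_path Q \<alpha>)) ` arcs Q)"

text \<open>The algebra \<open>kQ/J\<^sup>2\<close> on the basis of residue classes of the paths of length at most
  one. The lemma \<open>rad_square_zero_quotient\<close> below identifies it with the quotient of
  \<open>path_algebra Q\<close> by the square of \<open>arrow_ideal Q\<close>.\<close>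

definition rad_square_zero_algebra ::
    "('v, 'e) pre_digraph \<Rightarrow> ('k::field, ('v, 'e) qpath \<Rightarrow>\<^sub>0 'k) module" where
  "rad_square_zero_algebra Q =
     \<lparr>carrier = pm_span {p \<in> paths Q. path_length p \<le> 1},
      mult = pm_mult (\<lambda>p q. if path_start p = path_end Q q \<and> path_length (path_comp p q) \<le> 1
                            then basis_vec (path_comp p q) else 0),
      one = (\<Sum>i\<in>verts Q. basis_vec (trivial_path i)),
      zero = 0, add = (+), smult = pm_scale\<rparr>"

definition truncate_path :: "(('v, 'e) qpath \<Rightarrow>\<^sub>0 'k::field) \<Rightarrow> (('v, 'e) qpath \<Rightarrow>\<^sub>0 'k)" where
  "truncate_path = pm_extend (\<lambda>p. if path_length p \<le> 1 then basis_vec p else 0)"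

text \<open>The basis of \<open>P\<^sub>i = A e\<^sub>i\<close>; see the lemma \<open>indecomposable_projective_basis\<close>.\<close>

definition proj_basis :: "('v, 'e) pre_digraph \<Rightarrow> 'v \<Rightarrow> ('v, 'e) qpath set" where
  "proj_basis Q i = insert (trivial_path i) (arrow_path Q ` {\<alpha> \<in> arcs Q. tail Q \<alpha> = i})"

context
  fixes Q :: "('v, 'e) pre_digraph"
  assumes Q: "fin_digraph Q"
begin

interpretation fin_digraph Q by (rule Q)

lemma cas_append: "\<lbrakk>cas i p j; cas j q l\<rbrakk> \<Longrightarrow> cas i (p @ q) l"
  by (induction p arbitrary: i) auto

lemma cas_path_end: "cas i p j \<Longrightarrow> path_end Q (i, p) = j"
  by (induction p arbitrary: i) (auto simp: path_end_def split: if_splits)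

lemma in_pathsE:
  assumes "p \<in> paths Q"
  obtains "fst p \<in> verts Q" "set (snd p) \<subseteq> arcs Q" "cas (fst p) (snd p) (path_end Q p)"
  using assms cas_path_end by (cases p) (auto simp: paths_def awalk_def)

lemma path_end_in_verts: "p \<in> paths Q \<Longrightarrow> path_end Q p \<in> verts Q"
  by (cases p) (auto simp: paths_def awalk_def path_end_def dest!: last_in_set)

lemma path_end_comp: "path_start p = path_end Q q \<Longrightarrow> path_end Q (path_comp p q) = path_end Q p"
  by (cases p) (auto simp: path_end_def path_start_def path_comp_def)

lemma path_start_comp: "path_start (path_comp p q) = path_start q"
  by (auto simp: path_start_def path_comp_def)

lemma path_comp_assoc: "path_comp (path_comp p q) r = path_comp p (path_comp q r)"
  by (auto simp: path_comp_def)

lemma path_comp_in_paths: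
  assumes "p \<in> paths Q" "q \<in> paths Q" "path_start p = path_end Q q"
  shows "path_comp p q \<in> paths Q"
  using assms(1) assms(2)
  by (elim in_pathsE)
    (use assms(3) cas_append in \<open>fastforce simp: paths_def awalk_def path_comp_def path_start_def\<close>)

lemma trivial_path_in_paths: "i \<in> verts Q \<Longrightarrow> trivial_path i \<in> paths Q"
  by (auto simp: paths_def awalk_def)

lemma arrow_path_in_paths: "\<alpha> \<in> arcs Q \<Longrightarrow> arrow_path Q \<alpha> \<in> paths Q"
  by (auto simp: paths_def awalk_def arrow_path_def)

lemma path_Cons:
  assumes "(i, \<alpha> # p) \<in> paths Q"
  shows "\<alpha> \<in> arcs Q" "i = tail Q \<alpha>" "(head Q \<alpha>, p) \<in> paths Q"
    "(i, \<alpha> # p) = path_comp (head Q \<alpha>, p) (arrow_path Q \<alpha>)"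
    "path_start (head Q \<alpha>, p) = path_end Q (arrow_path Q \<alpha>)"
  using assms
  by (auto simp: paths_def awalk_def arrow_path_def path_comp_def path_start_def path_end_def)

lemma unit_left: "u \<in> paths Q \<Longrightarrow>
    (\<Sum>i\<in>verts Q. if path_start (trivial_path i) = path_end Q u
        then basis_vec (path_comp (trivial_path i) u) else 0) = basis_vec u"
  using path_end_in_verts[of u]
  by (subst sum.remove[of _ "path_end Q u"]) (auto simp: path_start_def path_comp_def intro!: sum.neutral)

lemma unit_right: "u \<in> paths Q \<Longrightarrow>
    (\<Sum>i\<in>verts Q. if path_start u = path_end Q (trivial_path i)
        then basis_vec (path_comp u (trivial_path i)) else 0) = basis_vec u"
  by (subst sum.remove[of _ "path_start u"])
    (auto simp: path_start_def path_end_def path_comp_def elim: in_pathsE intro!: sum.neutral)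

lemma ring_path_algebra: "ring (path_algebra Q)"
proof (rule ring_pm_mult)
  fix u v w
  assume *: "u \<in> paths Q" "v \<in> paths Q" "w \<in> paths Q"
  show "pm_extend (\<lambda>x. if path_start x = path_end Q w then basis_vec (path_comp x w) else 0)
         (if path_start u = path_end Q v then basis_vec (path_comp u v) else 0) =
       pm_extend (\<lambda>q. if path_start u = path_end Q q then basis_vec (path_comp u q) else 0)
         (if path_start v = path_end Q w then basis_vec (path_comp v w) else 0)"
    by (auto simp: path_end_comp path_start_comp path_comp_assoc)
qed (auto simp: path_algebra_def pm_extend_sum unit_left unit_right
       intro: pm_span_sum pm_span_single path_comp_in_paths trivial_path_in_paths)

lemma ring_rad_square_zero_algebra: "ring (rad_square_zero_algebra Q)"
proof (rule ring_pm_mult)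
  let ?m = "\<lambda>p q. if path_start p = path_end Q q \<and> path_length (path_comp p q) \<le> 1
                 then basis_vec (path_comp p q) else 0"
  let ?X = "{p \<in> paths Q. path_length p \<le> 1}"
  fix u v w
  assume *: "u \<in> ?X" "v \<in> ?X" "w \<in> ?X"
  show "pm_extend (\<lambda>x. ?m x w) (?m u v) = pm_extend (?m u) (?m v w)"
    by (auto simp: path_end_comp path_start_comp path_comp_assoc)
      (auto simp: path_comp_def)
next
  fix u assume *: "u \<in> {p \<in> paths Q. path_length p \<le> 1}"
  have 1: "path_length (path_comp (trivial_path i) u) \<le> 1"
    "path_length (path_comp u (trivial_path i)) \<le> 1" for i
    using * by (auto simp: path_comp_def)
  show "pm_extend (\<lambda>p. if path_start p = path_end Q u \<and> path_length (path_comp p u) \<le> 1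
                 then basis_vec (path_comp p u) else 0)
         (\<Sum>i\<in>verts Q. basis_vec (trivial_path i)) = basis_vec u"
    using * 1 unit_left[of u] by (simp add: pm_extend_sum)
  show "pm_extend (\<lambda>q. if path_start u = path_end Q q \<and> path_length (path_comp u q) \<le> 1
                 then basis_vec (path_comp u q) else 0)
         (\<Sum>i\<in>verts Q. basis_vec (trivial_path i)) = basis_vec u"
    using * 1 unit_right[of u] by (simp add: pm_extend_sum)
next
  show "(\<Sum>i\<in>verts Q. basis_vec (trivial_path i)) \<in> pm_span {p \<in> paths Q. path_length p \<le> 1}"
    by (intro pm_span_sum pm_span_single) (simp add: trivial_path_in_paths)
qed (auto simp: rad_square_zero_algebra_def intro: pm_span_single path_comp_in_paths)

lemma lookup_truncate_path:
  "Poly_Mapping.lookup (truncate_path f) p = (if path_length p \<le> 1 then Poly_Mapping.lookup f p else 0)"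
proof -
  have "Poly_Mapping.lookup (truncate_path f) p =
      (\<Sum>b\<in>Poly_Mapping.keys f. if b = p then (if path_length p \<le> 1 then Poly_Mapping.lookup f p else 0) else 0)"
    unfolding truncate_path_def pm_extend_def lookup_sum
    by (intro sum.cong) (auto simp: lookup_single when_def)
  then show ?thesis by (simp add: in_keys_iff)
qed

lemma truncate_path_mult:
  "truncate_path (f \<otimes>\<^bsub>path_algebra Q\<^esub> g) =
   truncate_path f \<otimes>\<^bsub>rad_square_zero_algebra Q\<^esub> truncate_path g"
  unfolding path_algebra_def rad_square_zero_algebra_def truncate_path_def
  apply (simp only: module.simps ring.simps monoid.simps partial_object.simps pm_mult_def pm_extend_comp)
  apply (rule pm_extend_cong)
  subgoal for u
    apply (cases "path_length u \<le> 1")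
    subgoal
      apply (simp add: pm_extend_comp del: One_nat_def)
      apply (rule pm_extend_cong)
      apply (auto simp: path_comp_def)
      done
    subgoal
      apply (simp del: One_nat_def)
      apply (rule trans[OF pm_extend_cong pm_extend_zero_fun])
      apply (auto simp: path_comp_def)
      done
    done
  done

lemma truncate_path_ring_hom:
  "truncate_path \<in> ring_hom (path_algebra Q) (rad_square_zero_algebra Q)"
proof (rule ring_hom_memI)
  fix f assume "f \<in> carrier (path_algebra Q)"
  then show "truncate_path f \<in> carrier (rad_square_zero_algebra Q)"
    by (auto simp: path_algebra_def rad_square_zero_algebra_def pm_span_def in_keys_iff
        lookup_truncate_path split: if_splits)
next
  show "truncate_path \<one>\<^bsub>path_algebra Q\<^esub> = \<one>\<^bsub>rad_square_zero_algebra Q\<^esub>"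
    by (simp add: path_algebra_def rad_square_zero_algebra_def truncate_path_def pm_extend_sum)
qed (simp_all add: truncate_path_mult, simp add: path_algebra_def rad_square_zero_algebra_def
      truncate_path_def pm_extend_add)

lemma path_mult_single:
  "path_start p = path_end Q q \<Longrightarrow>
   Poly_Mapping.single p c \<otimes>\<^bsub>path_algebra Q\<^esub> Poly_Mapping.single q d =
   Poly_Mapping.single (path_comp p q) (c * d)"
  by (simp add: path_algebra_def pm_mult_single)

lemma path_span_mult:
  assumes "f \<in> pm_span {p \<in> paths Q. path_length p \<ge> m}"
    and "g \<in> pm_span {p \<in> paths Q. path_length p \<ge> n}"
  shows "f \<otimes>\<^bsub>path_algebra Q\<^esub> g \<in> pm_span {p \<in> paths Q. path_length p \<ge> m + n}"
  unfolding path_algebra_def monoid.simps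
  by (rule pm_mult_span[OF _ assms])
    (auto intro!: pm_span_single path_comp_in_paths, auto simp: path_comp_def)

lemma arrow_ideal_ideal: "ideal (arrow_ideal Q) (path_algebra Q)"
  unfolding arrow_ideal_def
  by (rule ring.genideal_ideal[OF ring_path_algebra])
    (auto simp: path_algebra_def intro!: pm_span_single arrow_path_in_paths)

lemma arrow_ideal_subset:
  "(arrow_ideal Q :: (('v, 'e) qpath \<Rightarrow>\<^sub>0 'k::field) set) \<subseteq> pm_span {p \<in> paths Q. path_length p \<ge> 1}"
  unfolding arrow_ideal_def
proof (rule ring.genideal_minimal[OF ring_path_algebra])
  let ?R = "path_algebra Q :: ('k, ('v, 'e) qpath \<Rightarrow>\<^sub>0 'k) module"
  let ?I = "pm_span {p \<in> paths Q. path_length p \<ge> 1} :: (('v, 'e) qpath \<Rightarrow>\<^sub>0 'k) set"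
  interpret R: ring ?R by (rule ring_path_algebra)
  show "ideal ?I ?R"
  proof (rule idealI[OF ring_path_algebra])
    show "subgroup ?I (add_monoid ?R)"
    proof (rule group.subgroupI)
      show "Group.group (add_monoid ?R)" by (rule R.a_group)
      fix f assume f: "f \<in> ?I"
      then have "f \<in> carrier ?R" "- f \<in> carrier ?R"
        by (auto simp: path_algebra_def pm_span_def in_keys_iff)
      then have "\<ominus>\<^bsub>?R\<^esub> f = - f"
        by (intro R.minus_equality) (auto simp: path_algebra_def)
      then show "inv\<^bsub>add_monoid ?R\<^esub> f \<in> ?I"
        using f pm_span_uminus by (simp add: a_inv_def)
    qed (auto simp: path_algebra_def intro: pm_span_add, auto simp: pm_span_def, metis empty_subsetI keys_zero)
  next
    fix f x assume "f \<in> ?I" "x \<in> carrier ?R"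
    then show "x \<otimes>\<^bsub>?R\<^esub> f \<in> ?I" "f \<otimes>\<^bsub>?R\<^esub> x \<in> ?I"
      using path_span_mult[of x 0 f 1] path_span_mult[of f 1 x 0]
      by (simp_all add: path_algebra_def)
  qed
qed (auto intro!: pm_span_single arrow_path_in_paths, auto simp: arrow_path_def)

lemma single_in_arrow_ideal:
  assumes "p \<in> paths Q" "path_length p \<ge> 1"
  shows "Poly_Mapping.single p c \<in> arrow_ideal Q"
proof -
  obtain i \<alpha> r where p: "p = (i, \<alpha> # r)" using assms(2) by (cases p; cases "snd p") auto
  note P = path_Cons[OF assms(1)[unfolded p]]
  have "basis_vec (arrow_path Q \<alpha>) \<in> arrow_ideal Q"
    using ring.genideal_self[OF ring_path_algebra, of "(\<lambda>\<alpha>. basis_vec (arrow_path Q \<alpha>)) ` arcs Q"] P(1)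
    unfolding arrow_ideal_def
    by (auto simp: path_algebra_def intro!: pm_span_single arrow_path_in_paths)
  moreover have "Poly_Mapping.single (head Q \<alpha>, r) c \<in> carrier (path_algebra Q)"
    using P(3) by (auto simp: path_algebra_def intro!: pm_span_single)
  ultimately have "Poly_Mapping.single (head Q \<alpha>, r) c \<otimes>\<^bsub>path_algebra Q\<^esub> basis_vec (arrow_path Q \<alpha>)
      \<in> arrow_ideal Q"
    by (rule ideal.I_l_closed[OF arrow_ideal_ideal])
  then show ?thesis using P(4,5) by (simp add: path_mult_single p)
qed

lemma arrow_ideal_square:
  "ideal_prod (path_algebra Q) (arrow_ideal Q) (arrow_ideal Q) =
   pm_span {p \<in> paths Q. path_length p \<ge> 2}" (is "?JJ = ?L")
proof
  show "?JJ \<subseteq> ?L"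
  proof
    fix f assume "f \<in> ?JJ"
    then show "f \<in> ?L"
    proof (induction rule: ideal_prod.induct)
      case (prod f g)
      then show ?case using arrow_ideal_subset path_span_mult[of f 1 g 1]
        by (auto simp: numeral_2_eq_2)
    next
      case (sum f g)
      then show ?case by (auto simp: path_algebra_def intro: pm_span_add)
    qed
  qed
  show "?L \<subseteq> ?JJ"
  proof
    fix f assume f: "f \<in> ?L"
    have single: "Poly_Mapping.single p c \<in> ?JJ" if p: "p \<in> paths Q" "path_length p \<ge> 2" for p c
    proof -
      obtain i \<alpha> r where p': "p = (i, \<alpha> # r)" "r \<noteq> []"
        using p(2) by (cases p; cases "snd p"; cases "tl (snd p)") auto
      note P = path_Cons[OF p(1)[unfolded p']]
      have "Poly_Mapping.single (head Q \<alpha>, r) c \<otimes>\<^bsub>path_algebra Q\<^esub> basis_vec (arrow_path Q \<alpha>) \<in> ?JJ"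
        using P p'(2) arrow_path_in_paths
        by (intro ideal_prod.prod single_in_arrow_ideal) (auto simp: arrow_path_def Suc_le_eq)
      then show ?thesis using P(4,5) by (simp add: path_mult_single p')
    qed
    have sum: "sum F X \<in> ?JJ" if "finite X" "\<And>x. x \<in> X \<Longrightarrow> F x \<in> ?JJ"
      for F and X :: "('v, 'e) qpath set"
      using that
    proof (induction X rule: finite_induct)
      case empty
      have "0 \<in> arrow_ideal Q"
        using additive_subgroup.zero_closed[OF ideal.axioms(1)[OF arrow_ideal_ideal]]
        by (simp add: path_algebra_def)
      then have "0 \<otimes>\<^bsub>path_algebra Q\<^esub> 0 \<in> ?JJ" by (intro ideal_prod.prod)
      then show ?case by (simp add: path_algebra_def pm_mult_def)
    next
      case (insert x X)
      then have "F x \<oplus>\<^bsub>path_algebra Q\<^esub> sum F X \<in> ?JJ" by (intro ideal_prod.sum) auto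
      then show ?case using insert by (simp add: path_algebra_def)
    qed
    have "pm_extend basis_vec f \<in> ?JJ"
      unfolding pm_extend_def using f by (auto intro!: sum single simp: pm_span_def)
    then show "f \<in> ?JJ" by (simp add: pm_extend_basis)
  qed
qed

lemma truncate_path_surj:
  "truncate_path ` carrier (path_algebra Q) = carrier (rad_square_zero_algebra Q)"
proof
  show "truncate_path ` carrier (path_algebra Q) \<subseteq> carrier (rad_square_zero_algebra Q)"
    using truncate_path_ring_hom by (auto simp: ring_hom_def)
  show "carrier (rad_square_zero_algebra Q) \<subseteq> truncate_path ` carrier (path_algebra Q)"
  proof
    fix f assume f: "f \<in> carrier (rad_square_zero_algebra Q)"
    then have "truncate_path f = f"
      by (intro poly_mapping_eqI)
        (auto simp: lookup_truncate_path rad_square_zero_algebra_def pm_span_def in_keys_iff)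
    moreover have "f \<in> carrier (path_algebra Q)"
      using f by (auto simp: path_algebra_def rad_square_zero_algebra_def pm_span_def)
    ultimately show "f \<in> truncate_path ` carrier (path_algebra Q)" by force
  qed
qed

lemma truncate_path_kernel:
  "a_kernel (path_algebra Q) (rad_square_zero_algebra Q) truncate_path =
   ideal_prod (path_algebra Q) (arrow_ideal Q) (arrow_ideal Q)"
  unfolding arrow_ideal_square a_kernel_def'
  by (auto simp: path_algebra_def rad_square_zero_algebra_def pm_span_def poly_mapping_eq_iff
      fun_eq_iff lookup_truncate_path in_keys_iff not_less_eq_eq)
    (metis One_nat_def Suc_1 not_less_eq_eq)+

lemma rad_square_zero_quotient:
  "(path_algebra Q :: ('k::field, ('v, 'e) qpath \<Rightarrow>\<^sub>0 'k) module) Quot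
     ideal_prod (path_algebra Q) (arrow_ideal Q) (arrow_ideal Q) \<simeq>
   (rad_square_zero_algebra Q :: ('k, ('v, 'e) qpath \<Rightarrow>\<^sub>0 'k) module)"
proof -
  interpret ring_hom_ring
      "path_algebra Q :: ('k, ('v, 'e) qpath \<Rightarrow>\<^sub>0 'k) module"
      "rad_square_zero_algebra Q :: ('k, ('v, 'e) qpath \<Rightarrow>\<^sub>0 'k) module" truncate_path
    using ring_path_algebra ring_rad_square_zero_algebra truncate_path_ring_hom
    by (rule ring_hom_ringI2)
  show ?thesis using FactRing_iso[OF truncate_path_surj] by (simp add: truncate_path_kernel)
qed

lemma indecomposable_projective_basis:
  assumes "i \<in> verts Q"
  shows "(\<lambda>x. x \<otimes>\<^bsub>rad_square_zero_algebra Q\<^esub> basis_vec (trivial_path i)) `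
      carrier (rad_square_zero_algebra Q) = pm_span (proj_basis Q i)"
    (is "?f ` _ = ?S")
proof
  have f: "?f x = pm_extend (\<lambda>u. if path_start u = i \<and> path_length u \<le> 1 then basis_vec u else 0) x" for x
    by (simp add: rad_square_zero_algebra_def pm_mult_def)
      (rule pm_extend_cong, auto simp: path_end_def path_comp_def path_start_def)
  show "?f ` carrier (rad_square_zero_algebra Q) \<subseteq> pm_span (proj_basis Q i)"
  proof (clarify, unfold f, rule pm_span_extend)
    fix x assume "x \<in> carrier (rad_square_zero_algebra Q)"
    then show "x \<in> pm_span {p \<in> paths Q. path_length p \<le> 1}" by (simp add: rad_square_zero_algebra_def)
  next
    fix u assume u: "u \<in> {p \<in> paths Q. path_length p \<le> 1}"
    show "(if path_start u = i \<and> path_length u \<le> 1 then basis_vec u else 0) \<in> pm_span (proj_basis Q i)"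
    proof (cases "snd u")
      case Nil
      then show ?thesis by (cases u) (auto simp: proj_basis_def path_start_def intro: pm_span_single)
    next
      case (Cons \<alpha> r)
      then have "u = (fst u, [\<alpha>])" using u by (cases u) auto
      then show ?thesis using u path_Cons(1,2)[of "fst u" \<alpha> "[]"]
        by (auto simp: proj_basis_def path_start_def arrow_path_def intro!: pm_span_single)
    qed
  qed
  show "pm_span (proj_basis Q i) \<subseteq> ?f ` carrier (rad_square_zero_algebra Q)"
  proof
    fix x assume x: "x \<in> ?S"
    have b: "path_start u = i \<and> path_length u \<le> 1" if "u \<in> proj_basis Q i" for u
      using that by (auto simp: proj_basis_def path_start_def arrow_path_def)
    have keys: "\<And>u. u \<in> Poly_Mapping.keys x \<Longrightarrow> path_start u = i \<and> path_length u \<le> 1"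
      using x b unfolding pm_span_def by blast
    have "proj_basis Q i \<subseteq> {p \<in> paths Q. path_length p \<le> 1}"
      using assms trivial_path_in_paths arrow_path_in_paths by (auto simp: proj_basis_def arrow_path_def)
    then have "x \<in> carrier (rad_square_zero_algebra Q)"
      using x by (auto simp: rad_square_zero_algebra_def pm_span_def)
    moreover have "?f x = pm_extend basis_vec x"
      unfolding f using keys by (intro pm_extend_cong) simp
    ultimately show "x \<in> ?f ` carrier (rad_square_zero_algebra Q)"
      by (metis image_eqI pm_extend_basis)
  qed
qed

end

section \<open>Leavitt path algebras\<close>

datatype ('v, 'e) leavitt_gen = Vertex 'v | Arrow 'e | Ghost 'e

definition leavitt_gens :: "('v, 'e) pre_digraph \<Rightarrow> ('v, 'e) leavitt_gen set" where
  "leavitt_gens \<Gamma> = Vertex ` verts \<Gamma> \<union> Arrow ` arcs \<Gamma> \<union> Ghost ` arcs \<Gamma>"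

text \<open>The free algebra: words in the generators, written in the order of multiplication.\<close>

definition free_algebra :: "'g set \<Rightarrow> ('k::field, 'g list \<Rightarrow>\<^sub>0 'k) module" where
  "free_algebra G =
     \<lparr>carrier = pm_span (lists G),
      mult = pm_mult (\<lambda>u v. basis_vec (u @ v)),
      one = basis_vec [],
      zero = 0, add = (+), smult = pm_scale\<rparr>"

text \<open>An element \<open>r\<close> of this set stands for the relation \<open>r = 0\<close>. The first one
  expresses that the identity of the algebra is the sum of the idempotents \<open>e\<^sub>i\<close>.\<close>

definition leavitt_relations ::
    "('v, 'e) pre_digraph \<Rightarrow> (('v, 'e) leavitt_gen list \<Rightarrow>\<^sub>0 'k::field) set" where
  "leavitt_relations \<Gamma> =
     {(\<Sum>i\<in>verts \<Gamma>. basis_vec [Vertex i]) - basis_vec []} \<union>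
     {basis_vec [Vertex i, Vertex j] - (if i = j then basis_vec [Vertex i] else 0) | i j.
        i \<in> verts \<Gamma> \<and> j \<in> verts \<Gamma>} \<union>
     {basis_vec [Vertex (head \<Gamma> \<alpha>), Arrow \<alpha>] - basis_vec [Arrow \<alpha>] | \<alpha>. \<alpha> \<in> arcs \<Gamma>} \<union>
     {basis_vec [Arrow \<alpha>, Vertex (tail \<Gamma> \<alpha>)] - basis_vec [Arrow \<alpha>] | \<alpha>. \<alpha> \<in> arcs \<Gamma>} \<union>
     {basis_vec [Vertex (tail \<Gamma> \<alpha>), Ghost \<alpha>] - basis_vec [Ghost \<alpha>] | \<alpha>. \<alpha> \<in> arcs \<Gamma>} \<union>
     {basis_vec [Ghost \<alpha>, Vertex (head \<Gamma> \<alpha>)] - basis_vec [Ghost \<alpha>] | \<alpha>. \<alpha> \<in> arcs \<Gamma>} \<union>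
     {basis_vec [Arrow \<alpha>, Ghost \<beta>] - (if \<alpha> = \<beta> then basis_vec [Vertex (head \<Gamma> \<alpha>)] else 0)
        | \<alpha> \<beta>. \<alpha> \<in> arcs \<Gamma> \<and> \<beta> \<in> arcs \<Gamma>} \<union>
     {(\<Sum>\<alpha>\<in>{\<alpha> \<in> arcs \<Gamma>. tail \<Gamma> \<alpha> = i}. basis_vec [Ghost \<alpha>, Arrow \<alpha>]) - basis_vec [Vertex i]
        | i. i \<in> verts \<Gamma> \<and> (\<exists>\<alpha>\<in>arcs \<Gamma>. tail \<Gamma> \<alpha> = i)}"

definition leavitt_ideal ::
    "('v, 'e) pre_digraph \<Rightarrow> (('v, 'e) leavitt_gen list \<Rightarrow>\<^sub>0 'k::field) set" where
  "leavitt_ideal \<Gamma> = genideal (free_algebra (leavitt_gens \<Gamma>)) (leavitt_relations \<Gamma>)"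

fun gen_degree :: "('v, 'e) leavitt_gen \<Rightarrow> int" where
  "gen_degree (Vertex i) = 0"
| "gen_degree (Arrow \<alpha>) = 1"
| "gen_degree (Ghost \<alpha>) = - 1"

definition word_degree :: "('v, 'e) leavitt_gen list \<Rightarrow> int" where
  "word_degree w = sum_list (map gen_degree w)"

definition leavitt_path_algebra ::
    "('v, 'e) pre_digraph \<Rightarrow> ('k::field, (('v, 'e) leavitt_gen list \<Rightarrow>\<^sub>0 'k) set) dg" where
  "leavitt_path_algebra \<Gamma> =
     (let F = free_algebra (leavitt_gens \<Gamma>); I = leavitt_ideal \<Gamma>; L = F Quot I in
      \<lparr>carrier = carrier L, mult = mult L, one = one L, zero = zero L, add = add L,
       smult = (\<lambda>c X. \<Union>f\<in>X. I +>\<^bsub>F\<^esub> (c \<odot>\<^bsub>F\<^esub> f)),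
       grade = (\<lambda>n. (\<lambda>f. I +>\<^bsub>F\<^esub> f) ` pm_span {w \<in> lists (leavitt_gens \<Gamma>). word_degree w = n}),
       differential = (\<lambda>_. zero L)\<rparr>)"

definition opposite_quiver :: "('v, 'e) pre_digraph \<Rightarrow> ('v, 'e) pre_digraph" where
  "opposite_quiver Q = \<lparr>verts = verts Q, arcs = arcs Q, tail = head Q, head = tail Q\<rparr>"


section \<open>The projective Leavitt complex\<close>

text \<open>The choice of associated arrows is a function \<open>a\<close> sending \<open>i\<close> to the associated
  arrow terminating at \<open>i\<close>.\<close>

definition associated_choice :: "('v, 'e) pre_digraph \<Rightarrow> ('v \<Rightarrow> 'e) \<Rightarrow> bool" where
  "associated_choice Q a \<longleftrightarrow> (\<forall>i\<in>verts Q. a i \<in> arcs Q \<and> head Q (a i) = i)"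

definition associated_arrows :: "('v, 'e) pre_digraph \<Rightarrow> ('v \<Rightarrow> 'e) \<Rightarrow> 'e set" where
  "associated_arrows Q a = a ` verts Q"

definition associated_pairs ::
    "('v, 'e) pre_digraph \<Rightarrow> ('v \<Rightarrow> 'e) \<Rightarrow> (('v, 'e) qpath \<times> ('v, 'e) qpath) set" where
  "associated_pairs Q a =
     {(p, q). p \<in> paths Q \<and> q \<in> paths Q \<and> path_length p \<ge> 1 \<and> path_length q \<ge> 1 \<and>
        path_start p = path_start q \<and>
        (hd (snd p) \<noteq> hd (snd q) \<or> hd (snd p) \<notin> associated_arrows Q a)} \<union>
     {(p, trivial_path (path_start p)) | p. p \<in> paths Q} \<union>
     {(trivial_path (path_start p), p) | p. p \<in> paths Q}"

definition Lambda ::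
    "('v, 'e) pre_digraph \<Rightarrow> ('v \<Rightarrow> 'e) \<Rightarrow> int \<Rightarrow> 'v \<Rightarrow> (('v, 'e) qpath \<times> ('v, 'e) qpath) set" where
  "Lambda Q a l i = {(p, q) \<in> associated_pairs Q a.
     int (path_length q) - int (path_length p) = l \<and> path_end Q p = i}"

text \<open>The basis vector \<open>(u, (p, q))\<close> stands for \<open>u\<zeta>\<^bsub>(p,q)\<^esub>\<close>.\<close>

type_synonym ('v, 'e) plc_index = "('v, 'e) qpath \<times> (('v, 'e) qpath \<times> ('v, 'e) qpath)"

abbreviation zeta ::
    "('v, 'e) qpath \<Rightarrow> ('v, 'e) qpath \<times> ('v, 'e) qpath \<Rightarrow> (('v, 'e) plc_index \<Rightarrow>\<^sub>0 'k::field)" where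
  "zeta u pq \<equiv> basis_vec (u, pq)"

definition plc_grade ::
    "('v, 'e) pre_digraph \<Rightarrow> ('v \<Rightarrow> 'e) \<Rightarrow> int \<Rightarrow> (('v, 'e) plc_index \<Rightarrow>\<^sub>0 'k::field) set" where
  "plc_grade Q a l = pm_span (\<Union>i\<in>verts Q. proj_basis Q i \<times> Lambda Q a l i)"

definition plc_carrier ::
    "('v, 'e) pre_digraph \<Rightarrow> ('v \<Rightarrow> 'e) \<Rightarrow> (('v, 'e) plc_index \<Rightarrow>\<^sub>0 'k::field) set" where
  "plc_carrier Q a = pm_span (\<Union>l. \<Union>i\<in>verts Q. proj_basis Q i \<times> Lambda Q a l i)"

definition plc_differential ::
    "('v, 'e) pre_digraph \<Rightarrow> (('v, 'e) plc_index \<Rightarrow>\<^sub>0 'k::field) \<Rightarrow> (('v, 'e) plc_index \<Rightarrow>\<^sub>0 'k)" where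
  "plc_differential Q = pm_extend (\<lambda>(u, (p, q)).
     if path_length u \<ge> 1 then 0
     else if path_length p \<ge> 1 then zeta (arrow_path Q (last (snd p))) (path_hat p, q)
     else (\<Sum>\<beta>\<in>{\<beta> \<in> arcs Q. head Q \<beta> = path_start p}.
             zeta (arrow_path Q \<beta>) (trivial_path (tail Q \<beta>), path_comp q (arrow_path Q \<beta>))))"

definition plc_lact ::
    "('v, 'e) pre_digraph \<Rightarrow> (('v, 'e) qpath \<Rightarrow>\<^sub>0 'k::field) \<Rightarrow>
     (('v, 'e) plc_index \<Rightarrow>\<^sub>0 'k) \<Rightarrow> (('v, 'e) plc_index \<Rightarrow>\<^sub>0 'k)" where
  "plc_lact Q x = pm_extend (\<lambda>(u, pq).
     pm_extend (\<lambda>v. zeta v pq) (x \<otimes>\<^bsub>rad_square_zero_algebra Q\<^esub> basis_vec u))"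

text \<open>The generators of \<open>L\<^sub>k(Q\<^bsup>op\<^esup>)\<close> corresponding to \<open>\<alpha>\<^bsup>op\<^esup>\<close> and \<open>(\<alpha>\<^bsup>op\<^esup>)\<^sup>*\<close>
  are \<open>Arrow \<alpha>\<close> and \<open>Ghost \<alpha>\<close>; \<open>tail\<close> and \<open>head\<close> refer to \<open>Q\<close>.\<close>

fun plc_gen_basis ::
    "('v, 'e) pre_digraph \<Rightarrow> ('v \<Rightarrow> 'e) \<Rightarrow> ('v, 'e) leavitt_gen \<Rightarrow> ('v, 'e) plc_index \<Rightarrow>
     (('v, 'e) plc_index \<Rightarrow>\<^sub>0 'k::field)" where
  "plc_gen_basis Q a (Vertex j) (u, (p, q)) =
     (if j = path_end Q q then zeta u (p, q) else 0)"
| "plc_gen_basis Q a (Arrow \<alpha>) (u, (p, q)) =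
     (if path_length q = 0 \<and> path_length p \<ge> 1 \<and> hd (snd p) = \<alpha> \<and> \<alpha> \<in> associated_arrows Q a
      then zeta u (path_tilde Q p, trivial_path (head Q \<alpha>)) -
           (\<Sum>\<beta>\<in>{\<beta> \<in> arcs Q. head Q \<beta> = head Q \<alpha> \<and> \<beta> \<noteq> \<alpha>}.
              zeta u (path_comp (path_tilde Q p) (arrow_path Q \<beta>), arrow_path Q \<beta>))
      else if tail Q \<alpha> = path_end Q q then zeta u (p, path_comp (arrow_path Q \<alpha>) q)
      else 0)"
| "plc_gen_basis Q a (Ghost \<alpha>) (u, (p, q)) =
     (if path_length q \<ge> 1
      then (if last (snd q) = \<alpha> then zeta u (p, path_hat q) else 0)
      else if path_start p = head Q \<alpha>
      then zeta u (path_comp p (arrow_path Q \<alpha>), trivial_path (tail Q \<alpha>))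
      else 0)"

definition plc_gen_act ::
    "('v, 'e) pre_digraph \<Rightarrow> ('v \<Rightarrow> 'e) \<Rightarrow> (('v, 'e) plc_index \<Rightarrow>\<^sub>0 'k::field) \<Rightarrow>
     ('v, 'e) leavitt_gen \<Rightarrow> (('v, 'e) plc_index \<Rightarrow>\<^sub>0 'k)" where
  "plc_gen_act Q a z g = pm_extend (plc_gen_basis Q a g) z"

definition plc_free_act ::
    "('v, 'e) pre_digraph \<Rightarrow> ('v \<Rightarrow> 'e) \<Rightarrow> (('v, 'e) plc_index \<Rightarrow>\<^sub>0 'k::field) \<Rightarrow>
     (('v, 'e) leavitt_gen list \<Rightarrow>\<^sub>0 'k) \<Rightarrow> (('v, 'e) plc_index \<Rightarrow>\<^sub>0 'k)" where
  "plc_free_act Q a z = pm_extend (\<lambda>w. foldl (plc_gen_act Q a) z w)"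

text \<open>The action of a residue class is that of any of its representatives.\<close>

definition plc_ract ::
    "('v, 'e) pre_digraph \<Rightarrow> ('v \<Rightarrow> 'e) \<Rightarrow> (('v, 'e) plc_index \<Rightarrow>\<^sub>0 'k::field) \<Rightarrow>
     (('v, 'e) leavitt_gen list \<Rightarrow>\<^sub>0 'k) set \<Rightarrow> (('v, 'e) plc_index \<Rightarrow>\<^sub>0 'k)" where
  "plc_ract Q a z X = the_elem (plc_free_act Q a z ` X)"

definition projective_leavitt_complex ::
    "('v, 'e) pre_digraph \<Rightarrow> ('v \<Rightarrow> 'e) \<Rightarrow>
     ('k::field, ('v, 'e) qpath \<Rightarrow>\<^sub>0 'k, (('v, 'e) leavitt_gen list \<Rightarrow>\<^sub>0 'k) set,
      ('v, 'e) plc_index \<Rightarrow>\<^sub>0 'k) dg_bimod" where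
  "projective_leavitt_complex Q a =
     \<lparr>carrier = plc_carrier Q a,
      mult = undefined, one = undefined, zero = 0, add = (+), smult = pm_scale,
      grade = plc_grade Q a, differential = plc_differential Q,
      lact = plc_lact Q, ract = plc_ract Q a\<rparr>"

end

theory Submission
  imports Defs
begin

text \<open>Let \<open>E\<close> be the span of the idempotents \<open>e\<^sub>i\<close> and \<open>B\<close> the Leavitt path algebra of the
  opposite quiver. The key is to regard the complex \<open>P\<close> as \<open>A \<otimes>\<^sub>E B\<close>, the vector
  \<open>u\<zeta>\<close> at \<open>(p, q)\<close> being \<open>u \<otimes> p\<^sup>*q\<close>. In this picture \<open>B\<close> acts by right
  multiplication, and the differential is \<open>u \<otimes> b \<mapsto> \<Sum> u\<beta> \<otimes> \<beta>b\<close>, summed over all arrows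
  (on the right hand factor \<open>\<beta>\<close> is the generator belonging to the opposite arrow). The vectors
  with \<open>u\<close> trivial span the top of \<open>P\<close>, a copy of \<open>B\<close>; those with \<open>u\<close> an arrow span the
  radical. The relation \<open>\<Sum> \<beta>\<^sup>*\<beta> = e\<^sub>i\<close> over the arrows ending at \<open>i\<close> together with
  \<open>\<beta>\<gamma>\<^sup>* = \<delta>\<close> says that the differential maps the top bijectively onto the radical
  (\<open>contract_differential\<close>, \<open>differential_contract\<close>).

  An \<open>A\<close>-linear map is determined on the top, where it is \<open>f\<^sub>0 + d g\<close> with \<open>f\<^sub>0\<close> and \<open>g\<close>
  mapping the top to itself. Put \<open>\<Theta> f\<^sub>0 b = \<Sum> \<beta>\<^sup>* f\<^sub>0 (\<beta>b)\<close>. In degree \<open>n\<close> the differential of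
  the endomorphism complex sends \<open>(f\<^sub>0, g)\<close> to \<open>(0, f\<^sub>0 \<mp> \<Theta> f\<^sub>0)\<close>, with the sign of \<open>n\<close>.
  Its cohomology is therefore the kernel of \<open>1 \<mp> \<Theta>\<close> plus the cokernel of such a map.
  An element of the kernel commutes up to sign with left multiplication by all \<open>\<beta>\<close>, hence by all
  \<open>\<beta>\<^sup>*\<close>, so it is right multiplication by its value at the unit (\<open>cocycle_top_zero\<close>).
  The cokernel is zero: the equation \<open>h \<mp> \<Theta> h = g\<close> is solved by recursion on the basis of
  the elements \<open>p\<^sup>*q\<close>, first along \<open>q\<close> and then along \<open>p\<close> (\<open>homotopy_equation\<close>).

  That the elements \<open>p\<^sup>*q\<close> for associated pairs form a basis of \<open>B\<close> is proved through the
  complex itself. They span because the normal form of a product can be computed by acting on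
  the complex (\<open>normal_form_act_unit\<close>), and the action sends them to different basis vectors
  (\<open>act_unit_normal_form\<close>). The injection of \<open>B\<close> into \<open>P\<close> obtained in this way also shows
  that the grading of \<open>B\<close> is a direct sum decomposition.

  What remains is general: opposite and endomorphism algebras of dg structures are dg algebras,
  right multiplication is a homomorphism between them, and a quasi-isomorphism in one direction
  gives a zigzag between copies on the sum of the two types.\<close>

section \<open>Homogeneous components and signed bilinear maps\<close>

lemma scalars_simps [simp]:
  "carrier scalars = UNIV" "mult scalars = (*)" "one scalars = 1" "zero scalars = 0" "add scalars = (+)"
  by (simp_all add: scalars_def)

lemma cring_scalars: "cring (scalars :: 'k::field ring)"
proof (rule cringI)
  show "abelian_group (scalars :: 'k ring)"
    by (rule abelian_groupI) (auto simp: algebra_simps intro: exI[of _ "- x" for x])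
  show "Group.comm_monoid (scalars :: 'k ring)"
    by (rule comm_monoidI) (auto simp: algebra_simps)
qed (auto simp: algebra_simps)

lemma koszul_sign_add: "koszul_sign (m + n) = koszul_sign m * koszul_sign n"
  by (simp add: koszul_sign_def power_int_add)

lemma koszul_sign_parity: "koszul_sign n = (if even n then 1 else - 1)"
  by (simp add: koszul_sign_def power_int_minus_left)

lemma koszul_sign_square [simp]: "koszul_sign n * koszul_sign n = 1"
  by (simp add: koszul_sign_parity)

lemma koszul_sign_cancel [simp]: "koszul_sign n * (koszul_sign n * x) = x"
  by (simp add: koszul_sign_parity)

lemma additive_finsum:
  assumes "abelian_group C" "abelian_group E"
    and closed: "\<And>x. x \<in> carrier C \<Longrightarrow> f x \<in> carrier E"
    and add: "\<And>x y. x \<in> carrier C \<Longrightarrow> y \<in> carrier C \<Longrightarrow> f (x \<oplus>\<^bsub>C\<^esub> y) = f x \<oplus>\<^bsub>E\<^esub> f y"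
    and "c \<in> N \<rightarrow> carrier C"
  shows "f (finsum C c N) = finsum E (\<lambda>n. f (c n)) N"
proof -
  interpret C: abelian_group C by fact
  interpret E: abelian_group E by fact
  have 0: "f \<zero>\<^bsub>C\<^esub> = \<zero>\<^bsub>E\<^esub>"
    using add[of "\<zero>\<^bsub>C\<^esub>" "\<zero>\<^bsub>C\<^esub>"] closed[of "\<zero>\<^bsub>C\<^esub>"] E.add.r_cancel_one' by auto
  from assms(5) show ?thesis
    by (induction N rule: infinite_finite_induct)
      (auto simp: 0 add closed C.finsum_closed E.finsum_insert C.finsum_insert Pi_def)
qed

text \<open>The existence half of a direct sum decomposition, for structures whose directness is yet to
  be proved.\<close>

lemma hom_decomp_finsum:
  assumes "abelian_group C" and closed: "\<And>n. grade C n \<subseteq> carrier C"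
    and "finite N" "\<And>n. c n \<in> grade C n" "\<And>n. n \<notin> N \<Longrightarrow> c n = \<zero>\<^bsub>C\<^esub>" "x = finsum C c N"
  shows "hom_decomp C x c"
proof -
  interpret abelian_group C by fact
  have "{n. c n \<noteq> \<zero>\<^bsub>C\<^esub>} \<subseteq> N" using assms(5) by auto
  moreover from this have "finsum C c {n. c n \<noteq> \<zero>\<^bsub>C\<^esub>} = finsum C c N"
    using assms(3,4) closed by (intro add.finprod_mono_neutral_cong_left) auto
  ultimately show ?thesis
    using assms(3,4,6) finite_subset unfolding hom_decomp_def by auto
qed

context dg_space
begin

lemma smult_closed' [simp]: "x \<in> carrier C \<Longrightarrow> c \<odot> x \<in> carrier C"
  by (rule smult_closed) auto

lemma smult_add: "x \<in> carrier C \<Longrightarrow> y \<in> carrier C \<Longrightarrow> c \<odot> (x \<oplus> y) = c \<odot> x \<oplus> c \<odot> y"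
  by (rule smult_r_distr) auto

lemma smult_add_left: "x \<in> carrier C \<Longrightarrow> (c + d) \<odot> x = c \<odot> x \<oplus> d \<odot> x"
  using smult_l_distr[of c d x] by simp

lemma smult_smult: "x \<in> carrier C \<Longrightarrow> c \<odot> (d \<odot> x) = (c * d) \<odot> x"
  using smult_assoc1[of c d x] by simp

lemma smult_1 [simp]: "x \<in> carrier C \<Longrightarrow> 1 \<odot> x = x"
  using smult_one[of x] by simp

lemma smult_0 [simp]: "x \<in> carrier C \<Longrightarrow> 0 \<odot> x = \<zero>"
  using smult_l_null[of x] by simp

lemma smult_zero [simp]: "c \<odot> \<zero> = \<zero>"
  using smult_r_null[of c] by simp

lemma smult_minus_1: "x \<in> carrier C \<Longrightarrow> (- 1) \<odot> x = \<ominus> x"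
  using smult_add_left[of x "-1" 1] by (metis smult_1 smult_closed' minus_equality add.left_inverse smult_0)

lemma minus_eq_smult: "x \<in> carrier C \<Longrightarrow> y \<in> carrier C \<Longrightarrow> x \<ominus> y = x \<oplus> (- 1) \<odot> y"
  by (simp add: minus_eq smult_minus_1)

lemma grade_closed: "x \<in> grade C n \<Longrightarrow> x \<in> carrier C"
  using submoduleE(1)[OF grade_submodule] by blast

lemma grade_add: "x \<in> grade C n \<Longrightarrow> y \<in> grade C n \<Longrightarrow> x \<oplus> y \<in> grade C n"
  using submoduleE(5)[OF grade_submodule] by blast

lemma grade_smult: "x \<in> grade C n \<Longrightarrow> c \<odot> x \<in> grade C n"
  using submoduleE(4)[OF grade_submodule] by auto

lemma grade_zero [simp]: "\<zero> \<in> grade C n"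
  using subgroup.one_closed[OF submodule.axioms(1)[OF grade_submodule]] by simp

lemma differential_zero [simp]: "differential C \<zero> = \<zero>"
  using differential_smult[of "\<zero>" 0] by (simp add: differential_closed)

lemma hom_decomp_superset:
  assumes "hom_decomp C x c" "finite N" "{n. c n \<noteq> \<zero>} \<subseteq> N"
  shows "x = finsum C c N"
  using assms unfolding hom_decomp_def
  by (auto intro!: add.finprod_mono_neutral_cong_left intro: grade_closed)

lemma hom_decompI:
  assumes "finite N" "\<And>n. c n \<in> grade C n" "\<And>n. n \<notin> N \<Longrightarrow> c n = \<zero>" "x = finsum C c N"
  shows "hom_decomp C x c"
  by (rule hom_decomp_finsum[OF abelian_group_axioms _ assms]) (auto intro: grade_closed)

lemma hom_comp_eq: "x \<in> carrier C \<Longrightarrow> hom_decomp C x c \<Longrightarrow> hom_comp C x = c"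
  unfolding hom_comp_def by (rule the1_equality[OF grade_direct_sum])

lemma hom_decomp_unique: "x \<in> carrier C \<Longrightarrow> hom_decomp C x c \<Longrightarrow> hom_decomp C x c' \<Longrightarrow> c = c'"
  using grade_direct_sum by blast

lemma hom_decomp_hom_comp: "x \<in> carrier C \<Longrightarrow> hom_decomp C x (hom_comp C x)"
  unfolding hom_comp_def by (rule theI'[OF grade_direct_sum])

lemma hom_comp_grade: "x \<in> carrier C \<Longrightarrow> hom_comp C x n \<in> grade C n"
  using hom_decomp_hom_comp by (auto simp: hom_decomp_def)

lemma finite_degrees: "x \<in> carrier C \<Longrightarrow> finite (degrees C x)"
  using hom_decomp_hom_comp by (auto simp: hom_decomp_def degrees_def)

lemma finsum_hom_comp:
  "x \<in> carrier C \<Longrightarrow> finite N \<Longrightarrow> degrees C x \<subseteq> N \<Longrightarrow> finsum C (hom_comp C x) N = x"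
  using hom_decomp_superset[OF hom_decomp_hom_comp] by (auto simp: degrees_def)

lemma hom_comp_homogeneous:
  assumes "x \<in> grade C m"
  shows "hom_comp C x = (\<lambda>n. if n = m then x else \<zero>)"
  using assms
  by (intro hom_comp_eq hom_decompI[of "{m}"]) (auto simp: grade_closed finsum_insert)

lemma degrees_homogeneous: "x \<in> grade C m \<Longrightarrow> degrees C x \<subseteq> {m}"
  by (auto simp: degrees_def hom_comp_homogeneous)

lemma hom_comp_add:
  assumes x: "x \<in> carrier C" and y: "y \<in> carrier C"
  shows "hom_comp C (x \<oplus> y) = (\<lambda>n. hom_comp C x n \<oplus> hom_comp C y n)"
proof (rule hom_comp_eq)
  let ?N = "degrees C x \<union> degrees C y"
  show "hom_decomp C (x \<oplus> y) (\<lambda>n. hom_comp C x n \<oplus> hom_comp C y n)"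
  proof (rule hom_decompI[of ?N])
    show "x \<oplus> y = (\<Oplus>n\<in>?N. hom_comp C x n \<oplus> hom_comp C y n)"
      using x y by (subst finsum_addf)
        (auto simp: finsum_hom_comp finite_degrees hom_comp_grade[THEN grade_closed])
  qed (use x y in \<open>auto simp: finite_degrees hom_comp_grade grade_add\<close>, auto simp: degrees_def)
qed (use x y in auto)

text \<open>Signs are defined on homogeneous elements only. All identities below are additive in each
  argument, so this rule reduces them to the case in which every sign is a scalar.\<close>

lemma homogeneous_induct [consumes 1, case_names zero homogeneous add]:
  assumes "x \<in> carrier C" and "P \<zero>" and "\<And>n x. x \<in> grade C n \<Longrightarrow> P x"
    and "\<And>x y. x \<in> carrier C \<Longrightarrow> y \<in> carrier C \<Longrightarrow> P x \<Longrightarrow> P y \<Longrightarrow> P (x \<oplus> y)"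
  shows "P x"
proof -
  have g: "hom_comp C x n \<in> grade C n" for n using assms(1) hom_comp_grade by blast
  have "P (finsum C (hom_comp C x) N)" if "finite N" for N
    using that
  proof induction
    case empty
    show ?case using assms(2) by simp
  next
    case (insert n N)
    have "finsum C (hom_comp C x) (insert n N) = hom_comp C x n \<oplus> finsum C (hom_comp C x) N"
      using insert g grade_closed by (intro finsum_insert) (auto simp: Pi_def)
    moreover have "P (hom_comp C x n \<oplus> finsum C (hom_comp C x) N)"
      by (rule assms(4)) (use g grade_closed insert in \<open>auto intro!: finsum_closed assms(3)[OF g] simp: Pi_def\<close>)
    ultimately show ?case by simp
  qed
  from this[OF finite_degrees[OF assms(1)]] show ?thesis
    using assms(1) by (simp add: finsum_hom_comp finite_degrees)
qed

end

locale bilinear_dg = C: dg_space C + D: dg_space D + E: dg_space E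
  for C :: "('k::field, 'a, 'm) dg_scheme" and D :: "('k, 'b, 'n) dg_scheme"
    and E :: "('k, 'c, 'o) dg_scheme" +
  fixes f :: "'a \<Rightarrow> 'b \<Rightarrow> 'c"
  assumes closed: "\<lbrakk>x \<in> carrier C; y \<in> carrier D\<rbrakk> \<Longrightarrow> f x y \<in> carrier E"
    and add_left: "\<lbrakk>x \<in> carrier C; x' \<in> carrier C; y \<in> carrier D\<rbrakk> \<Longrightarrow> f (x \<oplus>\<^bsub>C\<^esub> x') y = f x y \<oplus>\<^bsub>E\<^esub> f x' y"
    and add_right: "\<lbrakk>x \<in> carrier C; y \<in> carrier D; y' \<in> carrier D\<rbrakk> \<Longrightarrow> f x (y \<oplus>\<^bsub>D\<^esub> y') = f x y \<oplus>\<^bsub>E\<^esub> f x y'"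
    and smult_left: "\<lbrakk>x \<in> carrier C; y \<in> carrier D\<rbrakk> \<Longrightarrow> f (c \<odot>\<^bsub>C\<^esub> x) y = c \<odot>\<^bsub>E\<^esub> f x y"
    and smult_right: "\<lbrakk>x \<in> carrier C; y \<in> carrier D\<rbrakk> \<Longrightarrow> f x (c \<odot>\<^bsub>D\<^esub> y) = c \<odot>\<^bsub>E\<^esub> f x y"
begin

abbreviation "S \<equiv> signed_extension C D E f"

lemma zero_left [simp]: "y \<in> carrier D \<Longrightarrow> f \<zero>\<^bsub>C\<^esub> y = \<zero>\<^bsub>E\<^esub>"
  using smult_left[of "\<zero>\<^bsub>C\<^esub>" y 0] closed by simp

lemma zero_right [simp]: "x \<in> carrier C \<Longrightarrow> f x \<zero>\<^bsub>D\<^esub> = \<zero>\<^bsub>E\<^esub>"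
  using smult_right[of x "\<zero>\<^bsub>D\<^esub>" 0] closed by simp

lemma term_closed:
  "x \<in> carrier C \<Longrightarrow> y \<in> carrier D \<Longrightarrow> c \<odot>\<^bsub>E\<^esub> f (hom_comp C x m) (hom_comp D y n) \<in> carrier E"
  by (simp add: closed C.hom_comp_grade[THEN C.grade_closed] D.hom_comp_grade[THEN D.grade_closed])

text \<open>The index set in \<open>signed_extension\<close> depends on the arguments, so it changes when
  they are added. By bilinearity the terms outside of it vanish, and a common larger index set
  can be used.\<close>

lemma signed_superset:
  assumes "x \<in> carrier C" "y \<in> carrier D" "finite X" "finite Y" "degrees C x \<subseteq> X" "degrees D y \<subseteq> Y"
  shows "S x y =
    finsum E (\<lambda>(m, n). koszul_sign (m * n) \<odot>\<^bsub>E\<^esub> f (hom_comp C x m) (hom_comp D y n)) (X \<times> Y)"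
  unfolding signed_extension_def
proof (rule E.add.finprod_mono_neutral_cong_left)
  fix i assume i: "i \<in> X \<times> Y - degrees C x \<times> degrees D y"
  obtain m n where "i = (m, n)" by fastforce
  then have "hom_comp C x m = \<zero>\<^bsub>C\<^esub> \<or> hom_comp D y n = \<zero>\<^bsub>D\<^esub>" using i by (auto simp: degrees_def)
  then show "(case i of (m, n) \<Rightarrow> koszul_sign (m * n) \<odot>\<^bsub>E\<^esub> f (hom_comp C x m) (hom_comp D y n)) = \<zero>\<^bsub>E\<^esub>"
    using assms C.hom_comp_grade[THEN C.grade_closed] D.hom_comp_grade[THEN D.grade_closed]
    by (auto simp: \<open>i = (m, n)\<close>)
qed (use assms term_closed in auto)

lemma signed_closed: "x \<in> carrier C \<Longrightarrow> y \<in> carrier D \<Longrightarrow> S x y \<in> carrier E"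
  unfolding signed_extension_def by (rule E.finsum_closed) (auto simp: term_closed)

lemma signed_add_left:
  assumes "x \<in> carrier C" "x' \<in> carrier C" "y \<in> carrier D"
  shows "S (x \<oplus>\<^bsub>C\<^esub> x') y = S x y \<oplus>\<^bsub>E\<^esub> S x' y"
proof -
  let ?X = "degrees C x \<union> degrees C x' \<union> degrees C (x \<oplus>\<^bsub>C\<^esub> x')"
  let ?g = "\<lambda>x (m, n). koszul_sign (m * n) \<odot>\<^bsub>E\<^esub> f (hom_comp C x m) (hom_comp D y n)"
  have *: "S z y = finsum E (?g z) (?X \<times> degrees D y)" if "z \<in> {x, x', x \<oplus>\<^bsub>C\<^esub> x'}" for z
    using that assms by (intro signed_superset) (auto simp: C.finite_degrees D.finite_degrees)
  have "finsum E (?g (x \<oplus>\<^bsub>C\<^esub> x')) (?X \<times> degrees D y) = finsum E (\<lambda>i. ?g x i \<oplus>\<^bsub>E\<^esub> ?g x' i) (?X \<times> degrees D y)"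
    using assms C.hom_comp_grade[THEN C.grade_closed] D.hom_comp_grade[THEN D.grade_closed]
    by (intro E.finsum_cong') (auto simp: C.hom_comp_add add_left E.smult_add closed)
  also have "\<dots> = finsum E (?g x) (?X \<times> degrees D y) \<oplus>\<^bsub>E\<^esub> finsum E (?g x') (?X \<times> degrees D y)"
    using assms term_closed by (intro E.finsum_addf) auto
  finally show ?thesis by (simp add: *)
qed

lemma signed_add_right:
  assumes "x \<in> carrier C" "y \<in> carrier D" "y' \<in> carrier D"
  shows "S x (y \<oplus>\<^bsub>D\<^esub> y') = S x y \<oplus>\<^bsub>E\<^esub> S x y'"
proof -
  let ?Y = "degrees D y \<union> degrees D y' \<union> degrees D (y \<oplus>\<^bsub>D\<^esub> y')"
  let ?g = "\<lambda>y (m, n). koszul_sign (m * n) \<odot>\<^bsub>E\<^esub> f (hom_comp C x m) (hom_comp D y n)"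
  have *: "S x z = finsum E (?g z) (degrees C x \<times> ?Y)" if "z \<in> {y, y', y \<oplus>\<^bsub>D\<^esub> y'}" for z
    using that assms by (intro signed_superset) (auto simp: C.finite_degrees D.finite_degrees)
  have "finsum E (?g (y \<oplus>\<^bsub>D\<^esub> y')) (degrees C x \<times> ?Y) = finsum E (\<lambda>i. ?g y i \<oplus>\<^bsub>E\<^esub> ?g y' i) (degrees C x \<times> ?Y)"
    using assms C.hom_comp_grade[THEN C.grade_closed] D.hom_comp_grade[THEN D.grade_closed]
    by (intro E.finsum_cong') (auto simp: D.hom_comp_add add_right E.smult_add closed)
  also have "\<dots> = finsum E (?g y) (degrees C x \<times> ?Y) \<oplus>\<^bsub>E\<^esub> finsum E (?g y') (degrees C x \<times> ?Y)"
    using assms term_closed by (intro E.finsum_addf) auto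
  finally show ?thesis by (simp add: *)
qed

lemma signed_homogeneous:
  assumes "x \<in> grade C m" "y \<in> grade D n"
  shows "S x y = koszul_sign (m * n) \<odot>\<^bsub>E\<^esub> f x y"
proof -
  have "S x y = finsum E (\<lambda>(m, n). koszul_sign (m * n) \<odot>\<^bsub>E\<^esub> f (hom_comp C x m) (hom_comp D y n)) ({m} \<times> {n})"
    using assms by (intro signed_superset)
      (auto simp: C.grade_closed D.grade_closed dest: C.degrees_homogeneous D.degrees_homogeneous)
  then show ?thesis
    using assms by (simp add: C.hom_comp_homogeneous D.hom_comp_homogeneous closed C.grade_closed D.grade_closed)
qed

lemma signed_zero_left [simp]: "y \<in> carrier D \<Longrightarrow> S \<zero>\<^bsub>C\<^esub> y = \<zero>\<^bsub>E\<^esub>"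
  using signed_add_left[of "\<zero>\<^bsub>C\<^esub>" "\<zero>\<^bsub>C\<^esub>" y] signed_closed[of "\<zero>\<^bsub>C\<^esub>" y] E.add.r_cancel_one' by auto

lemma signed_zero_right [simp]: "x \<in> carrier C \<Longrightarrow> S x \<zero>\<^bsub>D\<^esub> = \<zero>\<^bsub>E\<^esub>"
  using signed_add_right[of x "\<zero>\<^bsub>D\<^esub>" "\<zero>\<^bsub>D\<^esub>"] signed_closed[of x "\<zero>\<^bsub>D\<^esub>"] E.add.r_cancel_one' by auto

lemma signed_smult_left:
  assumes "x \<in> carrier C" "y \<in> carrier D"
  shows "S (c \<odot>\<^bsub>C\<^esub> x) y = c \<odot>\<^bsub>E\<^esub> S x y"
  using assms
proof (induction x rule: C.homogeneous_induct)
  case (homogeneous m x)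
  show ?case using homogeneous(2)
  proof (induction y rule: D.homogeneous_induct)
    case (homogeneous n y)
    show ?case
      using \<open>x \<in> grade C m\<close> homogeneous C.grade_smult
      by (simp add: signed_homogeneous[of _ m _ n] smult_left C.grade_closed D.grade_closed
          E.smult_smult closed mult.commute)
  qed (use homogeneous(1) in
      \<open>simp_all add: C.grade_closed signed_add_right E.smult_add signed_closed\<close>)
qed (simp_all add: C.smult_add signed_add_left E.smult_add signed_closed)

lemma signed_smult_right:
  assumes "x \<in> carrier C" "y \<in> carrier D"
  shows "S x (c \<odot>\<^bsub>D\<^esub> y) = c \<odot>\<^bsub>E\<^esub> S x y"
  using assms
proof (induction x rule: C.homogeneous_induct)
  case (homogeneous m x)
  show ?case using homogeneous(2)
  proof (induction y rule: D.homogeneous_induct)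
    case (homogeneous n y)
    show ?case
      using \<open>x \<in> grade C m\<close> homogeneous D.grade_smult
      by (simp add: signed_homogeneous[of _ m _ n] smult_right C.grade_closed D.grade_closed
          E.smult_smult closed mult.commute)
  qed (use homogeneous(1) in
      \<open>simp_all add: C.grade_closed signed_add_right E.smult_add D.smult_add signed_closed\<close>)
qed (simp_all add: signed_add_left E.smult_add signed_closed)

end

section \<open>The opposite dg algebra\<close>

lemma dg_spaceI:
  assumes "Module.module scalars C"
    and "\<And>n. submodule (grade C n) scalars C"
    and ex: "\<And>x. x \<in> carrier C \<Longrightarrow> \<exists>c. hom_decomp C x c"
    and unique: "\<And>x c c'. x \<in> carrier C \<Longrightarrow> hom_decomp C x c \<Longrightarrow> hom_decomp C x c' \<Longrightarrow> c = c'"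
    and "\<And>x. x \<in> carrier C \<Longrightarrow> differential C x \<in> carrier C"
    and "\<And>x y. \<lbrakk>x \<in> carrier C; y \<in> carrier C\<rbrakk> \<Longrightarrow>
          differential C (x \<oplus>\<^bsub>C\<^esub> y) = differential C x \<oplus>\<^bsub>C\<^esub> differential C y"
    and "\<And>c x. x \<in> carrier C \<Longrightarrow> differential C (c \<odot>\<^bsub>C\<^esub> x) = c \<odot>\<^bsub>C\<^esub> differential C x"
    and "\<And>n x. x \<in> grade C n \<Longrightarrow> differential C x \<in> grade C (n + 1)"
    and "\<And>x. x \<in> carrier C \<Longrightarrow> differential C (differential C x) = \<zero>\<^bsub>C\<^esub>"
  shows "dg_space C"
  by (intro dg_space.intro dg_space_axioms.intro ex_ex1I) (fact assms | erule (2) unique | erule ex)+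

text \<open>Opposite and endomorphism algebras arise by updating a record field other than those from
  which homogeneous components are computed.\<close>

lemma hom_decomp_cong:
  assumes "carrier C' = carrier C" "zero C' = zero C" "add C' = add C" "grade C' = grade C"
  shows "hom_decomp C' = hom_decomp C"
proof -
  have "finsum C' = (finsum C :: (int \<Rightarrow> _) \<Rightarrow> _)"
    using assms by (intro ext) (simp add: finsum_def finprod_def)
  then show ?thesis using assms by (intro ext) (simp add: hom_decomp_def)
qed

lemma dg_space_cong:
  fixes C C' :: "('k::field, 'a) dg"
  assumes "dg_space C" "carrier C' = carrier C" "zero C' = zero C" "add C' = add C"
    "smult C' = smult C" "grade C' = grade C" "differential C' = differential C"
  shows "dg_space C'"
proof -
  interpret dg_space C by fact
  have mono: "add_monoid C' = add_monoid C" using assms by simp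
  have ag: "abelian_group C'" 
    by (rule comm_group_abelian_groupI) (use add.comm_group_axioms mono a_comm_group in simp)
  have mod: "Module.module scalars C'"
    by (rule moduleI) (use assms ag cring_scalars in \<open>auto simp: smult_l_distr smult_r_distr smult_add_left smult_add smult_smult\<close>)
  have sub: "submodule (grade C' n) scalars C'" for n
    using grade_submodule[of n] assms mono by (simp add: submodule_def submodule_axioms_def)
  show ?thesis
    by (rule dg_spaceI[OF mod sub])
      (use assms grade_direct_sum[THEN ex1_implies_ex] in \<open>auto intro: hom_decomp_unique simp: hom_decomp_cong[OF assms(2,3,4,6)]
        differential_closed differential_add differential_smult differential_grade differential_square\<close>)
qed

lemma (in dg_algebra) bilinear_opposite: "bilinear_dg C C C (\<lambda>x y. y \<otimes> x)"
  by unfold_locales (auto simp: l_distr r_distr smult_mult_left smult_mult_right)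

lemma dg_opposite_simps:
  "carrier (dg_opposite C) = carrier C" "zero (dg_opposite C) = zero C" "add (dg_opposite C) = add C"
  "smult (dg_opposite C) = smult C" "one (dg_opposite C) = one C" "grade (dg_opposite C) = grade C"
  "differential (dg_opposite C) = differential C"
  "mult (dg_opposite C) = signed_extension C C C (\<lambda>x y. y \<otimes>\<^bsub>C\<^esub> x)"
  by (simp_all add: dg_opposite_def)

text \<open>On homogeneous elements of degrees \<open>l\<close>, \<open>m\<close>, \<open>n\<close> both bracketings of a product are
  \<open>zyx\<close> with the sign of \<open>lm + ln + mn\<close>. In the Leibniz rule the two summands of
  \<open>d(yx)\<close> exchange their roles, and the degree shift by \<open>d\<close> accounts for the
  difference of the signs.\<close>

lemma dg_algebra_opposite:
  fixes C :: "('k::field, 'a) dg"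
  assumes "dg_algebra C"
  shows "dg_algebra (dg_opposite C)"
proof -
  interpret dg_algebra C by fact
  interpret opp: bilinear_dg C C C "\<lambda>x y. y \<otimes>\<^bsub>C\<^esub> x"
    by (rule bilinear_opposite)
  let ?C = "dg_opposite C"
  note simps = dg_opposite_simps[of C]
  have space: "dg_space ?C"
    by (rule dg_space_cong[OF dg_space_axioms]) (simp_all add: simps)
  interpret D: dg_space ?C by (rule space)
  note hom = opp.signed_homogeneous
  have one: "opp.S \<one>\<^bsub>C\<^esub> x = x" "opp.S x \<one>\<^bsub>C\<^esub> = x" if "x \<in> carrier C" for x
    using that
    by (induction x rule: homogeneous_induct)
      (auto simp: hom[OF one_grade] hom[OF _ one_grade] grade_closed koszul_sign_parity
        opp.signed_add_left opp.signed_add_right)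
  have assoc: "opp.S (opp.S x y) z = opp.S x (opp.S y z)"
    if "x \<in> carrier C" "y \<in> carrier C" "z \<in> carrier C" for x y z
    using that
  proof (induction x rule: homogeneous_induct)
    case (homogeneous l x)
    note x = \<open>x \<in> grade C l\<close> grade_closed[OF \<open>x \<in> grade C l\<close>]
    show ?case using homogeneous(2,3)
    proof (induction y rule: homogeneous_induct)
      case (homogeneous m y)
      note y = \<open>y \<in> grade C m\<close> grade_closed[OF \<open>y \<in> grade C m\<close>]
      show ?case using homogeneous(2)
      proof (induction z rule: homogeneous_induct)
        case (homogeneous n z)
        note z = \<open>z \<in> grade C n\<close> grade_closed[OF \<open>z \<in> grade C n\<close>]
        have "opp.S (y \<otimes>\<^bsub>C\<^esub> x) z = koszul_sign ((m + l) * n) \<odot>\<^bsub>C\<^esub> (z \<otimes>\<^bsub>C\<^esub> (y \<otimes>\<^bsub>C\<^esub> x))"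
          by (rule hom) (use mult_grade x y z in auto)
        moreover have "opp.S x (z \<otimes>\<^bsub>C\<^esub> y) = koszul_sign (l * (n + m)) \<odot>\<^bsub>C\<^esub> ((z \<otimes>\<^bsub>C\<^esub> y) \<otimes>\<^bsub>C\<^esub> x)"
          by (rule hom) (use mult_grade x y z in auto)
        ultimately show ?case
          using x y z
          by (simp add: hom[OF x(1) y(1)] hom[OF y(1) z(1)] opp.signed_smult_left
              opp.signed_smult_right smult_smult m_assoc koszul_sign_add algebra_simps)
      qed (use x y in \<open>auto simp: opp.signed_add_right opp.signed_closed\<close>)
    qed (use x in \<open>auto simp: opp.signed_add_right opp.signed_add_left opp.signed_closed\<close>)
  qed (auto simp: opp.signed_add_left opp.signed_closed)
  have "ring ?C"
  proof (rule ringI)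
    show "abelian_group ?C" by (rule D.abelian_group_axioms)
    show "Group.monoid ?C"
      by (rule monoidI) (auto simp: simps opp.signed_closed one assoc)
  qed (auto simp: simps opp.signed_add_left opp.signed_add_right)
  moreover have "dg_algebra_axioms ?C"
  proof (unfold dg_algebra_axioms_def simps, intro conjI allI impI)
    fix x y m n
    assume x: "x \<in> grade C m" and y: "y \<in> grade C n"
    show "opp.S x y \<in> grade C (m + n)"
      using mult_grade[OF y x] by (simp add: hom[OF x y] grade_smult add.commute)
  next
    fix x y m
    assume x: "x \<in> grade C m" and y: "y \<in> carrier C"
    note x' = grade_closed[OF x] differential_grade[OF x] differential_closed[OF grade_closed[OF x]]
    show "differential C (opp.S x y) =
        opp.S (differential C x) y \<oplus>\<^bsub>C\<^esub> koszul_sign m \<odot>\<^bsub>C\<^esub> opp.S x (differential C y)"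
      using y
    proof (induction y rule: homogeneous_induct)
      case (homogeneous n y)
      note y' = grade_closed[OF homogeneous] differential_grade[OF homogeneous]
        differential_closed[OF grade_closed[OF homogeneous]]
      show ?case
        using x' y'
        by (simp add: hom[OF x homogeneous] hom[OF x y'(2)] hom[OF x'(2) homogeneous]
            differential_smult leibniz[OF homogeneous] smult_add smult_smult
            koszul_sign_add algebra_simps a_comm)
    next
      case (add y z)
      then show ?case
        using x' by (simp add: opp.signed_add_right differential_add smult_add opp.signed_closed
            differential_closed a_ac)
    qed (use x' in auto)
  qed (auto simp: opp.signed_smult_left opp.signed_smult_right one_grade)
  ultimately show ?thesis using space by (simp add: dg_algebra_def)
qed

section \<open>The dg endomorphism algebra\<close>

context dg_bimodule
begin

abbreviation "End_grade \<equiv> dg_End_grade A M"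
abbreviation "U \<equiv> dg_End_underlying A M"

lemma End_apply [simp]:
  assumes "x \<in> carrier M"
  shows "(f \<oplus>\<^bsub>U\<^esub> g) x = f x \<oplus> g x" "\<zero>\<^bsub>U\<^esub> x = \<zero>" "(c \<odot>\<^bsub>U\<^esub> f) x = c \<odot> f x" "\<one>\<^bsub>U\<^esub> x = x"
    "(f \<otimes>\<^bsub>U\<^esub> g) x = f (g x)"
  using assms by (simp_all add: dg_End_underlying_def compose_eq)

lemma End_extensional [simp]:
  "f \<oplus>\<^bsub>U\<^esub> g \<in> extensional (carrier M)" "\<zero>\<^bsub>U\<^esub> \<in> extensional (carrier M)"
  "c \<odot>\<^bsub>U\<^esub> f \<in> extensional (carrier M)" "\<one>\<^bsub>U\<^esub> \<in> extensional (carrier M)"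
  "f \<otimes>\<^bsub>U\<^esub> g \<in> extensional (carrier M)"
  by (simp_all add: dg_End_underlying_def)

lemma grade_End [simp]: "grade U = End_grade"
  by (simp add: dg_End_underlying_def)

lemma End_gradeD:
  assumes "f \<in> End_grade n"
  shows "f \<in> extensional (carrier M)" "x \<in> carrier M \<Longrightarrow> f x \<in> carrier M"
    "\<lbrakk>x \<in> carrier M; y \<in> carrier M\<rbrakk> \<Longrightarrow> f (x \<oplus> y) = f x \<oplus> f y"
    "x \<in> carrier M \<Longrightarrow> f (c \<odot> x) = c \<odot> f x"
    "\<lbrakk>a \<in> grade A m; x \<in> carrier M\<rbrakk> \<Longrightarrow> f (lact M a x) = koszul_sign (n * m) \<odot> lact M a (f x)"
    "x \<in> grade M l \<Longrightarrow> f x \<in> grade M (l + n)"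
  using assms by (auto simp: dg_End_grade_def)

lemma End_gradeI:
  assumes "f \<in> extensional (carrier M)" "\<And>x. x \<in> carrier M \<Longrightarrow> f x \<in> carrier M"
    "\<And>x y. \<lbrakk>x \<in> carrier M; y \<in> carrier M\<rbrakk> \<Longrightarrow> f (x \<oplus> y) = f x \<oplus> f y"
    "\<And>c x. x \<in> carrier M \<Longrightarrow> f (c \<odot> x) = c \<odot> f x"
    "\<And>m a x. \<lbrakk>a \<in> grade A m; x \<in> carrier M\<rbrakk> \<Longrightarrow> f (lact M a x) = koszul_sign (n * m) \<odot> lact M a (f x)"
    "\<And>l x. x \<in> grade M l \<Longrightarrow> f x \<in> grade M (l + n)"
  shows "f \<in> End_grade n"
  using assms by (auto simp: dg_End_grade_def)

lemma End_grade_zero: "\<zero>\<^bsub>U\<^esub> \<in> End_grade n"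
  by (rule End_gradeI)
    (use lact_smult_right[of _ \<zero> 0] in \<open>auto simp: lact_closed A.grade_closed grade_closed\<close>)

lemma End_grade_add:
  assumes "f \<in> End_grade n" "g \<in> End_grade n"
  shows "f \<oplus>\<^bsub>U\<^esub> g \<in> End_grade n"
proof (rule End_gradeI)
  fix l x assume x: "x \<in> grade M l"
  show "(f \<oplus>\<^bsub>U\<^esub> g) x \<in> grade M (l + n)"
    using grade_add[OF assms[THEN End_gradeD(6), OF x]] grade_closed[OF x] by simp
qed (use assms[THEN End_gradeD(2)] in \<open>simp_all add: assms[THEN End_gradeD(3)] assms[THEN End_gradeD(4)]
       assms[THEN End_gradeD(5)] lact_closed A.grade_closed lact_add_right smult_add a_ac\<close>)

lemma End_grade_smult:
  assumes "f \<in> End_grade n"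
  shows "c \<odot>\<^bsub>U\<^esub> f \<in> End_grade n"
proof (rule End_gradeI)
  fix l x assume x: "x \<in> grade M l"
  show "(c \<odot>\<^bsub>U\<^esub> f) x \<in> grade M (l + n)"
    using grade_smult[OF assms[THEN End_gradeD(6), OF x]] grade_closed[OF x] by simp
qed (use assms[THEN End_gradeD(2)] in \<open>simp_all add: assms[THEN End_gradeD(3)] assms[THEN End_gradeD(4)]
       assms[THEN End_gradeD(5)] lact_closed A.grade_closed lact_smult_right smult_add smult_smult mult.commute\<close>)

lemma End_grade_mult:
  assumes f: "f \<in> End_grade m" and g: "g \<in> End_grade n"
  shows "f \<otimes>\<^bsub>U\<^esub> g \<in> End_grade (m + n)"
proof (rule End_gradeI)
  fix l x assume x: "x \<in> grade M l"
  show "(f \<otimes>\<^bsub>U\<^esub> g) x \<in> grade M (l + (m + n))"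
    using End_gradeD(6)[OF f End_gradeD(6)[OF g x]] x
    by (simp add: grade_closed add.assoc add.commute[of m n])
qed (use f[THEN End_gradeD(2)] g[THEN End_gradeD(2)] in \<open>auto simp:
      f[THEN End_gradeD(3)] g[THEN End_gradeD(3)] f[THEN End_gradeD(4)] g[THEN End_gradeD(4)]
      f[THEN End_gradeD(5)] g[THEN End_gradeD(5)] lact_closed A.grade_closed smult_smult
      koszul_sign_add algebra_simps\<close>)

lemma End_grade_one: "\<one>\<^bsub>U\<^esub> \<in> End_grade 0"
  by (rule End_gradeI) (auto simp: koszul_sign_parity lact_closed A.grade_closed grade_closed)

lemma finite_sum_in_End:
  "finite N \<Longrightarrow> (\<And>n. n \<in> N \<Longrightarrow> c n \<in> End_grade n) \<Longrightarrow>
   (\<lambda>x\<in>carrier M. finsum M (\<lambda>n. c n x) N) \<in> carrier U"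
  by (auto simp: dg_End_underlying_def)

text \<open>Padding the family with zero maps allows families over different index sets to be added.\<close>

lemma End_carrierE:
  assumes "f \<in> carrier U"
  obtains N c where "finite N" "\<And>n. c n \<in> End_grade n" "\<And>n. n \<notin> N \<Longrightarrow> c n = \<zero>\<^bsub>U\<^esub>"
    "f = (\<lambda>x\<in>carrier M. finsum M (\<lambda>n. c n x) N)"
proof -
  from assms obtain N c where *: "finite N" "\<forall>n\<in>N. c n \<in> End_grade n"
    "f = (\<lambda>x\<in>carrier M. finsum M (\<lambda>n. c n x) N)"
    by (auto simp: dg_End_underlying_def)
  let ?c = "\<lambda>n. if n \<in> N then c n else \<zero>\<^bsub>U\<^esub>"
  have "f = (\<lambda>x\<in>carrier M. finsum M (\<lambda>n. ?c n x) N)"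
    unfolding *(3)
  proof (rule restrict_ext)
    fix x assume "x \<in> carrier M"
    then have "c n x \<in> carrier M" if "n \<in> N" for n using * that End_gradeD(2) by blast
    then show "finsum M (\<lambda>n. c n x) N = finsum M (\<lambda>n. ?c n x) N"
      by (intro finsum_cong') auto
  qed
  then show ?thesis using * End_grade_zero by (intro that[of N ?c]) auto
qed

lemma End_ext_eqI:
  "\<lbrakk>f \<in> extensional (carrier M); g \<in> extensional (carrier M); \<And>x. x \<in> carrier M \<Longrightarrow> f x = g x\<rbrakk> \<Longrightarrow> f = g"
  by (rule extensionalityI[of _ "carrier M"])

lemma End_grade_carrier: assumes "f \<in> End_grade n" shows "f \<in> carrier U"
proof -
  have "f = (\<lambda>x\<in>carrier M. finsum M (\<lambda>n. f x) {n})"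
    by (rule End_ext_eqI) (use assms in \<open>auto simp: End_gradeD\<close>)
  then show ?thesis using finite_sum_in_End[of "{n}" "\<lambda>_. f"] assms by simp
qed

lemma End_carrier_add:
  assumes "f \<in> carrier U" "g \<in> carrier U"
  shows "f \<oplus>\<^bsub>U\<^esub> g \<in> carrier U"
proof -
  obtain N c where f: "finite N" "\<And>n. c n \<in> End_grade n" "\<And>n. n \<notin> N \<Longrightarrow> c n = \<zero>\<^bsub>U\<^esub>"
    "f = (\<lambda>x\<in>carrier M. finsum M (\<lambda>n. c n x) N)" by (rule End_carrierE[OF assms(1)]) blast
  obtain N' c' where g: "finite N'" "\<And>n. c' n \<in> End_grade n" "\<And>n. n \<notin> N' \<Longrightarrow> c' n = \<zero>\<^bsub>U\<^esub>"
    "g = (\<lambda>x\<in>carrier M. finsum M (\<lambda>n. c' n x) N')" by (rule End_carrierE[OF assms(2)]) blast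
  have c: "(\<lambda>n. c n x) \<in> X \<rightarrow> carrier M" "(\<lambda>n. c' n x) \<in> X \<rightarrow> carrier M" if "x \<in> carrier M" for x X
    using f(2) g(2) that by (auto intro: End_gradeD(2))
  have c': "c n x \<in> carrier M" "c' n x \<in> carrier M" if "x \<in> carrier M" for x n
    using f(2) g(2) that by (auto intro: End_gradeD(2))
  have 1: "finsum M (\<lambda>n. c n x) N = finsum M (\<lambda>n. c n x) (N \<union> N')"
    and 2: "finsum M (\<lambda>n. c' n x) N' = finsum M (\<lambda>n. c' n x) (N \<union> N')" if "x \<in> carrier M" for x
    using f(1,3) g(1,3) that by (auto intro!: add.finprod_mono_neutral_cong_left simp: c')
  have "f \<oplus>\<^bsub>U\<^esub> g = (\<lambda>x\<in>carrier M. finsum M (\<lambda>n. (c n \<oplus>\<^bsub>U\<^esub> c' n) x) (N \<union> N'))"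
    by (rule End_ext_eqI) (use f(1) g(1) c in \<open>simp_all add: f(4) g(4) 1 2 finsum_addf\<close>)
  then show ?thesis
    using f(1,2) g(1,2) finite_sum_in_End[of "N \<union> N'" "\<lambda>n. c n \<oplus>\<^bsub>U\<^esub> c' n"] by (simp add: End_grade_add)
qed

lemma End_induct [consumes 1, case_names zero homogeneous add]:
  assumes "f \<in> carrier U" and zero: "P \<zero>\<^bsub>U\<^esub>"
    and homogeneous: "\<And>n f. f \<in> End_grade n \<Longrightarrow> P f"
    and add: "\<And>f g. \<lbrakk>f \<in> carrier U; g \<in> carrier U; P f; P g\<rbrakk> \<Longrightarrow> P (f \<oplus>\<^bsub>U\<^esub> g)"
  shows "P f"
proof -
  from assms(1) obtain N c where c: "finite N" "\<And>n. c n \<in> End_grade n"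
    "f = (\<lambda>x\<in>carrier M. finsum M (\<lambda>n. c n x) N)"
    by (rule End_carrierE) blast
  have "P (\<lambda>x\<in>carrier M. finsum M (\<lambda>n. c n x) N)"
    using c(1)
  proof (induction N rule: finite_induct)
    case empty
    have "(\<lambda>x\<in>carrier M. finsum M (\<lambda>n. c n x) {}) = \<zero>\<^bsub>U\<^esub>" by (rule End_ext_eqI) auto
    then show ?case using zero by metis
  next
    case (insert n N)
    let ?g = "\<lambda>x\<in>carrier M. finsum M (\<lambda>n. c n x) N"
    have "P (c n \<oplus>\<^bsub>U\<^esub> ?g)"
      by (intro add End_grade_carrier[OF c(2)] insert homogeneous[OF c(2)] finite_sum_in_End c(2))
    moreover have "c n \<oplus>\<^bsub>U\<^esub> ?g = (\<lambda>x\<in>carrier M. finsum M (\<lambda>n. c n x) (insert n N))"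
    proof (rule End_ext_eqI)
      fix x assume x: "x \<in> carrier M"
      then have "finsum M (\<lambda>n. c n x) (insert n N) = c n x \<oplus> finsum M (\<lambda>n. c n x) N"
        using insert c(2) by (intro finsum_insert) (auto intro: End_gradeD(2))
      with x show "(c n \<oplus>\<^bsub>U\<^esub> ?g) x = (\<lambda>x\<in>carrier M. finsum M (\<lambda>n. c n x) (insert n N)) x" by simp
    qed auto
    ultimately show ?case by metis
  qed
  then show ?thesis using c(3) by metis
qed

lemma End_carrierD:
  assumes "f \<in> carrier U"
  shows "f \<in> extensional (carrier M)" "x \<in> carrier M \<Longrightarrow> f x \<in> carrier M"
    "\<lbrakk>x \<in> carrier M; y \<in> carrier M\<rbrakk> \<Longrightarrow> f (x \<oplus> y) = f x \<oplus> f y"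
    "x \<in> carrier M \<Longrightarrow> f (c \<odot> x) = c \<odot> f x"
proof -
  show "x \<in> carrier M \<Longrightarrow> f x \<in> carrier M"
    using assms by (induction f rule: End_induct) (auto simp: End_gradeD)
  show "f \<in> extensional (carrier M)"
    using assms by (induction f rule: End_induct) (auto simp: End_gradeD)
  have "(x \<in> carrier M \<longrightarrow> f x \<in> carrier M) \<and> (y \<in> carrier M \<longrightarrow> f y \<in> carrier M) \<and>
     (x \<in> carrier M \<longrightarrow> y \<in> carrier M \<longrightarrow> f (x \<oplus> y) = f x \<oplus> f y)"
    using assms by (induction f rule: End_induct) (auto simp: End_gradeD a_ac)
  then show "\<lbrakk>x \<in> carrier M; y \<in> carrier M\<rbrakk> \<Longrightarrow> f (x \<oplus> y) = f x \<oplus> f y" by blast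
  have "x \<in> carrier M \<longrightarrow> f x \<in> carrier M \<and> f (c \<odot> x) = c \<odot> f x"
    using assms by (induction f rule: End_induct) (auto simp: End_gradeD smult_add)
  then show "x \<in> carrier M \<Longrightarrow> f (c \<odot> x) = c \<odot> f x" by blast
qed

lemma End_value_zero [simp]: "f \<in> carrier U \<Longrightarrow> f \<zero> = \<zero>"
  using End_carrierD(4)[of f \<zero> 0] End_carrierD(2)[of f \<zero>] by simp

lemma End_eqI:
  "\<lbrakk>f \<in> carrier U; g \<in> carrier U; \<And>x. x \<in> carrier M \<Longrightarrow> f x = g x\<rbrakk> \<Longrightarrow> f = g"
  by (rule End_ext_eqI) (auto simp: End_carrierD)

lemma End_carrier_zero: "\<zero>\<^bsub>U\<^esub> \<in> carrier U"
  by (rule End_grade_carrier[OF End_grade_zero])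

lemma End_carrier_one: "\<one>\<^bsub>U\<^esub> \<in> carrier U"
  by (rule End_grade_carrier[OF End_grade_one])

lemma End_carrier_smult: "f \<in> carrier U \<Longrightarrow> c \<odot>\<^bsub>U\<^esub> f \<in> carrier U"
proof (induction f rule: End_induct)
  case zero
  have "c \<odot>\<^bsub>U\<^esub> \<zero>\<^bsub>U\<^esub> = \<zero>\<^bsub>U\<^esub>" by (rule End_ext_eqI) auto
  then show ?case using End_carrier_zero by simp
next
  case (homogeneous n f)
  then show ?case by (intro End_grade_carrier End_grade_smult)
next
  case (add f g)
  have "c \<odot>\<^bsub>U\<^esub> (f \<oplus>\<^bsub>U\<^esub> g) = (c \<odot>\<^bsub>U\<^esub> f) \<oplus>\<^bsub>U\<^esub> (c \<odot>\<^bsub>U\<^esub> g)"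
    by (rule End_ext_eqI) (use add in \<open>auto simp: smult_add End_carrierD\<close>)
  then show ?case using End_carrier_add[OF add(3,4)] by simp
qed

lemma End_mult_add_left:
  "g \<in> carrier U \<Longrightarrow> (f \<oplus>\<^bsub>U\<^esub> f') \<otimes>\<^bsub>U\<^esub> g = (f \<otimes>\<^bsub>U\<^esub> g) \<oplus>\<^bsub>U\<^esub> (f' \<otimes>\<^bsub>U\<^esub> g)"
  by (rule End_ext_eqI) (auto simp: End_carrierD)

lemma End_mult_add_right:
  "\<lbrakk>f \<in> carrier U; g \<in> carrier U; g' \<in> carrier U\<rbrakk> \<Longrightarrow>
   f \<otimes>\<^bsub>U\<^esub> (g \<oplus>\<^bsub>U\<^esub> g') = (f \<otimes>\<^bsub>U\<^esub> g) \<oplus>\<^bsub>U\<^esub> (f \<otimes>\<^bsub>U\<^esub> g')"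
  by (rule End_ext_eqI) (auto simp: End_carrierD)

lemma End_carrier_mult:
  assumes "f \<in> carrier U" "g \<in> carrier U"
  shows "f \<otimes>\<^bsub>U\<^esub> g \<in> carrier U"
  using assms
proof (induction f rule: End_induct)
  case zero
  have "\<zero>\<^bsub>U\<^esub> \<otimes>\<^bsub>U\<^esub> g = \<zero>\<^bsub>U\<^esub>" by (rule End_ext_eqI) (use zero in \<open>auto simp: End_carrierD\<close>)
  then show ?case using End_carrier_zero by simp
next
  case (homogeneous n f)
  from homogeneous(2) show ?case
  proof (induction g rule: End_induct)
    case zero
    have "f \<otimes>\<^bsub>U\<^esub> \<zero>\<^bsub>U\<^esub> = \<zero>\<^bsub>U\<^esub>"
      by (rule End_ext_eqI) (use End_grade_carrier[OF homogeneous(1)] in auto)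
    then show ?case using End_carrier_zero by simp
  next
    case (homogeneous m g)
    then show ?case using \<open>f \<in> End_grade n\<close> End_grade_carrier End_grade_mult by blast
  next
    case (add g g')
    then show ?case using End_grade_carrier[OF homogeneous(1)] by (simp add: End_mult_add_right End_carrier_add)
  qed
next
  case (add f f')
  then show ?case by (simp add: End_mult_add_left End_carrier_add)
qed

lemma End_abelian_group: "abelian_group U"
proof (rule abelian_groupI)
  fix f assume f: "f \<in> carrier U"
  have "((- 1) \<odot>\<^bsub>U\<^esub> f) \<oplus>\<^bsub>U\<^esub> f = \<zero>\<^bsub>U\<^esub>"
    by (rule End_ext_eqI) (use f in \<open>auto simp: End_carrierD smult_minus_1 l_neg\<close>)
  then show "\<exists>g\<in>carrier U. g \<oplus>\<^bsub>U\<^esub> f = \<zero>\<^bsub>U\<^esub>" using f End_carrier_smult by blast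
  show "\<zero>\<^bsub>U\<^esub> \<oplus>\<^bsub>U\<^esub> f = f"
    by (rule End_ext_eqI) (use f in \<open>auto simp: End_carrierD\<close>)
next
  fix f g h assume *: "f \<in> carrier U" "g \<in> carrier U" "h \<in> carrier U"
  show "f \<oplus>\<^bsub>U\<^esub> g \<oplus>\<^bsub>U\<^esub> h = f \<oplus>\<^bsub>U\<^esub> (g \<oplus>\<^bsub>U\<^esub> h)"
    by (rule End_ext_eqI) (use * in \<open>auto simp: End_carrierD a_ac\<close>)
next
  fix f g assume *: "f \<in> carrier U" "g \<in> carrier U"
  show "f \<oplus>\<^bsub>U\<^esub> g = g \<oplus>\<^bsub>U\<^esub> f"
    by (rule End_ext_eqI) (use * in \<open>auto simp: End_carrierD a_ac\<close>)
qed (auto simp: End_carrier_add End_carrier_zero)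

lemma End_ring: "ring U"
proof (rule ringI[OF End_abelian_group])
  show "Group.monoid U"
    by (rule monoidI)
      (auto intro!: End_ext_eqI simp: End_carrier_mult End_carrier_one End_carrierD)
qed (simp_all add: End_mult_add_left End_mult_add_right)

lemma End_module: "Module.module scalars U"
  by (rule moduleI[OF cring_scalars End_abelian_group])
    (auto intro!: End_ext_eqI simp: End_carrier_add End_carrier_smult End_carrierD
      smult_add_left smult_add smult_smult)

lemma End_submodule: "submodule (End_grade n) scalars U"
proof -
  interpret E: Module.module scalars U by (rule End_module)
  show ?thesis
  proof (rule E.submoduleI)
    fix f assume f: "f \<in> End_grade n"
    have "((- 1) \<odot>\<^bsub>U\<^esub> f) \<oplus>\<^bsub>U\<^esub> f = \<zero>\<^bsub>U\<^esub>"
      by (rule End_ext_eqI) (use f in \<open>auto simp: End_gradeD smult_minus_1 l_neg\<close>)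
    then have "\<ominus>\<^bsub>U\<^esub> f = (- 1) \<odot>\<^bsub>U\<^esub> f"
      by (rule E.minus_equality) (use f in \<open>auto simp: End_grade_carrier End_carrier_smult\<close>)
    then show "\<ominus>\<^bsub>U\<^esub> f \<in> End_grade n" using f by (simp add: End_grade_smult)
  qed (auto simp: End_grade_carrier End_grade_add End_grade_smult End_grade_zero)
qed

lemma End_finsum:
  assumes "c \<in> N \<rightarrow> carrier U" "x \<in> carrier M"
  shows "finsum U c N x = finsum M (\<lambda>n. c n x) N"
  by (rule additive_finsum[OF End_abelian_group abelian_group_axioms])
    (use assms in \<open>auto simp: End_carrierD\<close>)

text \<open>On an element of degree \<open>l\<close> the maps \<open>c n\<close> have values in the different degrees
  \<open>n + l\<close>, so that they can be read off from the components of \<open>f x\<close>. Hence the sum of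
  the graded pieces of the endomorphism algebra is direct.\<close>

lemma End_decomp_value:
  assumes "hom_decomp U f c" "x \<in> grade M l"
  shows "hom_comp M (f x) (n + l) = c n x"
proof -
  let ?N = "{n. c n \<noteq> \<zero>\<^bsub>U\<^esub>}"
  interpret E: abelian_group U by (rule End_abelian_group)
  have c: "\<And>n. c n \<in> End_grade n" "finite ?N" "f = finsum U c ?N"
    using assms by (auto simp: hom_decomp_def)
  have cc: "c \<in> N \<rightarrow> carrier U" for N using c(1) End_grade_carrier by blast
  have x: "x \<in> carrier M" using assms(2) grade_closed by blast
  have cx: "c n x \<in> carrier M" for n using c(1) x by (rule End_gradeD(2))
  have inj: "inj_on (\<lambda>n. n + l) ?N" by (auto simp: inj_on_def)
  have "f x = finsum M (\<lambda>n. c n x) ?N"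
    using c(3) End_finsum[OF cc x] by metis
  also have "\<dots> = finsum M (\<lambda>n. c (n + l - l) x) ?N" by simp
  also have "\<dots> = finsum M (\<lambda>m. c (m - l) x) ((\<lambda>n. n + l) ` ?N)"
    by (rule finsum_reindex[symmetric, OF _ inj]) (use cx in auto)
  finally have fx: "f x = finsum M (\<lambda>m. c (m - l) x) ((\<lambda>n. n + l) ` ?N)" .
  have "hom_decomp M (f x) (\<lambda>m. c (m - l) x)"
  proof (rule hom_decompI[OF _ _ _ fx])
    show "c (m - l) x \<in> grade M m" for m
      using End_gradeD(6)[OF c(1)[of "m - l"] assms(2)] by simp
    show "c (m - l) x = \<zero>" if "m \<notin> (\<lambda>n. n + l) ` ?N" for m
    proof -
      have "m - l \<notin> ?N" using that by (metis (no_types, lifting) diff_add_cancel imageI)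
      then show ?thesis using x by simp
    qed
  qed (use c(2) in auto)
  moreover have "f x \<in> carrier M"
    unfolding fx using cx by (auto intro!: finsum_closed)
  ultimately have "hom_comp M (f x) = (\<lambda>m. c (m - l) x)" by (intro hom_comp_eq)
  then show ?thesis by simp
qed

lemma End_decomp_unique:
  assumes "hom_decomp U f c" "hom_decomp U f c'"
  shows "c = c'"
proof
  fix n
  have "c n \<in> End_grade n" "c' n \<in> End_grade n"
    using assms by (auto simp: hom_decomp_def)
  then have c: "c n \<in> carrier U" "c' n \<in> carrier U" using End_grade_carrier by blast+
  show "c n = c' n"
  proof (rule End_eqI[OF c])
    fix x assume "x \<in> carrier M"
    then show "c n x = c' n x"
    proof (induction x rule: homogeneous_induct)
      case (homogeneous l x)
      then show ?case using assms[THEN End_decomp_value] by metis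
    qed (use c in \<open>simp_all add: End_carrierD\<close>)
  qed
qed

lemma End_decomp_exists:
  assumes "f \<in> carrier U"
  shows "\<exists>c. hom_decomp U f c"
proof -
  obtain N c where f: "finite N" "\<And>n. c n \<in> End_grade n" "\<And>n. n \<notin> N \<Longrightarrow> c n = \<zero>\<^bsub>U\<^esub>"
    "f = (\<lambda>x\<in>carrier M. finsum M (\<lambda>n. c n x) N)" by (rule End_carrierE[OF assms]) blast
  interpret E: abelian_group U by (rule End_abelian_group)
  have cc: "c \<in> N \<rightarrow> carrier U" using f(2) End_grade_carrier by blast
  have "f = finsum U c N"
    by (rule End_eqI[OF assms E.finsum_closed[OF cc]]) (simp add: End_finsum[OF cc] f(4))
  then have "hom_decomp U f c"
    by (intro hom_decomp_finsum[OF End_abelian_group _ f(1)]) (use f(2,3) End_grade_carrier in auto)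
  then show ?thesis by blast
qed

end

section \<open>The differential of the endomorphism algebra\<close>

lemma hom_comp_cong:
  assumes "carrier C' = carrier C" "zero C' = zero C" "add C' = add C" "grade C' = grade C"
  shows "hom_comp C' = hom_comp C" "degrees C' = degrees C"
  using hom_decomp_cong[OF assms] assms by (auto simp: fun_eq_iff hom_comp_def degrees_def)

lemma (in dg_space) smult_cancel:
  assumes "c + d = 0" "x \<in> carrier C" "y \<in> carrier C"
  shows "c \<odot> y \<oplus> (d \<odot> y \<oplus> x) = x"
proof -
  have "c \<odot> y \<oplus> (d \<odot> y \<oplus> x) = (c \<odot> y \<oplus> d \<odot> y) \<oplus> x"
    using assms by (simp add: a_assoc)
  also have "\<dots> = (c + d) \<odot> y \<oplus> x"
    using assms by (subst smult_add_left) auto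
  finally show ?thesis using assms by simp
qed

lemma (in dg_space) smult_cancel_middle:
  assumes "c + d = 0" "x \<in> carrier C" "y \<in> carrier C" "z \<in> carrier C"
  shows "c \<odot> y \<oplus> z \<oplus> (d \<odot> y \<oplus> x) = z \<oplus> x"
  using assms smult_cancel[OF assms(1) _ assms(3), of "z \<oplus> x"] by (simp add: a_ac)

context dg_bimodule
begin

abbreviation "E \<equiv> dg_End A M"

lemma End_record:
  "carrier E = carrier U" "mult E = mult U" "one E = one U" "zero E = zero U" "add E = add U"
  "smult E = smult U" "grade E = End_grade"
  "differential E = (\<lambda>f. \<lambda>x\<in>carrier M.
     finsum M (\<lambda>n. differential M (hom_comp U f n x) \<ominus> (koszul_sign n \<odot> hom_comp U f n (differential M x)))
       (degrees U f))"
  by (simp_all add: dg_End_def Let_def)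

text \<open>The differential of \<open>dg_End\<close> is defined through homogeneous components. To have their
  theory at hand before, the underlying algebra is given the zero differential.\<close>

lemma End_zero_dg_space: "dg_space (U\<lparr>differential := (\<lambda>_. \<zero>\<^bsub>U\<^esub>)\<rparr>)" (is "dg_space ?V")
proof -
  interpret V: Module.module scalars U by (rule End_module)
  have mono: "add_monoid ?V = add_monoid U" by simp
  have ag: "abelian_group ?V" 
    by (rule comm_group_abelian_groupI) (use V.add.comm_group_axioms mono V.a_comm_group in simp)
  have mod: "Module.module scalars ?V"
    by (rule moduleI) (use ag cring_scalars V.smult_l_distr V.smult_r_distr V.smult_assoc1 V.smult_one
       V.smult_closed in \<open>auto\<close>)
  have sub: "submodule (grade ?V n) scalars ?V" for n
    using End_submodule[of n] by (simp add: submodule_def submodule_axioms_def)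
  have eq: "hom_decomp ?V = hom_decomp U" by (rule hom_decomp_cong) auto
  show ?thesis
    by (rule dg_spaceI[OF mod sub])
      (use End_decomp_unique End_decomp_exists in \<open>auto simp: eq End_grade_zero End_carrier_zero\<close>)
qed

interpretation V: dg_space "U\<lparr>differential := (\<lambda>_. \<zero>\<^bsub>U\<^esub>)\<rparr>"
  by (rule End_zero_dg_space)

lemma V_comp: "hom_comp (U\<lparr>differential := (\<lambda>_. \<zero>\<^bsub>U\<^esub>)\<rparr>) = hom_comp U"
  "degrees (U\<lparr>differential := (\<lambda>_. \<zero>\<^bsub>U\<^esub>)\<rparr>) = degrees U"
  by (rule hom_comp_cong; simp)+

lemmas End_hom_comp_add = V.hom_comp_add[unfolded V_comp, simplified]
lemmas End_hom_comp_grade = V.hom_comp_grade[unfolded V_comp, simplified]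
lemmas End_hom_comp_homogeneous = V.hom_comp_homogeneous[unfolded V_comp, simplified]
lemmas End_degrees_homogeneous = V.degrees_homogeneous[unfolded V_comp, simplified]
lemmas End_finite_degrees = V.finite_degrees[unfolded V_comp, simplified]

definition commutator :: "int \<Rightarrow> ('m \<Rightarrow> 'm) \<Rightarrow> 'm \<Rightarrow> 'm" where
  "commutator n f = (\<lambda>x\<in>carrier M. differential M (f x) \<ominus> (koszul_sign n \<odot> f (differential M x)))"

lemma commutator_extensional [simp]: "commutator n f \<in> extensional (carrier M)"
  by (simp add: commutator_def)

lemma commutator_apply:
  "f \<in> carrier U \<Longrightarrow> x \<in> carrier M \<Longrightarrow>
   commutator n f x = differential M (f x) \<oplus> (- koszul_sign n) \<odot> f (differential M x)"
  by (simp add: commutator_def minus_eq_smult End_carrierD differential_closed smult_smult)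

lemma End_hom_comp_carrier: "f \<in> carrier U \<Longrightarrow> hom_comp U f n \<in> carrier U"
  using End_hom_comp_grade End_grade_carrier by blast

lemma commutator_closed:
  "f \<in> carrier U \<Longrightarrow> x \<in> carrier M \<Longrightarrow> commutator n f x \<in> carrier M"
  by (simp add: commutator_apply End_carrierD differential_closed)

lemma commutator_add:
  "f \<in> carrier U \<Longrightarrow> g \<in> carrier U \<Longrightarrow> x \<in> carrier M \<Longrightarrow>
   commutator n (f \<oplus>\<^bsub>U\<^esub> g) x = commutator n f x \<oplus> commutator n g x"
  by (simp add: commutator_apply End_carrier_add End_carrierD differential_closed differential_add smult_add a_ac)

lemma commutator_zero: "x \<in> carrier M \<Longrightarrow> commutator n \<zero>\<^bsub>U\<^esub> x = \<zero>"
  by (simp add: commutator_apply End_carrier_zero differential_closed)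

text \<open>As in \<open>signed_superset\<close>: a common index set for several maps makes additivity visible.\<close>

lemma End_differential_superset:
  assumes "f \<in> carrier U" "finite N" "degrees U f \<subseteq> N" "x \<in> carrier M"
  shows "differential E f x = finsum M (\<lambda>n. commutator n (hom_comp U f n) x) N"
proof -
  have "differential E f x = finsum M (\<lambda>n. commutator n (hom_comp U f n) x) (degrees U f)"
    using assms(4) by (simp add: End_record commutator_def)
  also have "\<dots> = finsum M (\<lambda>n. commutator n (hom_comp U f n) x) N"
    using assms by (intro add.finprod_mono_neutral_cong_left)
      (auto simp: degrees_def commutator_zero commutator_closed End_hom_comp_carrier)
  finally show ?thesis .
qed

lemma End_differential_extensional: "differential E f \<in> extensional (carrier M)"
  by (simp add: End_record)

lemma End_differential_homogeneous:
  assumes "f \<in> End_grade n"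
  shows "differential E f = commutator n f"
proof (rule End_ext_eqI[OF End_differential_extensional])
  fix x assume x: "x \<in> carrier M"
  show "differential E f x = commutator n f x"
    using End_differential_superset[OF End_grade_carrier[OF assms] _ End_degrees_homogeneous[OF assms] x]
    by (simp add: End_hom_comp_homogeneous[OF assms] commutator_closed End_grade_carrier[OF assms] x)
qed (simp add: commutator_def)

lemma End_differential_add:
  assumes "f \<in> carrier U" "g \<in> carrier U"
  shows "differential E (f \<oplus>\<^bsub>U\<^esub> g) = differential E f \<oplus>\<^bsub>U\<^esub> differential E g"
proof (rule End_ext_eqI[OF End_differential_extensional])
  fix x assume x: "x \<in> carrier M"
  let ?N = "degrees U f \<union> degrees U g \<union> degrees U (f \<oplus>\<^bsub>U\<^esub> g)"
  have N: "finite ?N" using assms by (simp add: End_finite_degrees End_carrier_add)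
  note sup = End_differential_superset[OF _ N _ x]
  show "differential E (f \<oplus>\<^bsub>U\<^esub> g) x = (differential E f \<oplus>\<^bsub>U\<^esub> differential E g) x"
    using assms x sup[OF assms(1)] sup[OF assms(2)]
    by (simp add: sup[of "f \<oplus>\<^bsub>U\<^esub> g"] le_supI1 End_carrier_add End_hom_comp_add commutator_add End_hom_comp_carrier
        finsum_addf commutator_closed)
qed auto

lemma commutator_grade:
  assumes f: "f \<in> End_grade n"
  shows "commutator n f \<in> End_grade (n + 1)"
proof (rule End_gradeI)
  note fU = End_grade_carrier[OF f]
  note D = End_carrierD(2)[OF fU] differential_closed lact_closed A.grade_closed A.differential_closed
  show "commutator n f \<in> extensional (carrier M)" by (simp add: commutator_def)
  fix x assume x: "x \<in> carrier M"
  show "commutator n f x \<in> carrier M" using fU x by (rule commutator_closed)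
  show "commutator n f (c \<odot> x) = c \<odot> commutator n f x" for c
    using x by (simp add: commutator_apply fU D End_carrierD(4)[OF fU] differential_smult smult_add smult_smult mult.commute)
  show "commutator n f (x \<oplus> y) = commutator n f x \<oplus> commutator n f y" if "y \<in> carrier M" for y
    using x that by (simp add: commutator_apply fU D End_carrierD(3)[OF fU] differential_add smult_add a_ac)
  fix m a assume a: "a \<in> grade A m"
  note a' = A.grade_closed[OF a] A.differential_grade[OF a]
  show "commutator n f (lact M a x) = koszul_sign ((n + 1) * m) \<odot> lact M a (commutator n f x)"
    using x a'(1)
    by (simp add: commutator_apply fU D End_gradeD(5)[OF f a] End_gradeD(5)[OF f a'(2)]
        differential_smult lact_leibniz[OF a] smult_add smult_smult lact_add_right lact_smult_right
        End_carrierD(3,4)[OF fU] koszul_sign_add algebra_simps)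
      (rule smult_cancel_middle; simp add: D)
next
  fix l x assume x: "x \<in> grade M l"
  have "differential M (f x) \<in> grade M (l + (n + 1))"
    using differential_grade[OF End_gradeD(6)[OF f x]] by (simp add: add.assoc)
  moreover have "f (differential M x) \<in> grade M (l + (n + 1))"
    using End_gradeD(6)[OF f differential_grade[OF x]] by (simp add: algebra_simps)
  ultimately show "commutator n f x \<in> grade M (l + (n + 1))"
    using grade_closed[OF x] by (simp add: commutator_apply End_grade_carrier[OF f] grade_add grade_smult)
qed

lemma End_differential_carrier: "f \<in> carrier U \<Longrightarrow> differential E f \<in> carrier U"
proof (induction f rule: End_induct)
  case zero
  show ?case
    using End_grade_carrier[OF commutator_grade[OF End_grade_zero[of 0]]]
    by (simp add: End_differential_homogeneous[OF End_grade_zero[of 0]])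
next
  case (homogeneous n f)
  then show ?case using End_grade_carrier[OF commutator_grade] by (simp add: End_differential_homogeneous)
qed (simp add: End_differential_add End_carrier_add)

lemma End_differential_zero: "differential E \<zero>\<^bsub>U\<^esub> = \<zero>\<^bsub>U\<^esub>"
  by (rule End_ext_eqI[OF End_differential_extensional])
    (simp_all add: End_differential_homogeneous[OF End_grade_zero[of 0]] commutator_zero)

lemma End_differential_smult:
  "f \<in> carrier U \<Longrightarrow> differential E (c \<odot>\<^bsub>U\<^esub> f) = c \<odot>\<^bsub>U\<^esub> differential E f"
proof (induction f rule: End_induct)
  case zero
  have "c \<odot>\<^bsub>U\<^esub> \<zero>\<^bsub>U\<^esub> = \<zero>\<^bsub>U\<^esub>" by (rule End_ext_eqI) auto
  then show ?case by (simp add: End_differential_zero)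
next
  case (homogeneous n f)
  show ?case
    unfolding End_differential_homogeneous[OF homogeneous]
      End_differential_homogeneous[OF End_grade_smult[OF homogeneous]]
    by (rule End_ext_eqI) (use End_grade_carrier[OF homogeneous] in
      \<open>auto simp: commutator_apply End_carrier_smult differential_closed differential_smult End_carrierD
         smult_add smult_smult mult.commute\<close>)
next
  case (add f g)
  have "c \<odot>\<^bsub>U\<^esub> (x \<oplus>\<^bsub>U\<^esub> y) = (c \<odot>\<^bsub>U\<^esub> x) \<oplus>\<^bsub>U\<^esub> (c \<odot>\<^bsub>U\<^esub> y)"
    if "x \<in> carrier U" "y \<in> carrier U" for x y
    by (rule End_ext_eqI) (use that in \<open>auto simp: smult_add End_carrierD\<close>)
  with add show ?case by (simp add: End_differential_add End_carrier_smult End_differential_carrier)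
qed

text \<open>The terms \<open>d f d\<close> carry the opposite signs of \<open>n\<close> and \<open>n + 1\<close>; the other terms
  contain \<open>d d\<close>.\<close>

lemma commutator_commutator:
  assumes "f \<in> End_grade n"
  shows "commutator (n + 1) (commutator n f) = \<zero>\<^bsub>U\<^esub>"
proof (rule End_ext_eqI)
  fix x assume x: "x \<in> carrier M"
  note fU = End_grade_carrier[OF assms]
  note cU = End_grade_carrier[OF commutator_grade[OF assms]]
  have k: "koszul_sign (n + 1) = - koszul_sign n" by (simp add: koszul_sign_parity)
  show "commutator (n + 1) (commutator n f) x = \<zero>\<^bsub>U\<^esub> x"
    using x by (simp add: commutator_apply fU cU End_carrierD(2)[OF fU] differential_closed
        differential_add differential_smult differential_square smult_add smult_smult k
        End_value_zero[OF fU] flip: smult_add_left)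
qed (simp_all add: commutator_def)

text \<open>The two terms \<open>f d g\<close> on the right cancel.\<close>

lemma End_leibniz:
  assumes f: "f \<in> End_grade m" and g: "g \<in> End_grade n"
  shows "commutator (m + n) (f \<otimes>\<^bsub>U\<^esub> g) =
     (commutator m f \<otimes>\<^bsub>U\<^esub> g) \<oplus>\<^bsub>U\<^esub> (koszul_sign m \<odot>\<^bsub>U\<^esub> (f \<otimes>\<^bsub>U\<^esub> commutator n g))"
proof (rule End_ext_eqI)
  fix x assume x: "x \<in> carrier M"
  note fU = End_grade_carrier[OF f]
  note gU = End_grade_carrier[OF g]
  note D = End_carrierD(2)[OF fU] End_carrierD(2)[OF gU] differential_closed
  show "commutator (m + n) (f \<otimes>\<^bsub>U\<^esub> g) x =
     ((commutator m f \<otimes>\<^bsub>U\<^esub> g) \<oplus>\<^bsub>U\<^esub> (koszul_sign m \<odot>\<^bsub>U\<^esub> (f \<otimes>\<^bsub>U\<^esub> commutator n g))) x"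
    using x
    by (simp add: commutator_apply fU gU End_carrier_mult D End_carrierD(3,4)[OF fU] smult_add smult_smult
        koszul_sign_add a_assoc) (rule smult_cancel[symmetric]; simp add: D)
qed (simp_all add: commutator_def)

lemma End_dg_algebra: "dg_algebra E"
proof -
  interpret R: ring U by (rule End_ring)
  interpret RM: Module.module scalars U by (rule End_module)
  have mono: "add_monoid E = add_monoid U" by (simp add: End_record)
  have ag: "abelian_group E"
    by (rule comm_group_abelian_groupI) (use R.add.comm_group_axioms mono R.a_comm_group in simp)
  have mod: "Module.module scalars E"
    by (rule moduleI) (use ag cring_scalars RM.smult_l_distr RM.smult_r_distr RM.smult_assoc1 RM.smult_one
       RM.smult_closed in \<open>auto simp: End_record\<close>)
  have sub: "submodule (grade E n) scalars E" for n
    using End_submodule[of n] by (simp add: submodule_def submodule_axioms_def End_record)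
  have eq: "hom_decomp E = hom_decomp U" by (rule hom_decomp_cong) (auto simp: End_record)
  have sq: "differential E (differential E f) = \<zero>\<^bsub>U\<^esub>" if "f \<in> carrier U" for f
    using that
  proof (induction f rule: End_induct)
    case (homogeneous n f)
    then show ?case
      by (simp add: End_differential_homogeneous commutator_commutator
          End_differential_homogeneous[OF commutator_grade])
  next
    case (add f g)
    have "\<zero>\<^bsub>U\<^esub> \<oplus>\<^bsub>U\<^esub> \<zero>\<^bsub>U\<^esub> = \<zero>\<^bsub>U\<^esub>" by simp
    with add show ?case by (simp add: End_differential_add End_differential_carrier)
  qed (simp add: End_differential_zero)
  have space: "dg_space E"
  proof (rule dg_spaceI[OF mod sub])
    show "\<exists>c. hom_decomp E f c" if "f \<in> carrier E" for f
      using that by (simp add: eq End_decomp_exists End_record)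
    show "c = c'" if "hom_decomp E f c" "hom_decomp E f c'" for f c c'
      using that by (simp add: eq End_decomp_unique)
    show "differential E f \<in> grade E (n + 1)" if "f \<in> grade E n" for f n
      using that commutator_grade[of f n] End_differential_homogeneous[of f n] by (simp add: End_record(7))
  qed (simp_all add: End_record(1-7) End_differential_carrier End_differential_add End_differential_smult sq)
  have ring: "ring E"
  proof (rule ringI[OF ag])
    show "Group.monoid E"
      by (rule monoidI) (auto simp: End_record(1-7) R.m_assoc)
  qed (auto simp: End_record(1-7) R.l_distr R.r_distr)
  interpret space: dg_space E by (rule space)
  interpret ring: ring E by (rule ring)
  have "dg_algebra_axioms E"
  proof (unfold dg_algebra_axioms_def End_record(1-7), intro conjI allI impI)
    fix c f g assume fg: "f \<in> carrier U" "g \<in> carrier U"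
    show "(c \<odot>\<^bsub>U\<^esub> f) \<otimes>\<^bsub>U\<^esub> g = c \<odot>\<^bsub>U\<^esub> (f \<otimes>\<^bsub>U\<^esub> g)"
      by (rule End_ext_eqI) (use fg in \<open>auto simp: End_carrierD\<close>)
    show "f \<otimes>\<^bsub>U\<^esub> (c \<odot>\<^bsub>U\<^esub> g) = c \<odot>\<^bsub>U\<^esub> (f \<otimes>\<^bsub>U\<^esub> g)"
      by (rule End_ext_eqI) (use fg in \<open>auto simp: End_carrierD\<close>)
  next
    fix f g m assume f: "f \<in> End_grade m" and g: "g \<in> carrier U"
    note fU = End_grade_carrier[OF f]
    note f' = End_grade_carrier[OF commutator_grade[OF f]]
    show "differential E (f \<otimes>\<^bsub>U\<^esub> g) = (differential E f \<otimes>\<^bsub>U\<^esub> g) \<oplus>\<^bsub>U\<^esub>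
        (koszul_sign m \<odot>\<^bsub>U\<^esub> (f \<otimes>\<^bsub>U\<^esub> differential E g))"
      using g
    proof (induction g rule: End_induct)
      case zero
      show ?case
        using space.smult_zero[unfolded End_record]
        by (simp add: End_differential_zero End_differential_homogeneous[OF f] fU f')
    next
      case (homogeneous n g)
      then show ?case
        by (simp add: End_differential_homogeneous[OF f] End_differential_homogeneous
            End_differential_homogeneous[OF End_grade_mult[OF f]] End_leibniz[OF f])
    next
      case (add g h)
      note D = add(1,2) fU f' End_differential_carrier
      have "differential E (f \<otimes>\<^bsub>U\<^esub> (g \<oplus>\<^bsub>U\<^esub> h)) =
         differential E (f \<otimes>\<^bsub>U\<^esub> g) \<oplus>\<^bsub>U\<^esub> differential E (f \<otimes>\<^bsub>U\<^esub> h)"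
        by (simp add: R.r_distr D End_differential_add)
      then show ?case
        unfolding add(3,4)
        by (simp add: R.r_distr D End_differential_add End_differential_homogeneous[OF f]
            space.smult_add[unfolded End_record(1-7)] R.a_ac End_carrier_smult)
    qed
  qed (auto simp: End_grade_one End_grade_mult)
  then show ?thesis using space ring by (simp add: dg_algebra_def)
qed

end

section \<open>Right multiplication as a homomorphism\<close>

context dg_bimodule
begin

lemma bilinear_right: "bilinear_dg B M M (\<lambda>b z. ract M z b)"
  by unfold_locales (auto simp: ract_closed ract_add_left ract_add_right ract_smult_left ract_smult_right)

interpretation right: bilinear_dg B M M "\<lambda>b z. ract M z b"
  by (rule bilinear_right)

abbreviation "rmult \<equiv> right_mult_map B M"

lemma rmult_apply: "z \<in> carrier M \<Longrightarrow> rmult b z = right.S b z"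
  by (simp add: right_mult_map_def)

lemma rmult_extensional: "rmult b \<in> extensional (carrier M)"
  by (simp add: right_mult_map_def)

lemma rmult_homogeneous:
  "b \<in> grade B n \<Longrightarrow> z \<in> grade M m \<Longrightarrow> rmult b z = koszul_sign (n * m) \<odot> ract M z b"
  by (simp add: rmult_apply grade_closed right.signed_homogeneous)

lemma rmult_add:
  "b \<in> carrier B \<Longrightarrow> b' \<in> carrier B \<Longrightarrow> rmult (b \<oplus>\<^bsub>B\<^esub> b') = rmult b \<oplus>\<^bsub>U\<^esub> rmult b'"
  by (rule End_ext_eqI) (simp_all add: rmult_extensional rmult_apply right.signed_add_left)

lemma rmult_smult: "b \<in> carrier B \<Longrightarrow> rmult (c \<odot>\<^bsub>B\<^esub> b) = c \<odot>\<^bsub>U\<^esub> rmult b"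
  by (rule End_ext_eqI) (simp_all add: rmult_extensional rmult_apply right.signed_smult_left)

lemma rmult_zero: "rmult \<zero>\<^bsub>B\<^esub> = \<zero>\<^bsub>U\<^esub>"
  by (rule End_ext_eqI) (simp_all add: rmult_extensional rmult_apply)

lemma rmult_grade:
  assumes b: "b \<in> grade B n"
  shows "rmult b \<in> End_grade n"
proof (rule End_gradeI)
  note b' = B.grade_closed[OF b]
  fix z assume z: "z \<in> carrier M"
  show "rmult b z \<in> carrier M" using z b' by (simp add: rmult_apply right.signed_closed)
  show "rmult b (z \<oplus> z') = rmult b z \<oplus> rmult b z'" if "z' \<in> carrier M" for z'
    using z b' that by (simp add: rmult_apply right.signed_add_right)
  show "rmult b (c \<odot> z) = c \<odot> rmult b z" for c
    using z b' by (simp add: rmult_apply right.signed_smult_right)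
  fix m a assume a: "a \<in> grade A m"
  note a' = A.grade_closed[OF a]
  show "rmult b (lact M a z) = koszul_sign (n * m) \<odot> lact M a (rmult b z)"
    using z
  proof (induction z rule: homogeneous_induct)
    case zero
    have "lact M a \<zero> = \<zero>" using lact_smult_right[OF a', of \<zero> 0] a' by (simp add: lact_closed)
    then show ?case using b' by (simp add: rmult_apply)
  next
    case (homogeneous l z)
    note z' = grade_closed[OF homogeneous]
    show ?case
      using a' b' z'
      by (simp add: rmult_homogeneous[OF b homogeneous] rmult_homogeneous[OF b lact_grade[OF a homogeneous]]
          lact_smult_right lact_ract ract_closed lact_closed smult_smult koszul_sign_add algebra_simps)
  next
    case (add x y)
    then show ?case
      using a' b'
      by (simp add: lact_add_right lact_closed rmult_apply right.signed_add_right right.signed_closed smult_add)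
  qed
next
  fix l z assume z: "z \<in> grade M l"
  show "rmult b z \<in> grade M (l + n)"
    unfolding rmult_homogeneous[OF b z] by (intro grade_smult ract_grade z b)
qed (rule rmult_extensional)

lemma rmult_carrier: "b \<in> carrier B \<Longrightarrow> rmult b \<in> carrier U"
proof (induction b rule: B.homogeneous_induct)
  case (homogeneous n b)
  then show ?case using rmult_grade End_grade_carrier by blast
qed (simp_all add: rmult_zero rmult_add End_carrier_zero End_carrier_add)

lemma rmult_eqI:
  assumes "b \<in> carrier B" "f \<in> carrier U" "\<And>m z. z \<in> grade M m \<Longrightarrow> rmult b z = f z"
  shows "rmult b = f"
proof (rule End_eqI[OF rmult_carrier[OF assms(1)] assms(2)])
  fix z assume "z \<in> carrier M"
  then show "rmult b z = f z"
  proof (induction z rule: homogeneous_induct)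
    case (add x y)
    then show ?case using rmult_carrier[OF assms(1)] assms(2) by (simp add: End_carrierD)
  qed (use rmult_carrier[OF assms(1)] assms(2,3) in auto)
qed

text \<open>For \<open>z\<close> of degree \<open>p\<close>, applying \<open>b\<close> and then \<open>b'\<close> produces the sign of
  \<open>mp + n(m + p)\<close>, while \<open>b b'\<close> produces that of \<open>(m + n)p\<close>. The excess \<open>mn\<close> is the
  sign in the product of the opposite algebra. For the differential, the terms \<open>(dz)b\<close> of
  the commutator cancel by the Leibniz rule, and \<open>z(db)\<close> remains.\<close>

lemma right_mult_dg_algebra_hom: "dg_algebra_hom B (dg_opposite E) rmult"
proof -
  interpret E: dg_algebra E by (rule End_dg_algebra)
  interpret opp: bilinear_dg E E E "\<lambda>x y. y \<otimes>\<^bsub>E\<^esub> x" by (rule E.bilinear_opposite)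
  note simps = dg_opposite_simps[of E] End_record(1-7)
  have mult: "rmult (b \<otimes>\<^bsub>B\<^esub> b') = opp.S (rmult b) (rmult b')" if "b \<in> carrier B" "b' \<in> carrier B" for b b'
    using that
  proof (induction b rule: B.homogeneous_induct)
    case zero
    then show ?case using opp.signed_zero_left rmult_carrier by (simp add: rmult_zero End_record(1-7))
  next
    case (homogeneous m b)
    note b = homogeneous(1) B.grade_closed[OF homogeneous(1)]
    from homogeneous(2) show ?case
    proof (induction b' rule: B.homogeneous_induct)
      case zero
      then show ?case using opp.signed_zero_right rmult_carrier b by (simp add: rmult_zero End_record(1-7))
    next
      case (homogeneous n b')
      note b' = homogeneous B.grade_closed[OF homogeneous]
      have S: "opp.S (rmult b) (rmult b') = koszul_sign (m * n) \<odot>\<^bsub>U\<^esub> (rmult b' \<otimes>\<^bsub>U\<^esub> rmult b)"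
        using opp.signed_homogeneous[of "rmult b" m "rmult b'" n] rmult_grade b(1) b'(1) by (simp add: End_record(1-7))
      show ?case unfolding S
      proof (rule rmult_eqI)
        fix p z assume z: "z \<in> grade M p"
        note z' = grade_closed[OF z]
        have "rmult b' (koszul_sign (m * p) \<odot> ract M z b) =
            koszul_sign (n * (p + m)) \<odot> ract M (koszul_sign (m * p) \<odot> ract M z b) b'"
          by (intro rmult_homogeneous b'(1) grade_smult ract_grade z b(1))
        then show "rmult (b \<otimes>\<^bsub>B\<^esub> b') z = (koszul_sign (m * n) \<odot>\<^bsub>U\<^esub> (rmult b' \<otimes>\<^bsub>U\<^esub> rmult b)) z"
          using z' b b'(2)
          by (simp add: rmult_homogeneous[OF b(1) z] rmult_homogeneous[OF B.mult_grade[OF b(1) b'(1)] z]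
              ract_closed ract_smult_left ract_mult smult_smult koszul_sign_add algebra_simps)
      qed (use b b' in \<open>auto simp: End_carrier_smult End_carrier_mult rmult_carrier\<close>)
    next
      case (add x y)
      then show ?case using b opp.signed_add_right[of "rmult b" "rmult x" "rmult y"] rmult_carrier
        by (simp add: B.r_distr rmult_add End_record(1-7))
    qed
  next
    case (add x y)
    then show ?case using opp.signed_add_left[of "rmult x" "rmult y" "rmult b'"] rmult_carrier
      by (simp add: B.l_distr rmult_add End_record(1-7))
  qed
  have one: "rmult \<one>\<^bsub>B\<^esub> = \<one>\<^bsub>U\<^esub>"
  proof (rule rmult_eqI)
    fix m z assume z: "z \<in> grade M m"
    show "rmult \<one>\<^bsub>B\<^esub> z = \<one>\<^bsub>U\<^esub> z"
      using grade_closed[OF z] by (simp add: rmult_homogeneous[OF B.one_grade z] ract_one koszul_sign_parity)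
  qed (auto simp: End_carrier_one)
  have diff: "rmult (differential B b) = differential E (rmult b)" if "b \<in> carrier B" for b
    using that
  proof (induction b rule: B.homogeneous_induct)
    case zero
    then show ?case by (simp add: rmult_zero End_differential_zero)
  next
    case (homogeneous n b)
    note b = homogeneous B.grade_closed[OF homogeneous] B.differential_grade[OF homogeneous]
      B.differential_closed[OF B.grade_closed[OF homogeneous]]
    note bE = rmult_grade[OF b(1)]
    show ?case
      unfolding End_differential_homogeneous[OF bE]
    proof (rule rmult_eqI[OF b(4) End_grade_carrier[OF commutator_grade[OF bE]]])
      fix m z assume z: "z \<in> grade M m"
      note z' = grade_closed[OF z] differential_grade[OF z] differential_closed[OF grade_closed[OF z]]
      have cancel: "x = y \<oplus> x \<oplus> c \<odot> y'"
        if "c \<odot> y' = (- 1) \<odot> y" "x \<in> carrier M" "y \<in> carrier M" for x y y' c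
        using that by (simp add: smult_minus_1 a_ac r_neg1 r_neg2) (simp add: a_lcomm r_neg)
      have "rmult (differential B b) z = koszul_sign ((n + 1) * m) \<odot> ract M z (differential B b)"
        by (rule rmult_homogeneous[OF b(3) z])
      moreover have "commutator n (rmult b) z =
          koszul_sign (n * m) \<odot> ract M (differential M z) b \<oplus>
          koszul_sign ((n + 1) * m) \<odot> ract M z (differential B b) \<oplus>
          (- koszul_sign n) \<odot> (koszul_sign (n * (m + 1)) \<odot> ract M (differential M z) b)"
        using b z'
        by (simp add: commutator_apply End_grade_carrier[OF bE] rmult_homogeneous[OF b(1) z]
            rmult_homogeneous[OF b(1) z'(2)] differential_smult ract_leibniz[OF z b(2)] ract_closed smult_add
            smult_smult koszul_sign_add algebra_simps)
      ultimately show "rmult (differential B b) z = commutator n (rmult b) z"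
        using b z'
        by (simp only:) (rule cancel; simp add: smult_smult ract_closed koszul_sign_add algebra_simps)
    qed
  next
    case (add x y)
    then show ?case
      by (simp add: B.differential_add rmult_add B.differential_closed End_differential_add rmult_carrier)
  qed
  show ?thesis
  proof (intro dg_algebra_hom.intro dg_algebra_hom_axioms.intro B.dg_algebra_axioms
      dg_algebra_opposite[OF End_dg_algebra] ring_hom_memI)
  qed (auto simp: simps rmult_carrier rmult_add rmult_smult rmult_grade mult one diff)
qed

end

section \<open>Quasi-isomorphisms in terms of elements\<close>

context dg_space
begin

definition cocycle_group :: "int \<Rightarrow> 'a monoid" where
  "cocycle_group n = \<lparr>carrier = cocycles C n, mult = add C, one = \<zero>\<rparr>"

lemma minus_grade: "x \<in> grade C n \<Longrightarrow> \<ominus> x \<in> grade C n"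
  using grade_smult[of x n "- 1"] by (simp add: smult_minus_1 grade_closed)

lemma differential_minus: "x \<in> carrier C \<Longrightarrow> differential C (\<ominus> x) = \<ominus> differential C x"
  using differential_smult[of x "- 1"] by (simp add: smult_minus_1 differential_closed)

lemma cocycle_closed: "x \<in> cocycles C n \<Longrightarrow> x \<in> carrier C"
  by (auto simp: cocycles_def grade_closed)

lemma coboundary_cocycle: "x \<in> coboundaries C n \<Longrightarrow> x \<in> cocycles C n"
  using differential_grade[of _ "n - 1"]
  by (auto simp: cocycles_def coboundaries_def differential_square grade_closed)

lemma cocycle_add: "\<lbrakk>x \<in> cocycles C n; y \<in> cocycles C n\<rbrakk> \<Longrightarrow> x \<oplus> y \<in> cocycles C n"
  by (auto simp: cocycles_def grade_add differential_add grade_closed)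

lemma cocycle_minus: "x \<in> cocycles C n \<Longrightarrow> \<ominus> x \<in> cocycles C n"
  by (auto simp: cocycles_def minus_grade differential_minus grade_closed)

lemma zero_coboundary: "\<zero> \<in> coboundaries C n"
  unfolding coboundaries_def by (rule image_eqI[of _ _ "\<zero>"]) auto

lemma coboundary_add: "\<lbrakk>x \<in> coboundaries C n; y \<in> coboundaries C n\<rbrakk> \<Longrightarrow> x \<oplus> y \<in> coboundaries C n"
  unfolding coboundaries_def
  by (auto simp: differential_add[symmetric] grade_closed grade_add)

lemma coboundary_minus: "x \<in> coboundaries C n \<Longrightarrow> \<ominus> x \<in> coboundaries C n"
  unfolding coboundaries_def
  by (auto simp: differential_minus[symmetric] grade_closed minus_grade)

lemma comm_group_cocycles: "Group.comm_group (cocycle_group n)"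
proof (rule comm_groupI)
  fix x assume "x \<in> carrier (cocycle_group n)"
  then show "\<exists>y\<in>carrier (cocycle_group n). y \<otimes>\<^bsub>cocycle_group n\<^esub> x = \<one>\<^bsub>cocycle_group n\<^esub>"
    by (intro bexI[of _ "\<ominus> x"]) (auto simp: cocycle_group_def cocycle_minus l_neg cocycle_closed)
qed (auto simp: cocycle_group_def cocycle_add a_ac cocycle_closed coboundary_cocycle zero_coboundary)

lemma inv_cocycle: assumes "x \<in> cocycles C n" shows "inv\<^bsub>cocycle_group n\<^esub> x = \<ominus> x"
proof -
  interpret G: Group.comm_group "cocycle_group n" by (rule comm_group_cocycles)
  show ?thesis
    by (rule G.inv_equality) (use assms in \<open>auto simp: cocycle_group_def cocycle_minus l_neg cocycle_closed\<close>)
qed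

lemma coboundaries_normal: "coboundaries C n \<lhd> cocycle_group n"
proof -
  interpret G: Group.comm_group "cocycle_group n" by (rule comm_group_cocycles)
  have "subgroup (coboundaries C n) (cocycle_group n)"
  proof (rule G.subgroupI)
    show "inv\<^bsub>cocycle_group n\<^esub> x \<in> coboundaries C n" if "x \<in> coboundaries C n" for x
      using that by (simp add: inv_cocycle coboundary_cocycle coboundary_minus)
  qed (use zero_coboundary in \<open>auto simp: cocycle_group_def coboundary_cocycle coboundary_add\<close>)
  then show ?thesis by (rule G.normal_iff_subgroup[THEN iffD2])
qed

lemma cohomology_eq: "cohomology C n = cocycle_group n Mod coboundaries C n"
  by (simp add: cohomology_def cocycle_group_def)

abbreviation cohomology_class :: "int \<Rightarrow> 'a \<Rightarrow> 'a set" where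
  "cohomology_class n x \<equiv> coboundaries C n #>\<^bsub>cocycle_group n\<^esub> x"

lemma cohomology_class_eq_iff:
  assumes "x \<in> cocycles C n" "y \<in> cocycles C n"
  shows "cohomology_class n x = cohomology_class n y \<longleftrightarrow> x \<ominus> y \<in> coboundaries C n"
proof -
  interpret G: Group.comm_group "cocycle_group n" by (rule comm_group_cocycles)
  interpret N: normal "coboundaries C n" "cocycle_group n" by (rule coboundaries_normal)
  have "cohomology_class n x = cohomology_class n y \<longleftrightarrow>
      x \<otimes>\<^bsub>cocycle_group n\<^esub> inv\<^bsub>cocycle_group n\<^esub> y \<in> coboundaries C n"
    using assms N.rcos_module[of y x] G.repr_independence[of x "coboundaries C n" y] N.subgroup_axioms
      G.rcos_self[of x "coboundaries C n"] G.is_group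
    by (auto simp: cocycle_group_def)
  then show ?thesis using assms by (simp add: inv_cocycle minus_eq) (simp add: cocycle_group_def)
qed

end

text \<open>Being bijective on cohomology, spelled out for cocycles. In this form the property passes
  to isomorphic copies without any reference to cosets.\<close>

definition dg_quasi_iso_elementwise ::
    "('k::field, 'a) dg \<Rightarrow> ('k, 'b) dg \<Rightarrow> ('a \<Rightarrow> 'b) \<Rightarrow> bool" where
  "dg_quasi_iso_elementwise C D f \<longleftrightarrow> dg_algebra_hom C D f \<and>
     (\<forall>n. \<forall>x\<in>cocycles C n. f x \<in> coboundaries D n \<longrightarrow> x \<in> coboundaries C n) \<and>
     (\<forall>n. \<forall>y\<in>cocycles D n. \<exists>x\<in>cocycles C n. \<exists>w\<in>coboundaries D n. y = w \<oplus>\<^bsub>D\<^esub> f x)"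

context dg_algebra_hom
begin

lemma hom_closed: "x \<in> carrier C \<Longrightarrow> f x \<in> carrier D"
  and hom_add: "\<lbrakk>x \<in> carrier C; y \<in> carrier C\<rbrakk> \<Longrightarrow> f (x \<oplus>\<^bsub>C\<^esub> y) = f x \<oplus>\<^bsub>D\<^esub> f y"
  and hom_mult: "\<lbrakk>x \<in> carrier C; y \<in> carrier C\<rbrakk> \<Longrightarrow> f (x \<otimes>\<^bsub>C\<^esub> y) = f x \<otimes>\<^bsub>D\<^esub> f y"
  and hom_one: "f \<one>\<^bsub>C\<^esub> = \<one>\<^bsub>D\<^esub>"
  using ring_hom by (auto simp: ring_hom_def)

lemma hom_zero: "f \<zero>\<^bsub>C\<^esub> = \<zero>\<^bsub>D\<^esub>"
  using hom_smult[of "\<zero>\<^bsub>C\<^esub>" 0] hom_closed[of "\<zero>\<^bsub>C\<^esub>"] by simp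

lemma hom_minus: "x \<in> carrier C \<Longrightarrow> y \<in> carrier C \<Longrightarrow> f (x \<ominus>\<^bsub>C\<^esub> y) = f x \<ominus>\<^bsub>D\<^esub> f y"
  by (simp add: C.minus_eq_smult D.minus_eq_smult hom_add hom_smult hom_closed)

lemma hom_cocycle: "x \<in> cocycles C n \<Longrightarrow> f x \<in> cocycles D n"
  using hom_differential[of x] by (auto simp: cocycles_def hom_grade C.grade_closed hom_zero)

lemma hom_coboundary: "x \<in> coboundaries C n \<Longrightarrow> f x \<in> coboundaries D n"
  by (auto simp: coboundaries_def hom_grade C.grade_closed hom_differential)

lemma cohomology_map_class:
  assumes x: "x \<in> cocycles C n"
  shows "cohomology_map D f n (C.cohomology_class n x) = D.cohomology_class n (f x)"
proof -
  have "cohomology_map D f n (C.cohomology_class n x) =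
      {a \<oplus>\<^bsub>D\<^esub> f (h \<oplus>\<^bsub>C\<^esub> x) | a h. a \<in> coboundaries D n \<and> h \<in> coboundaries C n}"
    by (auto simp: cohomology_map_def set_add_def set_mult_def r_coset_def C.cocycle_group_def)
  also have "\<dots> = {(a \<oplus>\<^bsub>D\<^esub> f h) \<oplus>\<^bsub>D\<^esub> f x | a h. a \<in> coboundaries D n \<and> h \<in> coboundaries C n}"
  proof -
    have "a \<oplus>\<^bsub>D\<^esub> f (h \<oplus>\<^bsub>C\<^esub> x) = (a \<oplus>\<^bsub>D\<^esub> f h) \<oplus>\<^bsub>D\<^esub> f x"
      if "a \<in> coboundaries D n" "h \<in> coboundaries C n" for a h
      using x C.cocycle_closed[of x n] D.cocycle_closed[OF D.coboundary_cocycle[OF that(1)]]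
        C.cocycle_closed[OF C.coboundary_cocycle[OF that(2)]]
      by (simp add: hom_add D.a_assoc hom_closed)
    then show ?thesis by (metis (no_types, lifting))
  qed
  also have "\<dots> = {b \<oplus>\<^bsub>D\<^esub> f x | b. b \<in> coboundaries D n}"
  proof (intro subset_antisym subsetI)
    fix y assume "y \<in> {b \<oplus>\<^bsub>D\<^esub> f x | b. b \<in> coboundaries D n}"
    then obtain b where b: "b \<in> coboundaries D n" "y = b \<oplus>\<^bsub>D\<^esub> f x" by blast
    then have "y = (b \<oplus>\<^bsub>D\<^esub> f \<zero>\<^bsub>C\<^esub>) \<oplus>\<^bsub>D\<^esub> f x"
      using D.cocycle_closed[OF D.coboundary_cocycle] by (simp add: hom_zero)
    then show "y \<in> {(a \<oplus>\<^bsub>D\<^esub> f h) \<oplus>\<^bsub>D\<^esub> f x | a h. a \<in> coboundaries D n \<and> h \<in> coboundaries C n}"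
      using b(1) C.zero_coboundary by blast
  qed (auto intro: D.coboundary_add hom_coboundary)
  also have "\<dots> = D.cohomology_class n (f x)"
    by (auto simp: r_coset_def D.cocycle_group_def)
  finally show ?thesis .
qed

lemma cohomology_map_hom: "cohomology_map D f n \<in> Group.hom (cohomology C n) (cohomology D n)"
proof -
  interpret CN: normal "coboundaries C n" "C.cocycle_group n" by (rule C.coboundaries_normal)
  interpret DN: normal "coboundaries D n" "D.cocycle_group n" by (rule D.coboundaries_normal)
  show ?thesis
  proof (rule homI)
    fix X assume "X \<in> carrier (cohomology C n)"
    then obtain x where "x \<in> cocycles C n" "X = C.cohomology_class n x"
      by (auto simp: C.cohomology_eq FactGroup_def RCOSETS_def C.cocycle_group_def)
    then show "cohomology_map D f n X \<in> carrier (cohomology D n)"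
      using hom_cocycle[of x n]
      by (auto simp: cohomology_map_class D.cohomology_eq FactGroup_def RCOSETS_def D.cocycle_group_def)
  next
    fix X Y assume "X \<in> carrier (cohomology C n)" "Y \<in> carrier (cohomology C n)"
    then obtain x y where x: "x \<in> cocycles C n" "X = C.cohomology_class n x"
      and y: "y \<in> cocycles C n" "Y = C.cohomology_class n y"
      by (auto simp: C.cohomology_eq FactGroup_def RCOSETS_def C.cocycle_group_def)
    have "X \<otimes>\<^bsub>cohomology C n\<^esub> Y = C.cohomology_class n (x \<oplus>\<^bsub>C\<^esub> y)"
      using CN.rcos_sum[of x y] x y by (simp add: C.cohomology_eq FactGroup_def C.cocycle_group_def)
    moreover have "D.cohomology_class n (f x) <#>\<^bsub>D.cocycle_group n\<^esub> D.cohomology_class n (f y) =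
        D.cohomology_class n (f x \<oplus>\<^bsub>D\<^esub> f y)"
      using DN.rcos_sum[of "f x" "f y"] x y hom_cocycle by (simp add: D.cocycle_group_def)
    ultimately show "cohomology_map D f n (X \<otimes>\<^bsub>cohomology C n\<^esub> Y) =
        cohomology_map D f n X \<otimes>\<^bsub>cohomology D n\<^esub> cohomology_map D f n Y"
      using x y by (simp add: cohomology_map_class C.cocycle_add C.cocycle_closed hom_add
          D.cohomology_eq FactGroup_def)
  qed
qed

end

lemma dg_quasi_isoI:
  assumes "dg_quasi_iso_elementwise C D f"
  shows "dg_quasi_iso C D f"
proof -
  interpret dg_algebra_hom C D f using assms by (simp add: dg_quasi_iso_elementwise_def)
  have "bij_betw (cohomology_map D f n) (carrier (cohomology C n)) (carrier (cohomology D n))" for n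
  proof (rule bij_betw_imageI)
    show "inj_on (cohomology_map D f n) (carrier (cohomology C n))"
    proof (rule inj_onI)
      fix X Y assume "X \<in> carrier (cohomology C n)" "Y \<in> carrier (cohomology C n)"
      then obtain x y where x: "x \<in> cocycles C n" "X = C.cohomology_class n x"
        and y: "y \<in> cocycles C n" "Y = C.cohomology_class n y"
        by (auto simp: C.cohomology_eq FactGroup_def RCOSETS_def C.cocycle_group_def)
      assume "cohomology_map D f n X = cohomology_map D f n Y"
      then have "f x \<ominus>\<^bsub>D\<^esub> f y \<in> coboundaries D n"
        using x y by (simp add: cohomology_map_class hom_cocycle D.cohomology_class_eq_iff)
      then have "f (x \<ominus>\<^bsub>C\<^esub> y) \<in> coboundaries D n"
        using x y C.cocycle_closed by (simp add: hom_minus)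
      moreover have "x \<ominus>\<^bsub>C\<^esub> y \<in> cocycles C n"
        using x y by (simp add: C.minus_eq C.cocycle_add C.cocycle_minus)
      ultimately have "x \<ominus>\<^bsub>C\<^esub> y \<in> coboundaries C n"
        using assms by (auto simp: dg_quasi_iso_elementwise_def)
      then show "X = Y" using x y by (simp add: C.cohomology_class_eq_iff)
    qed
    show "cohomology_map D f n ` carrier (cohomology C n) = carrier (cohomology D n)"
    proof
      show "cohomology_map D f n ` carrier (cohomology C n) \<subseteq> carrier (cohomology D n)"
        using cohomology_map_hom[of n] by (auto simp: hom_def)
      show "carrier (cohomology D n) \<subseteq> cohomology_map D f n ` carrier (cohomology C n)"
      proof
        fix Y assume "Y \<in> carrier (cohomology D n)"
        then obtain y where y: "y \<in> cocycles D n" "Y = D.cohomology_class n y"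
          by (auto simp: D.cohomology_eq FactGroup_def RCOSETS_def D.cocycle_group_def)
        then obtain x w where xw: "x \<in> cocycles C n" "w \<in> coboundaries D n" "y = w \<oplus>\<^bsub>D\<^esub> f x"
          using assms unfolding dg_quasi_iso_elementwise_def by blast
        have "w \<in> carrier D" "f x \<in> carrier D"
          using xw D.coboundary_cocycle D.cocycle_closed hom_cocycle by blast+
        then have "y \<ominus>\<^bsub>D\<^esub> f x = w"
          using xw(3) by (simp add: D.minus_eq D.a_assoc D.r_neg)
        then have "Y = D.cohomology_class n (f x)"
          using y xw by (simp add: D.cohomology_class_eq_iff hom_cocycle)
        then have "Y = cohomology_map D f n (C.cohomology_class n x)"
          using xw by (simp add: cohomology_map_class)
        moreover have "C.cohomology_class n x \<in> carrier (cohomology C n)"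
          using xw by (auto simp: C.cohomology_eq FactGroup_def RCOSETS_def C.cocycle_group_def)
        ultimately show "Y \<in> cohomology_map D f n ` carrier (cohomology C n)" by blast
      qed
    qed
  qed
  then show ?thesis
    using cohomology_map_hom dg_algebra_hom_axioms by (auto simp: dg_quasi_iso_def iso_def)
qed

text \<open>Transport of structure along an injection. A zigzag between two dg algebras has to live on
  the sum of their types, and copies of the end points serve as its inner members.\<close>

definition dg_copy :: "('a \<Rightarrow> 'b) \<Rightarrow> ('k::field, 'a) dg \<Rightarrow> ('k, 'b) dg" where
  "dg_copy h C =
     \<lparr>carrier = h ` carrier C,
      mult = (\<lambda>x y. h (inv_into UNIV h x \<otimes>\<^bsub>C\<^esub> inv_into UNIV h y)),
      one = h \<one>\<^bsub>C\<^esub>, zero = h \<zero>\<^bsub>C\<^esub>,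
      add = (\<lambda>x y. h (inv_into UNIV h x \<oplus>\<^bsub>C\<^esub> inv_into UNIV h y)),
      smult = (\<lambda>c x. h (c \<odot>\<^bsub>C\<^esub> inv_into UNIV h x)),
      grade = (\<lambda>n. h ` grade C n),
      differential = (\<lambda>x. h (differential C (inv_into UNIV h x)))\<rparr>"

lemma dg_copy_simps:
  assumes "inj h"
  shows "carrier (dg_copy h C) = h ` carrier C" "one (dg_copy h C) = h \<one>\<^bsub>C\<^esub>"
    "zero (dg_copy h C) = h \<zero>\<^bsub>C\<^esub>"
    "h x \<otimes>\<^bsub>dg_copy h C\<^esub> h y = h (x \<otimes>\<^bsub>C\<^esub> y)" "h x \<oplus>\<^bsub>dg_copy h C\<^esub> h y = h (x \<oplus>\<^bsub>C\<^esub> y)"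
    "c \<odot>\<^bsub>dg_copy h C\<^esub> h x = h (c \<odot>\<^bsub>C\<^esub> x)"
    "grade (dg_copy h C) n = h ` grade C n"
    "differential (dg_copy h C) (h x) = h (differential C x)"
  using assms by (simp_all add: dg_copy_def)

lemma dg_algebra_copy:
  assumes "dg_algebra C" and h: "inj h"
  shows "dg_algebra (dg_copy h C)"
proof -
  interpret dg_algebra C by fact
  let ?D = "dg_copy h C"
  note simps = dg_copy_simps[OF h, of C]
  have ag: "abelian_group ?D"
  proof (rule abelian_groupI)
    fix x assume "x \<in> carrier ?D"
    then obtain y where y: "x = h y" "y \<in> carrier C" by (auto simp: simps)
    then show "\<exists>z\<in>carrier ?D. z \<oplus>\<^bsub>?D\<^esub> x = \<zero>\<^bsub>?D\<^esub>"
      by (intro bexI[of _ "h (\<ominus>\<^bsub>C\<^esub> y)"]) (auto simp: simps l_neg)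
  qed (auto simp: simps a_ac)
  have ring: "ring ?D"
  proof (rule ringI[OF ag])
    show "Group.monoid ?D" by (rule monoidI) (auto simp: simps m_assoc)
  qed (auto simp: simps l_distr r_distr)
  have mod: "Module.module scalars ?D"
    by (rule moduleI[OF cring_scalars ag]) (auto simp: simps smult_add smult_add_left smult_smult)
  interpret D: Module.module scalars ?D by (rule mod)
  have sub: "submodule (grade ?D n) scalars ?D" for n
  proof (rule D.submoduleI)
    fix x assume "x \<in> grade ?D n"
    then obtain y where y: "x = h y" "y \<in> grade C n" by (auto simp: simps)
    have "\<ominus>\<^bsub>?D\<^esub> x = h (\<ominus>\<^bsub>C\<^esub> y)"
      by (rule D.minus_equality) (use y in \<open>auto simp: simps grade_closed l_neg\<close>)
    then show "\<ominus>\<^bsub>?D\<^esub> x \<in> grade ?D n" using y by (simp add: simps minus_grade)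
  qed (auto simp: simps grade_closed grade_add grade_smult)
  have sum: "finsum ?D (\<lambda>i. h (c i)) N = h (finsum C c N)" if "c \<in> N \<rightarrow> carrier C" for c and N :: "int set"
    by (rule additive_finsum[OF abelian_group_axioms ag, of h, symmetric]) (use that in \<open>auto simp: simps\<close>)
  have decomp: "hom_decomp ?D (h x) (\<lambda>n. h (c n)) \<longleftrightarrow> hom_decomp C x c" for x c
  proof -
    have g: "(\<forall>n. h (c n) \<in> h ` grade C n) \<longleftrightarrow> (\<forall>n. c n \<in> grade C n)"
      using h by (simp add: inj_image_mem_iff)
    show ?thesis
    proof (cases "\<forall>n. c n \<in> grade C n")
      case True
      then have "c \<in> {n. c n \<noteq> \<zero>\<^bsub>C\<^esub>} \<rightarrow> carrier C" using grade_closed by blast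
      from sum[OF this] show ?thesis
        using h True by (auto simp: hom_decomp_def simps inj_eq)
    next
      case False
      then show ?thesis unfolding hom_decomp_def simps g by blast
    qed
  qed
  have form: "\<exists>c'. c = (\<lambda>n. h (c' n))" if "hom_decomp ?D x c" for x c
  proof -
    have "c n \<in> h ` grade C n" for n using that by (auto simp: hom_decomp_def simps)
    then have "c = (\<lambda>n. h (inv_into UNIV h (c n)))" by (intro ext) (metis f_inv_into_f imageE rangeI)
    then show ?thesis by (rule exI[of _ "\<lambda>n. inv_into UNIV h (c n)"])
  qed
  have space: "dg_space ?D"
  proof (rule dg_spaceI[OF mod sub])
    fix x assume "x \<in> carrier ?D"
    then obtain y where y: "x = h y" "y \<in> carrier C" by (auto simp: simps)
    then show "\<exists>c. hom_decomp ?D x c" using decomp hom_decomp_hom_comp by blast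
    fix c c' assume "hom_decomp ?D x c" "hom_decomp ?D x c'"
    then show "c = c'" using form decomp y hom_decomp_unique by metis
  qed (auto simp: simps differential_closed differential_add differential_smult differential_grade
      differential_square)
  have "dg_algebra_axioms ?D"
    by unfold_locales (auto simp: simps smult_mult_left smult_mult_right one_grade mult_grade leibniz)
  then show ?thesis using space ring by (simp add: dg_algebra_def)
qed

lemma dg_copy_cocycles:
  assumes "dg_algebra C" "inj h"
  shows "cocycles (dg_copy h C) n = h ` cocycles C n"
    "coboundaries (dg_copy h C) n = h ` coboundaries C n"
  using assms(2)
  by (auto simp: cocycles_def coboundaries_def dg_copy_simps[OF assms(2)] inj_eq image_image)

lemma dg_quasi_iso_elementwise_copy_target:
  assumes "dg_quasi_iso_elementwise C D f" "inj h"
  shows "dg_quasi_iso_elementwise C (dg_copy h D) (\<lambda>x. h (f x))"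
proof -
  interpret dg_algebra_hom C D f using assms by (simp add: dg_quasi_iso_elementwise_def)
  note simps = dg_copy_simps[OF assms(2), of D]
  have hom: "dg_algebra_hom C (dg_copy h D) (\<lambda>x. h (f x))"
    by (intro dg_algebra_hom.intro dg_algebra_hom_axioms.intro C.dg_algebra_axioms
        dg_algebra_copy[OF D.dg_algebra_axioms assms(2)] ring_hom_memI)
      (auto simp: simps hom_closed hom_add hom_mult hom_one hom_smult hom_grade hom_differential)
  note cc = dg_copy_cocycles[OF D.dg_algebra_axioms assms(2)]
  show ?thesis
    unfolding dg_quasi_iso_elementwise_def cc
  proof (intro conjI allI ballI impI hom)
    fix n x assume "x \<in> cocycles C n" "h (f x) \<in> h ` coboundaries D n"
    then show "x \<in> coboundaries C n"
      using assms by (auto simp: dg_quasi_iso_elementwise_def inj_image_mem_iff)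
  next
    fix n y assume "y \<in> h ` cocycles D n"
    then obtain z where "z \<in> cocycles D n" "y = h z" by blast
    then obtain x w where "x \<in> cocycles C n" "w \<in> coboundaries D n" "z = w \<oplus>\<^bsub>D\<^esub> f x"
      using assms unfolding dg_quasi_iso_elementwise_def by blast
    then show "\<exists>x\<in>cocycles C n. \<exists>w\<in>h ` coboundaries D n. y = w \<oplus>\<^bsub>dg_copy h D\<^esub> h (f x)"
      using \<open>y = h z\<close> by (auto simp: simps)
  qed
qed

lemma dg_quasi_iso_elementwise_copy_source:
  assumes "dg_quasi_iso_elementwise C D f" "inj h"
  shows "dg_quasi_iso_elementwise (dg_copy h C) D (\<lambda>x. f (inv_into UNIV h x))"
proof -
  interpret dg_algebra_hom C D f using assms by (simp add: dg_quasi_iso_elementwise_def)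
  note simps = dg_copy_simps[OF assms(2), of C]
  have hom: "dg_algebra_hom (dg_copy h C) D (\<lambda>x. f (inv_into UNIV h x))"
    by (intro dg_algebra_hom.intro dg_algebra_hom_axioms.intro D.dg_algebra_axioms
        dg_algebra_copy[OF C.dg_algebra_axioms assms(2)] ring_hom_memI)
      (use assms(2) in \<open>auto simp: simps hom_closed hom_add hom_mult hom_one hom_smult hom_grade hom_differential\<close>)
  note cc = dg_copy_cocycles[OF C.dg_algebra_axioms assms(2)]
  show ?thesis
    unfolding dg_quasi_iso_elementwise_def cc
    using assms hom unfolding dg_quasi_iso_elementwise_def by auto
qed

lemma dg_quasi_iso_elementwise_id:
  assumes "dg_algebra C" shows "dg_quasi_iso_elementwise C C (\<lambda>x. x)"
proof -
  interpret dg_algebra C by fact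
  have "dg_algebra_hom C C (\<lambda>x. x)"
    by (intro dg_algebra_hom.intro dg_algebra_hom_axioms.intro assms ring_hom_memI) auto
  moreover have "\<exists>x\<in>cocycles C n. \<exists>w\<in>coboundaries C n. y = w \<oplus>\<^bsub>C\<^esub> x" if "y \<in> cocycles C n" for n y
    using that zero_coboundary[of n] cocycle_closed by (intro bexI[of _ y] bexI[of _ "\<zero>\<^bsub>C\<^esub>"]) auto
  ultimately show ?thesis by (auto simp: dg_quasi_iso_elementwise_def)
qed

text \<open>The zigzag consists of the copies of \<open>C\<close> and \<open>D\<close> in the sum type, joined by the
  transported \<open>g\<close>.\<close>

lemma dg_quasi_isomorphicI:
  assumes "dg_quasi_iso_elementwise D C g"
  shows "dg_quasi_isomorphic C D"
proof -
  have alg: "dg_algebra C" "dg_algebra D"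
    using assms by (auto simp: dg_quasi_iso_elementwise_def dg_algebra_hom_def)
  have inj: "inj Inl" "inj Inr" by auto
  have "dg_quasi_iso C (dg_copy Inl C) Inl"
    using dg_quasi_iso_elementwise_copy_target[OF dg_quasi_iso_elementwise_id[OF alg(1)] inj(1)]
    by (rule dg_quasi_isoI)
  moreover have "dg_quasi_iso (dg_copy Inr D) (dg_copy Inl C) (\<lambda>x. Inl (g (inv_into UNIV Inr x)))"
    by (intro dg_quasi_isoI dg_quasi_iso_elementwise_copy_source[of D _ "\<lambda>x. Inl (g x)"]
        dg_quasi_iso_elementwise_copy_target assms inj)
  then have "symclp (\<lambda>X Y. \<exists>g. dg_quasi_iso X Y g) (dg_copy Inl C) (dg_copy Inr D)"
    unfolding symclp_def by blast
  then have "(symclp (\<lambda>X Y. \<exists>g. dg_quasi_iso X Y g))\<^sup>*\<^sup>* (dg_copy Inl C) (dg_copy Inr D)"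
    by (rule r_into_rtranclp)
  moreover have "dg_quasi_iso (dg_copy Inr D) D (inv_into UNIV Inr)"
    using dg_quasi_iso_elementwise_copy_source[OF dg_quasi_iso_elementwise_id[OF alg(2)] inj(2)]
    by (rule dg_quasi_isoI)
  ultimately show ?thesis unfolding dg_quasi_isomorphic_def by blast
qed

section \<open>Graded spaces with a homogeneous basis\<close>

lemma pm_extend_diff: "pm_extend \<phi> (f - g) = pm_extend \<phi> f - pm_extend \<phi> (g :: 'b \<Rightarrow>\<^sub>0 'k::field)"
proof -
  have "pm_extend \<phi> f = pm_extend \<phi> (f - g) + pm_extend \<phi> g" by (simp flip: pm_extend_add)
  then show ?thesis by simp
qed

lemma pm_scale_diff: "pm_scale c (f - g) = pm_scale c f - pm_scale c g"
  by (rule poly_mapping_eqI) (simp add: lookup_minus algebra_simps)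

lemma pm_scale_minus_1: "pm_scale (- 1) f = - f"
  by (rule poly_mapping_eqI) (simp add: lookup_uminus)

lemma pm_extend_scale_fun: "pm_extend (\<lambda>b. pm_scale c (\<phi> b)) f = pm_scale c (pm_extend \<phi> f)"
  by (simp add: pm_extend_def pm_scale_sum pm_scale_scale mult.commute)

lemma pm_extend_diff_fun: "pm_extend (\<lambda>b. \<phi> b - \<psi> b) f = pm_extend \<phi> f - pm_extend \<psi> f"
  by (simp add: pm_extend_def pm_scale_diff sum_subtractf)

lemma pm_extend_sum_fun: "pm_extend (\<lambda>b. \<Sum>i\<in>N. \<phi> i b) f = (\<Sum>i\<in>N. pm_extend (\<phi> i) f)"
  by (induction N rule: infinite_finite_induct) (auto simp: pm_extend_add_fun)

lemma pm_extend_cong_span: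
  "f \<in> pm_span X \<Longrightarrow> (\<And>b. b \<in> X \<Longrightarrow> \<phi> b = \<psi> b) \<Longrightarrow> pm_extend \<phi> f = pm_extend \<psi> f"
  by (rule pm_extend_cong) (auto simp: pm_span_def)

lemma pm_extend_eq_zero: "f \<in> pm_span X \<Longrightarrow> (\<And>b. b \<in> X \<Longrightarrow> \<phi> b = 0) \<Longrightarrow> pm_extend \<phi> f = 0"
  using pm_extend_cong_span[of f X \<phi> "\<lambda>_. 0"] by simp

lemma pm_span_mono: "X \<subseteq> Y \<Longrightarrow> f \<in> pm_span X \<Longrightarrow> f \<in> pm_span Y"
  by (auto simp: pm_span_def)

lemma pm_span_diff: "f \<in> pm_span X \<Longrightarrow> g \<in> pm_span X \<Longrightarrow> f - g \<in> pm_span X"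
  using pm_span_add[of f X "- g"] pm_span_uminus[of g X] by simp

lemma pm_span_empty [simp]: "pm_span {} = {0}"
  by (auto simp: pm_span_def)

lemma pm_mult_scale_left: "pm_mult m (pm_scale c f) g = pm_scale c (pm_mult m f g)"
  by (simp add: pm_mult_def pm_extend_scale)

lemma pm_mult_scale_right: "pm_mult m f (pm_scale c g) = pm_scale c (pm_mult m f g)"
  by (simp add: pm_mult_def pm_extend_scale pm_extend_scale_fun)

locale pm_space =
  fixes R :: "('k::field, 'b \<Rightarrow>\<^sub>0 'k, 'm) module_scheme" (structure) and X :: "'b set"
  assumes carrier_R: "carrier R = pm_span X" and add_R: "add R = (+)" and zero_R: "zero R = 0"
    and smult_R: "smult R = pm_scale"
begin

lemma R_module: "Module.module scalars R"
proof (rule moduleI[OF cring_scalars])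
  show "abelian_group R"
  proof (rule abelian_groupI)
    fix x assume "x \<in> carrier R"
    then show "\<exists>y\<in>carrier R. y \<oplus> x = \<zero>"
      by (intro bexI[of _ "- x"]) (auto simp: carrier_R add_R zero_R pm_span_uminus)
  qed (auto simp: carrier_R add_R zero_R pm_span_add algebra_simps)
qed (auto simp: carrier_R add_R zero_R smult_R pm_span_scale pm_scale_add pm_scale_add_left pm_scale_scale)

sublocale R: Module.module scalars R by (rule R_module)

lemma finsum_R: "c \<in> N \<rightarrow> carrier R \<Longrightarrow> finsum R c N = sum c N"
  by (induction N rule: infinite_finite_induct) (auto simp: R.finsum_insert Pi_def add_R zero_R)

lemma a_inv_R: "x \<in> carrier R \<Longrightarrow> \<ominus> x = - x"
  by (intro R.minus_equality) (auto simp: carrier_R add_R zero_R pm_span_uminus)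

lemma submodule_span:
  assumes "Y \<subseteq> X" shows "submodule (pm_span Y) scalars R"
proof (rule R.submoduleI)
  fix x :: "'b \<Rightarrow>\<^sub>0 'k" assume x: "x \<in> pm_span Y"
  then have "\<ominus> x = - x"
    using pm_span_mono[OF assms] by (intro a_inv_R) (auto simp: carrier_R)
  then show "\<ominus> x \<in> pm_span Y" using x pm_span_uminus by metis
qed (use pm_span_mono[OF assms] in \<open>auto simp: carrier_R add_R zero_R smult_R pm_span_add pm_span_scale\<close>)

end

text \<open>The component of degree \<open>n\<close> of a vector is its restriction to the basis vectors of
  degree \<open>n\<close>, and no other choice of components has the right coefficients.\<close>

lemma dg_space_pm:
  fixes C :: "('k::field, 'b \<Rightarrow>\<^sub>0 'k, 'm) dg_scheme" and deg :: "'b \<Rightarrow> int"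
  assumes "pm_space C X"
    and grade: "\<And>n. grade C n = pm_span {b \<in> X. deg b = n}"
    and diff: "differential C = pm_extend D"
    and D: "\<And>b. b \<in> X \<Longrightarrow> D b \<in> pm_span {b' \<in> X. deg b' = deg b + 1}"
    and DD: "\<And>b. b \<in> X \<Longrightarrow> pm_extend D (D b) = 0"
  shows "dg_space C"
proof -
  interpret pm_space C X by fact
  have grade_sub: "pm_span {b \<in> X. deg b = n} \<subseteq> carrier C" for n
    using pm_span_mono[of "{b \<in> X. deg b = n}" X] by (auto simp: carrier_R)
  have outside: "Poly_Mapping.lookup y b = 0" if "y \<in> pm_span {b \<in> X. deg b = n}" "deg b \<noteq> n" for y b n
    using that by (auto simp: pm_span_def in_keys_iff)
  show ?thesis
  proof (rule dg_spaceI[OF R_module])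
    show "submodule (grade C n) scalars C" for n unfolding grade by (rule submodule_span) auto
    fix x assume x: "x \<in> carrier C"
    let ?c = "\<lambda>n. pm_extend (\<lambda>b. if deg b = n then basis_vec b else 0) x"
    have lookup: "Poly_Mapping.lookup (?c n) b = (if deg b = n then Poly_Mapping.lookup x b else 0)" for n b
    proof -
      have "Poly_Mapping.lookup (?c n) b =
          (\<Sum>b'\<in>Poly_Mapping.keys x. if b' = b then (if deg b = n then Poly_Mapping.lookup x b else 0) else 0)"
        unfolding pm_extend_def lookup_sum by (rule sum.cong) (auto simp: lookup_single when_def)
      then show ?thesis by (simp add: in_keys_iff)
    qed
    have c: "?c n \<in> pm_span {b \<in> X. deg b = n}" for n
      using x unfolding pm_span_def carrier_R by (auto simp: in_keys_iff lookup split: if_splits)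
    let ?N = "deg ` Poly_Mapping.keys x"
    have cc: "?c \<in> ?N \<rightarrow> carrier C" using c grade_sub by blast
    have "hom_decomp C x ?c"
    proof (rule hom_decomp_finsum[of _ ?N])
      show "x = finsum C ?c ?N"
        unfolding finsum_R[OF cc]
        by (rule poly_mapping_eqI) (auto simp: lookup_sum lookup in_keys_iff)
      show "?c n = \<zero>\<^bsub>C\<^esub>" if "n \<notin> ?N" for n
        unfolding zero_R using that by (intro poly_mapping_eqI) (auto simp: lookup in_keys_iff)
    qed (use c grade_sub R.abelian_group_axioms in \<open>auto simp: grade\<close>)
    then show "\<exists>c. hom_decomp C x c" by blast
    have coeff: "Poly_Mapping.lookup (c n) b = (if deg b = n then Poly_Mapping.lookup x b else 0)"
      if c: "hom_decomp C x c" for c n b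
    proof -
      let ?S = "{n. c n \<noteq> \<zero>\<^bsub>C\<^esub>}"
      have g: "c m \<in> pm_span {b \<in> X. deg b = m}" for m using c by (auto simp: hom_decomp_def grade)
      then have "c \<in> ?S \<rightarrow> carrier C" using grade_sub by blast
      then have "x = sum c ?S" "finite ?S" using c finsum_R by (auto simp: hom_decomp_def)
      then have "Poly_Mapping.lookup x b = (\<Sum>m\<in>?S. Poly_Mapping.lookup (c m) b)"
        by (metis lookup_sum)
      also have "\<dots> = (\<Sum>m\<in>?S. if m = deg b then Poly_Mapping.lookup (c m) b else 0)"
        by (rule sum.cong) (use outside[OF g] in auto)
      also have "\<dots> = Poly_Mapping.lookup (c (deg b)) b"
        using \<open>finite ?S\<close> by (auto simp: zero_R)
      finally show ?thesis using outside[OF g] by auto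
    qed
    show "c = c'" if "hom_decomp C x c" "hom_decomp C x c'" for c c'
      by (intro ext poly_mapping_eqI) (simp add: coeff that)
    show "differential C x \<in> carrier C"
      unfolding diff carrier_R
      by (rule pm_span_extend[of x X]) (use x D pm_span_mono[of "{b' \<in> X. deg b' = _}" X] in \<open>auto simp: carrier_R\<close>)
    show "differential C (differential C x) = \<zero>\<^bsub>C\<^esub>"
      using x unfolding diff zero_R carrier_R pm_extend_comp by (rule pm_extend_eq_zero) (rule DD)
  next
    fix n x assume "x \<in> grade C n"
    then show "differential C x \<in> grade C (n + 1)"
      unfolding diff grade by (rule pm_span_extend) (use D in auto)
  qed (auto simp: diff add_R smult_R pm_extend_add pm_extend_scale)
qed

section \<open>The projective Leavitt complex as a dg space\<close>

type_synonym ('v, 'e, 'k) plc_vector = "('v, 'e) plc_index \<Rightarrow>\<^sub>0 'k"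
type_synonym ('v, 'e, 'k) word_vector = "('v, 'e) leavitt_gen list \<Rightarrow>\<^sub>0 'k"

text \<open>The type argument \<open>K\<close> fixes the ground field throughout the locale.\<close>

locale associated_quiver = fin_digraph Q for Q :: "('v, 'e) pre_digraph" +
  fixes a :: "'v \<Rightarrow> 'e" and K :: "'k::field itself"
  assumes choice: "associated_choice Q a"
begin

lemma fin: "fin_digraph Q" by (rule fin_digraph_axioms)

abbreviation "path_target i l \<equiv> path_end Q (i, l)"
abbreviation "assoc \<equiv> associated_arrows Q a"

lemma path_Nil_iff [simp]: "(i, []) \<in> paths Q \<longleftrightarrow> i \<in> verts Q"
  by (auto simp: paths_def awalk_def)

lemma path_Cons_iff [simp]:
  "(i, \<alpha> # l) \<in> paths Q \<longleftrightarrow> \<alpha> \<in> arcs Q \<and> i = tail Q \<alpha> \<and> (head Q \<alpha>, l) \<in> paths Q"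
  by (auto simp: paths_def awalk_def)

lemma path_target_simps [simp]:
  "path_target i [] = i" "path_target i (\<alpha> # l) = path_target (head Q \<alpha>) l"
  "path_target i (l @ [\<alpha>]) = head Q \<alpha>"
  by (auto simp: path_end_def)

lemma path_snoc_iff [simp]:
  "(i, l @ [\<alpha>]) \<in> paths Q \<longleftrightarrow> (i, l) \<in> paths Q \<and> \<alpha> \<in> arcs Q \<and> tail Q \<alpha> = path_target i l"
  by (induction l arbitrary: i) auto

lemma path_start_in_verts: "(i, l) \<in> paths Q \<Longrightarrow> i \<in> verts Q"
  by (cases l) auto

lemma path_target_in_verts: "(i, l) \<in> paths Q \<Longrightarrow> path_target i l \<in> verts Q"
  by (rule path_end_in_verts[OF fin])

lemma associated_arrow_iff: "\<alpha> \<in> arcs Q \<Longrightarrow> \<alpha> \<in> assoc \<longleftrightarrow> \<alpha> = a (head Q \<alpha>)"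
  using choice by (force simp: associated_arrows_def associated_choice_def)

lemma assoc_arcs: "\<alpha> \<in> assoc \<Longrightarrow> \<alpha> \<in> arcs Q"
  using choice by (auto simp: associated_arrows_def associated_choice_def)

text \<open>Associated pairs in terms of arrow lists with a common start \<open>i\<close>. Since trivial paths are
  empty lists, the three kinds of associated pairs become one condition.\<close>

definition admissible :: "'v \<Rightarrow> 'e list \<Rightarrow> 'e list \<Rightarrow> bool" where
  "admissible i l r \<longleftrightarrow> (i, l) \<in> paths Q \<and> (i, r) \<in> paths Q \<and>
     (l = [] \<or> r = [] \<or> hd l \<noteq> hd r \<or> hd l \<notin> assoc)"

lemma associated_pairs_iff:
  "((i, l), (j, r)) \<in> associated_pairs Q a \<longleftrightarrow> i = j \<and> admissible i l r"
  by (auto simp: associated_pairs_def admissible_def path_start_def Suc_le_eq path_start_in_verts)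

definition plc_basis :: "('v, 'e) plc_index set" where
  "plc_basis = {(u, pq). pq \<in> associated_pairs Q a \<and> u \<in> proj_basis Q (path_end Q (fst pq))}"

definition plc_degree :: "('v, 'e) plc_index \<Rightarrow> int" where
  "plc_degree = (\<lambda>(u, (p, q)). int (path_length q) - int (path_length p))"

abbreviation plc_span :: "('v, 'e, 'k) plc_vector set" where
  "plc_span \<equiv> pm_span plc_basis"

abbreviation plc_graded :: "int \<Rightarrow> ('v, 'e, 'k) plc_vector set" where
  "plc_graded n \<equiv> pm_span {b \<in> plc_basis. plc_degree b = n}"

lemma plc_basis_iff:
  "(u, ((i, l), (j, r))) \<in> plc_basis \<longleftrightarrow>
     i = j \<and> admissible i l r \<and> u \<in> proj_basis Q (path_target i l)"
  by (auto simp: plc_basis_def associated_pairs_iff)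

lemma plc_basisE:
  assumes "b \<in> plc_basis"
  obtains u i l r where "b = (u, ((i, l), (i, r)))" "admissible i l r" "u \<in> proj_basis Q (path_target i l)"
  using assms by (cases b) (auto simp: plc_basis_iff)

lemma plc_grade_eq: "plc_grade Q a n = plc_graded n"
proof -
  have "(\<Union>i\<in>verts Q. proj_basis Q i \<times> Lambda Q a n i) = {b \<in> plc_basis. plc_degree b = n}"
    using path_target_in_verts
    by (auto simp: Lambda_def plc_basis_iff plc_degree_def associated_pairs_iff admissible_def)
  then show ?thesis by (simp add: plc_grade_def)
qed

lemma plc_carrier_eq: "plc_carrier Q a = plc_span"
proof -
  have "(\<Union>n. \<Union>i\<in>verts Q. proj_basis Q i \<times> Lambda Q a n i) = plc_basis"
    using path_target_in_verts
    by (auto simp: Lambda_def plc_basis_iff associated_pairs_iff admissible_def)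
  then show ?thesis by (simp add: plc_carrier_def)
qed

definition differential_basis :: "('v, 'e) plc_index \<Rightarrow> ('v, 'e, 'k) plc_vector" where
  "differential_basis = (\<lambda>(u, (p, q)).
     if path_length u \<ge> 1 then 0
     else if path_length p \<ge> 1 then zeta (arrow_path Q (last (snd p))) (path_hat p, q)
     else (\<Sum>\<beta>\<in>{\<beta> \<in> arcs Q. head Q \<beta> = path_start p}.
             zeta (arrow_path Q \<beta>) (trivial_path (tail Q \<beta>), path_comp q (arrow_path Q \<beta>))))"

lemma plc_differential_eq: "plc_differential Q = pm_extend differential_basis"
  by (simp add: plc_differential_def differential_basis_def)

lemma differential_basis_simps [simp]:
  "differential_basis ((t, [\<gamma>]), pq) = 0"
  "l \<noteq> [] \<Longrightarrow> differential_basis ((t, []), ((i, l), q)) = zeta (tail Q (last l), [last l]) ((i, butlast l), q)"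
  "differential_basis ((t, []), ((i, []), (j, r))) =
     (\<Sum>\<beta>\<in>{\<beta> \<in> arcs Q. head Q \<beta> = i}. zeta (tail Q \<beta>, [\<beta>]) ((tail Q \<beta>, []), (tail Q \<beta>, \<beta> # r)))"
  by (auto simp: differential_basis_def path_hat_def arrow_path_def path_start_def path_comp_def Suc_le_eq split: prod.split)

lemma proj_basis_iff:
  "u \<in> proj_basis Q i \<longleftrightarrow> u = (i, []) \<or> (\<exists>\<gamma>\<in>arcs Q. tail Q \<gamma> = i \<and> u = (i, [\<gamma>]))"
  by (auto simp: proj_basis_def arrow_path_def)

lemma admissible_butlast: "admissible i (l @ [\<beta>]) r \<Longrightarrow> admissible i l r"
  by (cases l) (auto simp: admissible_def)

lemma admissible_Nil: "admissible i [] r \<longleftrightarrow> (i, r) \<in> paths Q" "admissible i l [] \<longleftrightarrow> (i, l) \<in> paths Q"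
  by (auto simp: admissible_def path_start_in_verts)

lemma differential_basis_degree:
  assumes "b \<in> plc_basis"
  shows "differential_basis b \<in> plc_graded (plc_degree b + 1)"
proof -
  obtain u i l r where b: "b = (u, ((i, l), (i, r)))" "admissible i l r" "u \<in> proj_basis Q (path_target i l)"
    using assms by (rule plc_basisE)
  consider "\<exists>t \<gamma>. u = (t, [\<gamma>])" | "u = (path_target i l, [])" using b(3) by (auto simp: proj_basis_iff)
  then show ?thesis
  proof cases
    case 1
    then show ?thesis using b by auto
  next
    case 2
    show ?thesis
    proof (cases l rule: rev_cases)
      case Nil
      then show ?thesis using b(2)
        by (auto simp: b(1) 2 plc_basis_iff plc_degree_def proj_basis_iff admissible_Nil
            intro!: pm_span_sum pm_span_single)
    next
      case (snoc l' \<beta>)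
      then show ?thesis using b(2) admissible_butlast[of i l' \<beta> r]
        by (auto simp: b(1) 2 plc_basis_iff plc_degree_def proj_basis_iff admissible_def
            intro!: pm_span_sum pm_span_single)
    qed
  qed
qed

lemma differential_basis_square:
  assumes "b \<in> plc_basis"
  shows "pm_extend differential_basis (differential_basis b) = 0"
proof -
  obtain t v i l r where b: "b = ((t, v), ((i, l), (i, r)))" by (metis assms plc_basisE surj_pair)
  show ?thesis
    by (cases v; cases l rule: rev_cases) (simp_all add: b pm_extend_sum, simp_all add: differential_basis_def)
qed

abbreviation P :: "('k, ('v, 'e) qpath \<Rightarrow>\<^sub>0 'k, ('v, 'e, 'k) word_vector set,
    ('v, 'e) plc_index \<Rightarrow>\<^sub>0 'k) dg_bimod" where
  "P \<equiv> projective_leavitt_complex Q a"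

lemma P_simps:
  "carrier P = plc_span" "zero P = 0" "add P = (+)" "smult P = pm_scale"
  "grade P = (\<lambda>n. plc_graded n)"
  "differential P = pm_extend differential_basis" "lact P = plc_lact Q" "ract P = plc_ract Q a"
  by (simp_all add: projective_leavitt_complex_def plc_carrier_eq plc_grade_eq plc_differential_eq fun_eq_iff)

sublocale P: pm_space P plc_basis by unfold_locales (simp_all add: P_simps)

lemma P_dg_space: "dg_space P"
  by (rule dg_space_pm[OF P.pm_space_axioms, of plc_degree differential_basis])
    (simp_all add: P_simps differential_basis_degree differential_basis_square)

definition alg_basis :: "('v, 'e) qpath set" where "alg_basis = {p \<in> paths Q. path_length p \<le> 1}"

lemma alg_basisE:
  assumes "v \<in> alg_basis"
  obtains i where "i \<in> verts Q" "v = (i, [])" | \<gamma> where "\<gamma> \<in> arcs Q" "v = (tail Q \<gamma>, [\<gamma>])"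
  using assms by (cases v; cases "snd v") (auto simp: alg_basis_def)

definition alg_mult :: "('v, 'e) qpath \<Rightarrow> ('v, 'e) qpath \<Rightarrow> (('v, 'e) qpath \<Rightarrow>\<^sub>0 'k)" where
  "alg_mult p q = (if path_start p = path_end Q q \<and> path_length (path_comp p q) \<le> 1
                   then basis_vec (path_comp p q) else 0)"

lemma alg_mult_eq: "alg_mult = (\<lambda>p q. if path_start p = path_end Q q \<and> path_length (path_comp p q) \<le> 1
    then basis_vec (path_comp p q) else 0)"
  by (intro ext) (simp add: alg_mult_def)

abbreviation A :: "('k, ('v, 'e) qpath \<Rightarrow>\<^sub>0 'k) dg" where
  "A \<equiv> dg_concentrated (rad_square_zero_algebra Q)"

lemma A_simps:
  "carrier A = pm_span alg_basis" "zero A = 0" "add A = (+)" "smult A = pm_scale"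
  "mult A = pm_mult alg_mult" "one A = (\<Sum>i\<in>verts Q. basis_vec (i, []))"
  "grade A = (\<lambda>n. pm_span {b \<in> alg_basis. 0 = n})" "differential A = (\<lambda>_. 0)"
  by (simp_all add: dg_concentrated_def module.defs dg.defs rad_square_zero_algebra_def alg_basis_def
      alg_mult_eq) (rule ext, auto)

sublocale A: pm_space A alg_basis by unfold_locales (simp_all add: A_simps)

text \<open>Elements of nonzero degree vanish, so all gradedness conditions reduce to degree zero.\<close>

lemma A_dg_algebra: "dg_algebra A"
proof -
  have diff: "differential A = pm_extend (\<lambda>_. 0)" by (simp add: A_simps fun_eq_iff)
  have space: "dg_space A"
    by (rule dg_space_pm[OF A.pm_space_axioms, of "\<lambda>_. 0", OF _ diff]) (simp_all add: A_simps)
  interpret R: ring "rad_square_zero_algebra Q :: ('k, ('v, 'e) qpath \<Rightarrow>\<^sub>0 'k) module" by (rule ring_rad_square_zero_algebra[OF fin])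
  have eq: "carrier A = carrier (rad_square_zero_algebra Q)" "mult A = mult (rad_square_zero_algebra Q)"
    "one A = one (rad_square_zero_algebra Q)" "add A = add (rad_square_zero_algebra Q)"
    by (simp_all add: dg_concentrated_def module.defs dg.defs)
  have ring: "ring A"
  proof (rule ringI[OF A.R.abelian_group_axioms])
    show "Group.monoid A" by (rule monoidI) (auto simp: eq R.m_assoc)
  qed (auto simp: eq R.l_distr R.r_distr)
  interpret dg_space A by (rule space)
  have zero: "x = 0" if "x \<in> grade A n" "n \<noteq> 0" for x n using that by (auto simp: A_simps)
  have mult_zero: "pm_mult m 0 x = 0" "pm_mult m x 0 = 0" for m and x :: "'x \<Rightarrow>\<^sub>0 'z::field"
    by (auto simp: pm_mult_def)
  have "dg_algebra_axioms A"
  proof (unfold_locales)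
    show "\<one>\<^bsub>A\<^esub> \<in> grade A 0"
      using R.one_closed by (simp add: A_simps eq[symmetric] flip: eq)
    fix x y m n assume x: "x \<in> grade A m" and y: "y \<in> grade A n"
    show "x \<otimes>\<^bsub>A\<^esub> y \<in> grade A (m + n)"
    proof (cases "m = 0 \<and> n = 0")
      case True
      have "grade A 0 = carrier A" by (simp add: A_simps)
      then show ?thesis using True x y R.m_closed[of x y] by (simp add: eq)
    next
      case False
      then have "x \<otimes>\<^bsub>A\<^esub> y = 0" using zero[OF x] zero[OF y] by (auto simp: A_simps(5) mult_zero)
      then show ?thesis using grade_zero[of "m + n"] by (simp add: A_simps(2))
    qed
  qed (auto simp: A_simps pm_mult_scale_left pm_mult_scale_right mult_zero)
  then show ?thesis using space ring by (simp add: dg_algebra_def)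
qed

end

section \<open>Left multiplication, differential and Leavitt generators on basis vectors\<close>

context associated_quiver
begin

definition left_basis :: "('v, 'e) qpath \<Rightarrow> ('v, 'e) plc_index \<Rightarrow> ('v, 'e, 'k) plc_vector" where
  "left_basis v = (\<lambda>(u, pq). if path_start v = path_end Q u \<and> path_length (path_comp v u) \<le> 1
     then zeta (path_comp v u) pq else 0)"

lemma left_basis_simps [simp]:
  "left_basis (j, []) ((t, []), pq) = (if j = t then zeta (t, []) pq else 0)"
  "left_basis (j, []) ((t, [\<gamma>]), pq) = (if j = head Q \<gamma> then zeta (t, [\<gamma>]) pq else 0)"
  "left_basis (s, [\<beta>]) ((t, []), pq) = (if s = t then zeta (t, [\<beta>]) pq else 0)"
  "left_basis (s, [\<beta>]) ((t, [\<gamma>]), pq) = 0"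
  by (simp_all add: left_basis_def path_start_def path_comp_def)

lemma plc_lact_eq: "plc_lact Q x z = pm_extend (\<lambda>b. pm_extend (\<lambda>v. left_basis v b) x) z"
proof -
  have "x \<otimes>\<^bsub>rad_square_zero_algebra Q\<^esub> basis_vec u = pm_extend (\<lambda>v. alg_mult v u) x"
    for x :: "('v, 'e) qpath \<Rightarrow>\<^sub>0 'k" and u
    by (simp add: rad_square_zero_algebra_def pm_mult_def alg_mult_def)
  moreover have "pm_extend (\<lambda>w. zeta w pq) (alg_mult v u) = left_basis v (u, pq)" for v u pq
    by (simp add: alg_mult_def left_basis_def)
  ultimately show ?thesis
    by (auto simp: plc_lact_def pm_extend_comp intro!: arg_cong[of _ _ "\<lambda>f. pm_extend f z"])
qed

lemma plc_lact_eq': "plc_lact Q x z = pm_extend (\<lambda>v. pm_extend (left_basis v) z) x"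
  unfolding plc_lact_eq by (subst pm_extend_swap) simp

lemma left_basis_degree:
  assumes "v \<in> alg_basis" "b \<in> plc_basis"
  shows "left_basis v b \<in> plc_graded (plc_degree b)"
proof -
  obtain u i l r where b: "b = (u, ((i, l), (i, r)))" "admissible i l r" "u \<in> proj_basis Q (path_target i l)"
    using assms(2) by (rule plc_basisE)
  show ?thesis
    using assms(1) b(3)
    by (cases v rule: alg_basisE; unfold proj_basis_iff; elim disjE bexE conjE)
      (use b(2) in \<open>auto simp: b(1) plc_basis_iff plc_degree_def proj_basis_iff intro!: pm_span_single\<close>)
qed

lemma left_basis_mult:
  assumes "v \<in> alg_basis" "w \<in> alg_basis" "b \<in> plc_basis"
  shows "pm_extend (\<lambda>v'. left_basis v' b) (alg_mult v w) = pm_extend (left_basis v) (left_basis w b)"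
proof -
  obtain u i l r where b: "b = (u, ((i, l), (i, r)))" "admissible i l r" "u \<in> proj_basis Q (path_target i l)"
    using assms(3) by (rule plc_basisE)
  show ?thesis
    by (insert b(3); rule alg_basisE[OF assms(1)]; rule alg_basisE[OF assms(2)]; unfold proj_basis_iff; elim disjE bexE conjE)
      (auto simp: b(1) alg_mult_def path_start_def path_comp_def)
qed

lemma left_basis_one:
  assumes "b \<in> plc_basis"
  shows "(\<Sum>i\<in>verts Q. left_basis (i, []) b) = basis_vec b"
proof -
  obtain u i l r where b: "b = (u, ((i, l), (i, r)))" "admissible i l r" "u \<in> proj_basis Q (path_target i l)"
    using assms by (rule plc_basisE)
  have "path_target i l \<in> verts Q" using b(2) path_target_in_verts by (auto simp: admissible_def)
  then show ?thesis
    using b(3) unfolding proj_basis_iff by (elim disjE bexE conjE) (auto simp: b(1))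
qed

lemma left_basis_differential:
  assumes "v \<in> alg_basis" "b \<in> plc_basis"
  shows "pm_extend differential_basis (left_basis v b) = pm_extend (left_basis v) (differential_basis b)"
proof -
  obtain u i l r where b: "b = (u, ((i, l), (i, r)))" "admissible i l r" "u \<in> proj_basis Q (path_target i l)"
    using assms(2) by (rule plc_basisE)
  have *: "l \<noteq> [] \<Longrightarrow> path_target i l = head Q (last l)" by (auto simp: path_end_def)
  show ?thesis
    using assms(1) b(3)
    by (cases v rule: alg_basisE; cases "l = []"; unfold proj_basis_iff; elim disjE bexE conjE)
      (auto simp: b(1) * pm_extend_sum intro!: sum.neutral sum.cong)
qed

abbreviation gens :: "('v, 'e) leavitt_gen set" where "gens \<equiv> leavitt_gens (opposite_quiver Q)"

lemma gensE:
  assumes "g \<in> gens"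
  obtains j where "g = Vertex j" "j \<in> verts Q" | \<alpha> where "g = Arrow \<alpha>" "\<alpha> \<in> arcs Q"
    | \<alpha> where "g = Ghost \<alpha>" "\<alpha> \<in> arcs Q"
  using assms by (auto simp: leavitt_gens_def opposite_quiver_def)

lemma gens_iff [simp]:
  "Vertex j \<in> gens \<longleftrightarrow> j \<in> verts Q" "Arrow \<alpha> \<in> gens \<longleftrightarrow> \<alpha> \<in> arcs Q" "Ghost \<alpha> \<in> gens \<longleftrightarrow> \<alpha> \<in> arcs Q"
  by (auto simp: leavitt_gens_def opposite_quiver_def)

definition gen_basis :: "('v, 'e) leavitt_gen \<Rightarrow> ('v, 'e) plc_index \<Rightarrow> ('v, 'e, 'k) plc_vector" where
  "gen_basis = plc_gen_basis Q a"

lemma gen_basis_simps [simp]: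
  "gen_basis (Vertex j) (u, ((i, l), (i', r))) =
     (if j = path_target i' r then zeta u ((i, l), (i', r)) else 0)"
  "gen_basis (Arrow \<alpha>) (u, ((i, l), (i', r))) =
     (if r = [] \<and> l \<noteq> [] \<and> hd l = \<alpha> \<and> \<alpha> \<in> assoc
      then zeta u ((head Q \<alpha>, tl l), (head Q \<alpha>, [])) -
        (\<Sum>\<beta>\<in>{\<beta> \<in> arcs Q. head Q \<beta> = head Q \<alpha> \<and> \<beta> \<noteq> \<alpha>}.
           zeta u ((tail Q \<beta>, \<beta> # tl l), (tail Q \<beta>, [\<beta>])))
      else if tail Q \<alpha> = path_target i' r then zeta u ((i, l), (i', r @ [\<alpha>])) else 0)"
  "gen_basis (Ghost \<alpha>) (u, ((i, l), (i', []))) =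
     (if i = head Q \<alpha> then zeta u ((tail Q \<alpha>, \<alpha> # l), (tail Q \<alpha>, [])) else 0)"
  "r \<noteq> [] \<Longrightarrow> gen_basis (Ghost \<alpha>) (u, ((i, l), (i', r))) =
     (if last r = \<alpha> then zeta u ((i, l), (i', butlast r)) else 0)"
  by (auto simp: gen_basis_def path_tilde_def path_comp_def arrow_path_def path_hat_def path_start_def Suc_le_eq)

lemma admissible_snoc:
  assumes "admissible i l r" "\<alpha> \<in> arcs Q" "tail Q \<alpha> = path_target i r"
    "\<not> (r = [] \<and> l \<noteq> [] \<and> hd l = \<alpha> \<and> \<alpha> \<in> assoc)"
  shows "admissible i l (r @ [\<alpha>])"
  using assms by (auto simp: admissible_def hd_append)

lemma admissible_butlast_right: "admissible i l r \<Longrightarrow> r \<noteq> [] \<Longrightarrow> admissible i l (butlast r)"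
  by (cases r rule: rev_cases; cases "butlast r") (auto simp: admissible_def path_start_in_verts)

lemma assoc_unique: "\<alpha> \<in> assoc \<Longrightarrow> \<beta> \<in> arcs Q \<Longrightarrow> head Q \<beta> = head Q \<alpha> \<Longrightarrow> \<beta> \<noteq> \<alpha> \<Longrightarrow> \<beta> \<notin> assoc"
  using assoc_arcs associated_arrow_iff by metis

text \<open>The correction terms in the action of an associated arrow are indexed by admissible pairs
  because only one arrow with a given target is associated.\<close>

lemma gen_basis_degree:
  assumes "g \<in> gens" "b \<in> plc_basis"
  shows "gen_basis g b \<in> plc_graded (plc_degree b + gen_degree g)"
proof -
  obtain u i l r where b: "b = (u, ((i, l), (i, r)))" and ad: "admissible i l r"
    and u: "u \<in> proj_basis Q (path_target i l)"
    using assms(2) by (rule plc_basisE)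
  from assms(1) show ?thesis
  proof (cases rule: gensE)
    case (1 j)
    then show ?thesis using ad u by (auto simp: b plc_basis_iff plc_degree_def intro!: pm_span_single)
  next
    case (2 \<alpha>)
    show ?thesis
    proof (cases "r = [] \<and> l \<noteq> [] \<and> hd l = \<alpha> \<and> \<alpha> \<in> assoc")
      case True
      then obtain l' where "l = \<alpha> # l'" by (cases l) auto
      then show ?thesis using True ad u 2 assoc_unique[of \<alpha>]
        by (auto simp: b plc_basis_iff plc_degree_def admissible_def path_start_in_verts
            intro!: pm_span_single pm_span_diff pm_span_sum)
    next
      case False
      then show ?thesis using ad u 2 admissible_snoc[OF ad 2(2) _ False]
        by (auto simp: b plc_basis_iff plc_degree_def intro!: pm_span_single)
    qed
  next
    case (3 \<alpha>)
    show ?thesis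
    proof (cases "r = []")
      case True
      then show ?thesis using ad u 3
        by (auto simp: b plc_basis_iff plc_degree_def admissible_Nil intro!: pm_span_single)
    next
      case False
      then show ?thesis using ad u 3 admissible_butlast_right[OF ad]
        by (auto simp: b plc_basis_iff plc_degree_def intro!: pm_span_single) (cases r; auto)
    qed
  qed
qed

lemma gen_basis_left:
  assumes "v \<in> alg_basis" "b \<in> plc_basis"
  shows "pm_extend (gen_basis g) (left_basis v b) = pm_extend (left_basis v) (gen_basis g b)"
proof -
  obtain u i l r where b: "b = (u, ((i, l), (i, r)))"
    using assms(2) by (rule plc_basisE)
  have *: "left_basis v (u, pq) = (if path_start v = path_end Q u \<and> path_length (path_comp v u) \<le> 1
     then zeta (path_comp v u) pq else 0)" for pq by (simp add: left_basis_def)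
  show ?thesis
    by (cases g; cases "r = []") (auto simp: b * pm_extend_diff pm_extend_sum)
qed

text \<open>Both operations act at opposite ends of the paths unless these are very short. The delicate
  case is \<open>\<zeta>\<close> at \<open>(\<alpha>, e)\<close> with \<open>\<alpha>\<close> associated, acted upon by \<open>\<alpha>\<close>: the
  differential of \<open>\<zeta>\<close> at \<open>(e, e)\<close> is a sum over all arrows with the target of \<open>\<alpha>\<close>,
  the correction terms remove all of them but \<open>\<alpha>\<close>, and the remaining term is what
  \<open>\<alpha>\<close> makes of the differential of the given vector.\<close>

lemma gen_basis_differential:
  assumes b: "b \<in> plc_basis" and "g \<in> gens"
  shows "pm_extend differential_basis (gen_basis g b) = pm_extend (gen_basis g) (differential_basis b)"
proof -
  obtain u i l r where b: "b = (u, ((i, l), (i, r)))" and ad: "admissible i l r"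
    and u: "u \<in> proj_basis Q (path_target i l)"
    using assms(1) by (rule plc_basisE)
  consider t \<gamma> where "u = (t, [\<gamma>])" | "u = (path_target i l, [])" using u by (auto simp: proj_basis_iff)
  then show ?thesis
  proof cases
    case 1
    then show ?thesis by (cases g; cases "r = []") (auto simp: b pm_extend_diff pm_extend_sum)
  next
    case 2
    from assms(2) show ?thesis
    proof (cases rule: gensE)
      case (1 j)
      then show ?thesis by (cases "l = []") (auto simp: b 2 pm_extend_sum intro!: sum.cong sum.neutral)
    next
      case (2 \<alpha>)
      show ?thesis
      proof (cases "r = [] \<and> l \<noteq> [] \<and> hd l = \<alpha> \<and> \<alpha> \<in> assoc")
        case True
        then obtain l' where l: "l = \<alpha> # l'" by (cases l) auto
        let ?S = "{\<beta> \<in> arcs Q. head Q \<beta> = head Q \<alpha>}"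
        have S: "{\<beta> \<in> arcs Q. head Q \<beta> = head Q \<alpha> \<and> \<beta> \<noteq> \<alpha>} = ?S - {\<alpha>}" "finite ?S" "\<alpha> \<in> ?S"
          using 2 by auto
        show ?thesis
        proof (cases "l' = []")
          case True
          then show ?thesis using \<open>r = [] \<and> _\<close> l 2 ad
            by (auto simp: b \<open>u = _\<close> pm_extend_diff pm_extend_sum S(1) sum.remove[OF S(2,3)] admissible_def)
        next
          case False
          then show ?thesis using True l 2 ad
            by (auto simp: b \<open>u = _\<close> pm_extend_diff pm_extend_sum)
        qed
      next
        case False
        then show ?thesis
          using 2 by (cases "l = []"; cases l rule: rev_cases)
            (auto simp: b \<open>u = _\<close> pm_extend_sum hd_append intro!: sum.cong sum.neutral split: if_splits)
      qed
    next
      case (3 \<alpha>)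
      then show ?thesis
        by (cases "l = []"; cases "r = []") (auto simp: b \<open>u = _\<close> pm_extend_sum)
    qed
  qed
qed

end

section \<open>The right action of the Leavitt path algebra\<close>

context associated_quiver
begin

abbreviation F :: "('k, ('v, 'e) leavitt_gen list \<Rightarrow>\<^sub>0 'k) module" where
  "F \<equiv> free_algebra gens"

abbreviation I :: "('v, 'e, 'k) word_vector set" where
  "I \<equiv> leavitt_ideal (opposite_quiver Q)"

abbreviation F_graded :: "int \<Rightarrow> ('v, 'e, 'k) word_vector set" where
  "F_graded n \<equiv> pm_span {w \<in> lists gens. word_degree w = n}"

lemma F_simps:
  "carrier F = pm_span (lists gens)" "mult F = pm_mult (\<lambda>u v. basis_vec (u @ v))"
  "one F = basis_vec []" "zero F = 0" "add F = (+)" "smult F = pm_scale"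
  by (simp_all add: free_algebra_def)

sublocale F: pm_space F "lists gens" by unfold_locales (simp_all add: F_simps)

lemma F_ring: "ring F"
  by (rule ring_pm_mult[of "lists gens" "\<lambda>u v. basis_vec (u @ v)" "basis_vec []"])
    (auto simp: F_simps intro!: pm_span_single)

sublocale F: ring F by (rule F_ring)

lemma F_minus: "f \<in> carrier F \<Longrightarrow> g \<in> carrier F \<Longrightarrow> f \<ominus>\<^bsub>F\<^esub> g = f - g"
  by (simp add: a_minus_def F.a_inv_R) (simp add: F_simps)

definition word_act :: "('v, 'e) leavitt_gen list \<Rightarrow> ('v, 'e, 'k) plc_vector \<Rightarrow> ('v, 'e, 'k) plc_vector" where
  "word_act w z = foldl (plc_gen_act Q a) z w"

abbreviation act :: "('v, 'e, 'k) plc_vector \<Rightarrow> ('v, 'e, 'k) word_vector \<Rightarrow> ('v, 'e, 'k) plc_vector" where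
  "act \<equiv> plc_free_act Q a"

lemma act_eq: "act z f = pm_extend (\<lambda>w. word_act w z) f"
  by (simp add: plc_free_act_def word_act_def)

lemma word_act_simps [simp]:
  "word_act [] z = z" "word_act (g # w) z = word_act w (pm_extend (gen_basis g) z)"
  by (simp_all add: word_act_def plc_gen_act_def gen_basis_def)

lemma word_act_append: "word_act (v @ w) z = word_act w (word_act v z)"
  by (simp add: word_act_def)

lemma word_act_linear: "word_act w z = pm_extend (\<lambda>b. word_act w (basis_vec b)) z"
proof (induction w arbitrary: z)
  case (Cons g w)
  show ?case
    by (simp add: Cons[of "pm_extend _ _"] Cons[of "gen_basis _ _"] pm_extend_comp)
qed (simp add: pm_extend_basis)

lemma act_linear: "act z f = pm_extend (\<lambda>b. act (basis_vec b) f) z"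
  unfolding act_eq by (subst word_act_linear) (rule pm_extend_swap)

lemma act_extend: "act (pm_extend \<phi> x) f = pm_extend (\<lambda>b. act (\<phi> b) f) x"
  unfolding act_linear[of "pm_extend \<phi> x"] act_linear[of "\<phi> _"] pm_extend_comp ..

lemma act_add: "act (x + y) f = act x f + act y f" "act z (f + g) = act z f + act z g"
  by (simp_all add: act_linear[of "x + y"] act_linear[of x] act_linear[of y] pm_extend_add)
    (simp add: act_eq pm_extend_add)

lemma act_scale: "act (pm_scale c z) f = pm_scale c (act z f)" "act z (pm_scale c f) = pm_scale c (act z f)"
  by (simp add: act_linear[of "pm_scale c z"] act_linear[of z f] pm_extend_scale)
    (simp add: act_eq pm_extend_scale)

lemma act_diff: "act z (f - g) = act z f - act z g"
  by (simp add: act_eq pm_extend_diff)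

lemma act_sum: "act z (sum f N) = (\<Sum>i\<in>N. act z (f i))"
  by (simp add: act_eq pm_extend_sum)

lemma act_word [simp]: "act z (basis_vec w) = word_act w z"
  by (simp add: act_eq)

lemma act_zero [simp]: "act z 0 = 0" "act 0 f = 0"
  by (simp add: act_eq) (subst act_linear, simp)

lemma act_mult: "act z (f \<otimes>\<^bsub>F\<^esub> g) = act (act z f) g"
  by (simp add: F_simps pm_mult_def act_eq[of z] pm_extend_comp word_act_append act_extend)
    (simp add: act_eq)

lemma word_act_degree:
  assumes "w \<in> lists gens" "z \<in> plc_graded n"
  shows "word_act w z \<in> plc_graded (n + word_degree w)"
  using assms
proof (induction w arbitrary: z n rule: list.induct)
  case (Cons g w)
  have "pm_extend (gen_basis g) z \<in> plc_graded (n + gen_degree g)"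
    using Cons(3) by (rule pm_span_extend) (use gen_basis_degree[of g] Cons(2) in auto)
  from Cons(1)[OF _ this] Cons(2) show ?case by (simp add: word_degree_def add.assoc)
qed (simp add: word_degree_def)

lemma act_degree:
  assumes "f \<in> F_graded m" "z \<in> plc_graded n"
  shows "act z f \<in> plc_graded (n + m)"
  unfolding act_eq using assms(1) by (rule pm_span_extend) (use word_act_degree assms(2) in auto)

lemma act_closed:
  assumes "f \<in> carrier F" "z \<in> plc_span"
  shows "act z f \<in> plc_span"
proof -
  have *: "word_act w z \<in> plc_span" if "w \<in> lists gens" for w
    using that assms(2)
  proof (induction w arbitrary: z rule: list.induct)
    case (Cons g w)
    have "pm_extend (gen_basis g) z \<in> plc_span"
      using Cons(3)
    proof (rule pm_span_extend)
      fix b assume "b \<in> plc_basis"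
      then show "gen_basis g b \<in> plc_span"
        using pm_span_mono[OF _ gen_basis_degree[of g b], of plc_basis] Cons(2) by auto
    qed
    then show ?case using Cons by simp
  qed simp
  show ?thesis unfolding act_eq using assms(1) * unfolding F_simps by (rule pm_span_extend)
qed

lemma opposite_simps:
  "verts (opposite_quiver Q) = verts Q" "arcs (opposite_quiver Q) = arcs Q"
  "tail (opposite_quiver Q) = head Q" "head (opposite_quiver Q) = tail Q"
  by (simp_all add: opposite_quiver_def)

lemma relations_closed: "leavitt_relations (opposite_quiver Q) \<subseteq> carrier F"
  unfolding leavitt_relations_def F_simps
  by (auto simp: opposite_simps intro!: pm_span_diff pm_span_sum pm_span_single)

text \<open>When \<open>q\<close> is trivial, the ghost arrows prolong \<open>p\<close> at its start in all possible ways.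
  The non-associated arrows then yield pairs \<open>(p\<beta>, \<beta>)\<close>, and the associated one
  yields the original vector minus exactly these. This relation is the reason for the
  correction terms.\<close>

lemma cuntz_krieger_action:
  assumes "b \<in> plc_basis"
  shows "(\<Sum>\<alpha>\<in>{\<alpha> \<in> arcs Q. head Q \<alpha> = j}. pm_extend (gen_basis (Arrow \<alpha>)) (gen_basis (Ghost \<alpha>) b)) =
    gen_basis (Vertex j) b"
proof -
  obtain u i l r where b: "b = (u, ((i, l), (i, r)))" and ad: "admissible i l r"
    using assms by (rule plc_basisE)
  let ?S = "{\<alpha> \<in> arcs Q. head Q \<alpha> = j}"
  show ?thesis
  proof (cases r rule: rev_cases)
    case Nil
    show ?thesis
    proof (cases "i = j")
      case True
      have j: "j \<in> verts Q" using ad True path_start_in_verts by (auto simp: admissible_def)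
      then have aj: "a j \<in> ?S" "a j \<in> assoc" 
        using choice by (auto simp: associated_choice_def associated_arrows_def)
      have S: "?S - {a j} = {\<beta> \<in> arcs Q. head Q \<beta> = j \<and> \<beta> \<noteq> a j}" by auto
      have "\<beta> \<notin> assoc" if "\<beta> \<in> ?S - {a j}" for \<beta> using that assoc_unique[of "a j" \<beta>] aj by auto
      then have "(\<Sum>\<alpha>\<in>?S - {a j}. pm_extend (gen_basis (Arrow \<alpha>)) (gen_basis (Ghost \<alpha>) b)) =
          (\<Sum>\<beta>\<in>?S - {a j}. zeta u ((tail Q \<beta>, \<beta> # l), (tail Q \<beta>, [\<beta>])))"
        by (intro sum.cong) (auto simp: b Nil True)
      then show ?thesis
        using aj by (subst sum.remove[of _ "a j"]) (auto simp: b Nil True S)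
    qed (auto simp: b Nil intro!: sum.neutral)
  next
    case (snoc r' \<gamma>)
    have n: "\<not> (r' = [] \<and> l \<noteq> [] \<and> hd l = \<gamma> \<and> \<gamma> \<in> assoc)" "\<gamma> \<in> arcs Q" "tail Q \<gamma> = path_target i r'"
      using ad by (auto simp: admissible_def snoc)
    have "(\<Sum>\<alpha>\<in>?S. pm_extend (gen_basis (Arrow \<alpha>)) (gen_basis (Ghost \<alpha>) b)) =
        (\<Sum>\<alpha>\<in>?S. if \<gamma> = \<alpha> then gen_basis (Vertex j) b else 0)"
      by (rule sum.cong) (use n in \<open>auto simp: b snoc\<close>)
    then show ?thesis using n(2) by (auto simp: b snoc)
  qed
qed

lemma relations_act_zero:
  assumes "f \<in> leavitt_relations (opposite_quiver Q)" and "b \<in> plc_basis"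
  shows "act (basis_vec b) f = 0"
proof -
  obtain u i l r where b: "b = (u, ((i, l), (i, r)))" and ad: "admissible i l r"
    using assms(2) by (rule plc_basisE)
  have target: "path_target i r \<in> verts Q" using ad path_target_in_verts by (auto simp: admissible_def)
  have r: "r \<noteq> [] \<Longrightarrow> path_target i r = head Q (last r)" by (auto simp: path_end_def)
  have r': "r \<noteq> [] \<Longrightarrow> path_target i (butlast r) = tail Q (last r)"
    using ad by (cases r rule: rev_cases) (auto simp: admissible_def)
  have l: "l \<noteq> [] \<Longrightarrow> i = tail Q (hd l)" using ad by (cases l) (auto simp: admissible_def)
  from assms(1) consider
      "f = (\<Sum>i\<in>verts Q. basis_vec [Vertex i]) - basis_vec []"
    | i j where "f = basis_vec [Vertex i, Vertex j] - (if i = j then basis_vec [Vertex i] else 0)"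
    | \<alpha> where "f = basis_vec [Vertex (tail Q \<alpha>), Arrow \<alpha>] - basis_vec [Arrow \<alpha>]" "\<alpha> \<in> arcs Q"
    | \<alpha> where "f = basis_vec [Arrow \<alpha>, Vertex (head Q \<alpha>)] - basis_vec [Arrow \<alpha>]" "\<alpha> \<in> arcs Q"
    | \<alpha> where "f = basis_vec [Vertex (head Q \<alpha>), Ghost \<alpha>] - basis_vec [Ghost \<alpha>]" "\<alpha> \<in> arcs Q"
    | \<alpha> where "f = basis_vec [Ghost \<alpha>, Vertex (tail Q \<alpha>)] - basis_vec [Ghost \<alpha>]" "\<alpha> \<in> arcs Q"
    | \<alpha> \<beta> where "f = basis_vec [Arrow \<alpha>, Ghost \<beta>] - (if \<alpha> = \<beta> then basis_vec [Vertex (tail Q \<alpha>)] else 0)"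
        "\<alpha> \<in> arcs Q" "\<beta> \<in> arcs Q"
    | j where "f = (\<Sum>\<alpha>\<in>{\<alpha> \<in> arcs Q. head Q \<alpha> = j}. basis_vec [Ghost \<alpha>, Arrow \<alpha>]) - basis_vec [Vertex j]"
    unfolding leavitt_relations_def opposite_simps by blast
  then show ?thesis
  proof cases
    case 1
    then show ?thesis using target by (simp add: act_diff act_sum b)
  next
    case 2
    then show ?thesis by (auto simp: act_diff b)
  next
    case (3 \<alpha>)
    then show ?thesis using l by (auto simp: act_diff b)
  next
    case (4 \<alpha>)
    then show ?thesis by (auto simp: act_diff b pm_extend_diff pm_extend_sum intro!: sum.cong)
  next
    case (5 \<alpha>)
    then show ?thesis using r by (cases "r = []") (auto simp: act_diff b)
  next
    case (6 \<alpha>)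
    then show ?thesis using r' by (cases "r = []") (auto simp: act_diff b)
  next
    case (7 \<alpha> \<beta>)
    show ?thesis
    proof (cases "r = [] \<and> l \<noteq> [] \<and> hd l = \<alpha> \<and> \<alpha> \<in> assoc")
      case True
      then obtain l' where l': "l = \<alpha> # l'" by (cases l) auto
      show ?thesis
        using True l 7 by (auto simp: act_diff b l' pm_extend_diff pm_extend_sum)
    next
      case False
      then show ?thesis using 7 by (auto simp: act_diff b)
    qed
  next
    case (8 j)
    then show ?thesis using cuntz_krieger_action[OF assms(2)] by (simp add: act_diff act_sum)
  qed
qed

lemma ideal_I: "ideal I F"
  unfolding leavitt_ideal_def by (rule F.genideal_ideal[OF relations_closed])

sublocale I: ideal I F by (rule ideal_I)

lemma I_closed: "f \<in> I \<Longrightarrow> f \<in> carrier F"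
  using I.a_subset by blast

text \<open>The elements that annihilate the whole complex form an ideal, so it suffices to look at the
  generating relations.\<close>

lemma ideal_acts_zero:
  assumes "f \<in> I" "z \<in> plc_span"
  shows "act z f = 0"
proof -
  let ?K = "{f \<in> carrier F. \<forall>z\<in>plc_span. act z f = 0}"
  have "ideal ?K F"
  proof (rule idealI[OF F_ring])
    show "subgroup ?K (add_monoid F)"
    proof (rule group.subgroupI)
      show "Group.group (add_monoid F)" by (rule F.R.a_group)
      fix f assume f: "f \<in> ?K"
      then have "inv\<^bsub>add_monoid F\<^esub> f = - f"
        using F.a_inv_R[of f] by (simp add: a_inv_def)
      then show "inv\<^bsub>add_monoid F\<^esub> f \<in> ?K"
        using f act_diff[of _ 0 f] by (simp add: F_simps pm_span_uminus)
    qed (auto simp: F_simps act_add pm_span_add intro!: exI[of _ 0])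
  qed (auto simp: act_mult act_closed)
  moreover have "act z f = 0" if "f \<in> leavitt_relations (opposite_quiver Q)" "z \<in> plc_span" for z f
    by (subst act_linear) (use that relations_act_zero in \<open>auto intro: pm_extend_eq_zero\<close>)
  then have "leavitt_relations (opposite_quiver Q) \<subseteq> ?K"
    using relations_closed by blast
  ultimately have "I \<subseteq> ?K"
    unfolding leavitt_ideal_def by (rule F.genideal_minimal)
  then show ?thesis using assms by blast
qed

end

section \<open>Normal forms\<close>

context associated_quiver
begin

lemma I_add: "f \<in> I \<Longrightarrow> g \<in> I \<Longrightarrow> f + g \<in> I"
  using I.a_closed[of f g] by (simp add: F_simps)

lemma I_zero: "0 \<in> I"
  using I.zero_closed by (simp add: F_simps)

lemma I_scale: assumes "f \<in> I" shows "pm_scale c f \<in> I"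
proof -
  have "pm_scale c f = Poly_Mapping.single [] c \<otimes>\<^bsub>F\<^esub> f"
    by (simp add: F_simps pm_mult_def pm_extend_basis)
  then show ?thesis using I.I_l_closed[OF assms, of "Poly_Mapping.single [] c"]
    by (simp add: F_simps pm_span_single)
qed

lemma I_minus: "f \<in> I \<Longrightarrow> - f \<in> I"
  using I_scale[of f "- 1"] by (simp add: pm_scale_minus_1)

lemma I_sum: "(\<And>i. i \<in> N \<Longrightarrow> f i \<in> I) \<Longrightarrow> sum f N \<in> I"
  by (induction N rule: infinite_finite_induct) (auto intro: I_add I_zero)

lemma I_extend: "x \<in> pm_span X \<Longrightarrow> (\<And>b. b \<in> X \<Longrightarrow> \<phi> b \<in> I) \<Longrightarrow> pm_extend \<phi> x \<in> I"
  unfolding pm_extend_def pm_span_def by (auto intro!: I_sum I_scale)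

definition cong_I (infix "\<approx>" 50) where
  "f \<approx> g \<longleftrightarrow> f - g \<in> I"

lemma cong_refl [simp]: "f \<approx> f"
  by (simp add: cong_I_def I_zero)

lemma cong_sym: "f \<approx> g \<Longrightarrow> g \<approx> f"
  using I_minus[of "f - g"] by (simp add: cong_I_def)

lemma cong_trans [trans]: "f \<approx> g \<Longrightarrow> g \<approx> h \<Longrightarrow> f \<approx> h"
  using I_add[of "f - g" "g - h"] by (simp add: cong_I_def)

lemma cong_diff: "f \<approx> g \<Longrightarrow> f' \<approx> g' \<Longrightarrow> f - f' \<approx> g - g'"
  using I_add[of "f - g" "- (f' - g')"] I_minus[of "f' - g'"] by (simp add: cong_I_def algebra_simps)

lemma cong_mult_right:
  assumes "f \<approx> g" "f \<in> carrier F" "g \<in> carrier F" "h \<in> carrier F"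
  shows "f \<otimes>\<^bsub>F\<^esub> h \<approx> g \<otimes>\<^bsub>F\<^esub> h"
proof -
  have "(f - g) \<otimes>\<^bsub>F\<^esub> h \<in> I" using assms I.I_r_closed unfolding cong_I_def by blast
  moreover have "(f - g) \<otimes>\<^bsub>F\<^esub> h = f \<otimes>\<^bsub>F\<^esub> h - g \<otimes>\<^bsub>F\<^esub> h"
    by (simp add: F_simps pm_mult_def pm_extend_diff)
  ultimately show ?thesis by (simp add: cong_I_def)
qed

lemma cong_mult_left:
  assumes "f \<approx> g" "h \<in> carrier F"
  shows "h \<otimes>\<^bsub>F\<^esub> f \<approx> h \<otimes>\<^bsub>F\<^esub> g"
proof -
  have "h \<otimes>\<^bsub>F\<^esub> (f - g) \<in> I" using assms I.I_l_closed unfolding cong_I_def by blast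
  moreover have "h \<otimes>\<^bsub>F\<^esub> (f - g) = h \<otimes>\<^bsub>F\<^esub> f - h \<otimes>\<^bsub>F\<^esub> g"
    by (simp add: F_simps pm_mult_def pm_extend_diff pm_extend_diff_fun)
  ultimately show ?thesis by (simp add: cong_I_def)
qed

abbreviation W :: "('v, 'e) leavitt_gen list \<Rightarrow> ('v, 'e, 'k) word_vector" where
  "W \<equiv> basis_vec"

lemma W_closed: "w \<in> lists gens \<Longrightarrow> W w \<in> carrier F"
  by (simp add: F_simps pm_span_single)

lemma W_mult: "W u \<otimes>\<^bsub>F\<^esub> W v = W (u @ v)"
  by (simp add: F_simps pm_mult_single)

lemma relation_cong:
  "f - g \<in> leavitt_relations (opposite_quiver Q) \<Longrightarrow> f \<approx> g"
  unfolding cong_I_def leavitt_ideal_def using F.genideal_self[OF relations_closed] by blast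

lemma leavitt_cong:
  "(\<Sum>i\<in>verts Q. W [Vertex i]) \<approx> W []"
  "i \<in> verts Q \<Longrightarrow> j \<in> verts Q \<Longrightarrow> W [Vertex i, Vertex j] \<approx> (if i = j then W [Vertex i] else 0)"
  "\<alpha> \<in> arcs Q \<Longrightarrow> W [Vertex (tail Q \<alpha>), Arrow \<alpha>] \<approx> W [Arrow \<alpha>]"
  "\<alpha> \<in> arcs Q \<Longrightarrow> W [Arrow \<alpha>, Vertex (head Q \<alpha>)] \<approx> W [Arrow \<alpha>]"
  "\<alpha> \<in> arcs Q \<Longrightarrow> W [Vertex (head Q \<alpha>), Ghost \<alpha>] \<approx> W [Ghost \<alpha>]"
  "\<alpha> \<in> arcs Q \<Longrightarrow> W [Ghost \<alpha>, Vertex (tail Q \<alpha>)] \<approx> W [Ghost \<alpha>]"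
  "\<alpha> \<in> arcs Q \<Longrightarrow> \<beta> \<in> arcs Q \<Longrightarrow>
     W [Arrow \<alpha>, Ghost \<beta>] \<approx> (if \<alpha> = \<beta> then W [Vertex (tail Q \<alpha>)] else 0)"
  "\<alpha> \<in> arcs Q \<Longrightarrow>
     (\<Sum>\<beta>\<in>{\<beta> \<in> arcs Q. head Q \<beta> = head Q \<alpha>}. W [Ghost \<beta>, Arrow \<beta>]) \<approx> W [Vertex (head Q \<alpha>)]"
         apply (rule relation_cong, unfold leavitt_relations_def opposite_simps, blast)
        apply (rule relation_cong, unfold leavitt_relations_def opposite_simps, blast)
       apply (rule relation_cong, unfold leavitt_relations_def opposite_simps, blast)
      apply (rule relation_cong, unfold leavitt_relations_def opposite_simps, blast)
     apply (rule relation_cong, unfold leavitt_relations_def opposite_simps, blast)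
    apply (rule relation_cong, unfold leavitt_relations_def opposite_simps, blast)
   apply (rule relation_cong, unfold leavitt_relations_def opposite_simps, blast)
  apply (rule relation_cong, unfold leavitt_relations_def opposite_simps,
    rule UnI2, rule CollectI, rule exI[of _ "head Q \<alpha>"], auto)
  done

lemma word_cong_left:
  assumes "W v \<approx> W v'" "u \<in> lists gens"
  shows "W (u @ v) \<approx> W (u @ v')"
  using cong_mult_left[OF assms(1) W_closed[OF assms(2)]] by (simp add: W_mult)

lemma word_cong_left_if:
  assumes "W v \<approx> (if c then W v' else 0)" "u \<in> lists gens"
  shows "W (u @ v) \<approx> (if c then W (u @ v') else 0)"
  using cong_mult_left[OF assms(1) W_closed[OF assms(2)]] by (simp add: W_mult F_simps pm_mult_def split: if_splits)

lemma word_cong_right: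
  assumes "W v \<approx> (if c then W v' else 0)" "u \<in> lists gens" "v \<in> lists gens" "v' \<in> lists gens"
  shows "W (v @ u) \<approx> (if c then W (v' @ u) else 0)"
proof -
  have "(if c then W v' else 0) \<in> carrier F" using W_closed[OF assms(4)] by (simp add: F_simps)
  from cong_mult_right[OF assms(1) W_closed[OF assms(3)] this W_closed[OF assms(2)]]
  show ?thesis by (simp add: W_mult F_simps pm_mult_def split: if_splits)
qed

text \<open>The vertex at which a word ends decides which generators may follow it. Expressing this by
  absorption of an idempotent avoids distinguishing the possible last letters.\<close>

definition ends_at :: "('v, 'e) leavitt_gen list \<Rightarrow> 'v \<Rightarrow> bool" where
  "ends_at w j \<longleftrightarrow> w \<in> lists gens \<and> j \<in> verts Q \<and> W (w @ [Vertex j]) \<approx> W w"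

lemma ends_at_Vertex:
  assumes w: "ends_at w j" and j': "j' \<in> verts Q"
  shows "W (w @ [Vertex j']) \<approx> (if j = j' then W w else 0)"
proof -
  have "W (w @ [Vertex j']) \<approx> W ((w @ [Vertex j]) @ [Vertex j'])"
    using word_cong_right[of w True "w @ [Vertex j]" "[Vertex j']"] cong_sym w j' by (simp add: ends_at_def)
  also have "\<dots> \<approx> (if j = j' then W (w @ [Vertex j]) else 0)"
    using word_cong_left_if[OF leavitt_cong(2), of j j' w] w j' by (simp add: ends_at_def)
  also have "\<dots> \<approx> (if j = j' then W w else 0)"
    using w by (auto simp: ends_at_def)
  finally show ?thesis .
qed

lemma ends_at_Arrow:
  assumes w: "ends_at w j" and "\<alpha> \<in> arcs Q" "tail Q \<alpha> \<noteq> j"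
  shows "W (w @ [Arrow \<alpha>]) \<approx> 0"
proof -
  have "W (w @ [Arrow \<alpha>]) \<approx> W (w @ [Vertex (tail Q \<alpha>), Arrow \<alpha>])"
    using assms by (intro word_cong_left cong_sym[OF leavitt_cong(3)]) (auto simp: ends_at_def)
  also have "\<dots> \<approx> 0"
    using word_cong_right[OF ends_at_Vertex[OF w], of "tail Q \<alpha>" "[Arrow \<alpha>]"] assms
    by (simp add: ends_at_def)
  finally show ?thesis .
qed

lemma ends_at_Ghost:
  assumes w: "ends_at w j" and "\<alpha> \<in> arcs Q" "head Q \<alpha> \<noteq> j"
  shows "W (w @ [Ghost \<alpha>]) \<approx> 0"
proof -
  have "W (w @ [Ghost \<alpha>]) \<approx> W (w @ [Vertex (head Q \<alpha>), Ghost \<alpha>])"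
    using assms by (intro word_cong_left cong_sym[OF leavitt_cong(5)]) (auto simp: ends_at_def)
  also have "\<dots> \<approx> 0"
    using word_cong_right[OF ends_at_Vertex[OF w], of "head Q \<alpha>" "[Ghost \<alpha>]"] assms
    by (simp add: ends_at_def)
  finally show ?thesis .
qed

text \<open>The word for \<open>p\<^sup>*q\<close>, which corresponds to \<open>\<zeta>\<close> at \<open>(p, q)\<close>. The leading
  vertex represents the idempotent when both paths are trivial.\<close>

definition normal_word :: "'v \<Rightarrow> 'e list \<Rightarrow> 'e list \<Rightarrow> ('v, 'e) leavitt_gen list" where
  "normal_word i l r = [Vertex (path_target i l)] @ map Ghost (rev l) @ map Arrow r"

lemma path_arcs: "(i, l) \<in> paths Q \<Longrightarrow> \<alpha> \<in> set l \<Longrightarrow> \<alpha> \<in> arcs Q"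
  by (induction l arbitrary: i) auto

lemma normal_word_gens: "admissible i l r \<Longrightarrow> normal_word i l r \<in> lists gens"
  using path_target_in_verts[of i l] path_arcs[of i l] path_arcs[of i r]
  by (fastforce simp: normal_word_def admissible_def)

lemma normal_word_ends_at:
  assumes ad: "admissible i l r"
  shows "ends_at (normal_word i l r) (path_target i r)"
proof -
  have gens: "normal_word i l r \<in> lists gens" using ad by (rule normal_word_gens)
  have target: "path_target i r \<in> verts Q" using ad path_target_in_verts by (auto simp: admissible_def)
  have "W (normal_word i l r @ [Vertex (path_target i r)]) \<approx> W (normal_word i l r)"
  proof (cases r rule: rev_cases)
    case (snoc r' \<gamma>)
    then show ?thesis
      using word_cong_left[OF leavitt_cong(4), of \<gamma> "[Vertex (path_target i l)] @ map Ghost (rev l) @ map Arrow r'"] gens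
      by (simp add: normal_word_def)
  next
    case Nil
    show ?thesis
    proof (cases l)
      case (Cons \<alpha> l')
      then show ?thesis
        using word_cong_left[OF leavitt_cong(6), of \<alpha> "[Vertex (path_target i l)] @ map Ghost (rev l')"] gens ad
        by (simp add: normal_word_def Nil admissible_def)
    qed (use leavitt_cong(2)[of i i] target in \<open>simp add: normal_word_def Nil\<close>)
  qed
  then show ?thesis using gens target by (simp add: ends_at_def)
qed

definition normal_form_basis :: "('v, 'e) plc_index \<Rightarrow> ('v, 'e, 'k) word_vector" where
  "normal_form_basis = (\<lambda>(u, (p, q)).
     if snd u = [] then W (normal_word (path_start p) (snd p) (snd q)) else 0)"

abbreviation normal_form :: "('v, 'e, 'k) plc_vector \<Rightarrow> ('v, 'e, 'k) word_vector" where
  "normal_form \<equiv> pm_extend normal_form_basis"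

lemma normal_form_basis_simp [simp]:
  "normal_form_basis ((t, v), ((i, l), (j, r))) = (if v = [] then W (normal_word i l r) else 0)"
  by (simp add: normal_form_basis_def path_start_def)

lemma normal_form_basis_degree:
  assumes "b \<in> plc_basis"
  shows "normal_form_basis b \<in> F_graded (plc_degree b)"
proof -
  obtain t v i l r where b: "b = ((t, v), ((i, l), (i, r)))" "admissible i l r"
    using assms by (metis plc_basisE surj_pair)
  have "sum_list (map gen_degree (map Ghost xs :: ('v, 'e) leavitt_gen list)) = - int (length xs)"
    "sum_list (map gen_degree (map Arrow xs :: ('v, 'e) leavitt_gen list)) = int (length xs)" for xs :: "'e list"
    by (induction xs) auto
  then have "word_degree (normal_word i l r) = int (length r) - int (length l)"
    by (simp add: word_degree_def normal_word_def del: map_map)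
  then show ?thesis using normal_word_gens[OF b(2)] by (auto simp: b(1) plc_degree_def intro: pm_span_single)
qed

lemma normal_form_degree:
  "z \<in> plc_graded n \<Longrightarrow> normal_form z \<in> F_graded n"
  by (erule pm_span_extend) (use normal_form_basis_degree in auto)

lemma normal_form_closed: assumes "z \<in> plc_span" shows "normal_form z \<in> carrier F"
  unfolding F_simps using assms
proof (rule pm_span_extend)
  show "normal_form_basis b \<in> pm_span (lists gens)" if "b \<in> plc_basis" for b
    using pm_span_mono[OF _ normal_form_basis_degree[OF that], of "lists gens"] by auto
qed

text \<open>Modulo the relations, right multiplication of normal words by a generator follows the
  formulas for the action on the complex. Appending a letter gives a normal word, or cancels the
  last letter, or gives zero because the vertices do not match. The exception is the subword
  \<open>\<alpha>\<^sup>*\<alpha>\<close> with \<open>\<alpha>\<close> associated, which is rewritten by the relation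
  \<open>\<Sum> \<beta>\<^sup>*\<beta> = e\<close>.\<close>

lemma normal_form_gen:
  assumes "b \<in> plc_basis" "g \<in> gens"
  shows "normal_form (gen_basis g b) \<approx> normal_form_basis b \<otimes>\<^bsub>F\<^esub> W [g]"
proof -
  obtain u i l r where b: "b = (u, ((i, l), (i, r)))" and ad: "admissible i l r"
    and u: "u \<in> proj_basis Q (path_target i l)"
    using assms(1) by (rule plc_basisE)
  consider t \<gamma> where "u = (t, [\<gamma>])" | "u = (path_target i l, [])" using u by (auto simp: proj_basis_iff)
  then show ?thesis
  proof cases
    case 1
    then show ?thesis
      by (cases g; cases "r = []") (auto simp: b pm_extend_diff pm_extend_sum F_simps pm_mult_def)
  next
    case 2
    have rhs: "normal_form_basis b \<otimes>\<^bsub>F\<^esub> W [g] = W (normal_word i l r @ [g])"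
      by (simp add: b 2 W_mult)
    note ends = normal_word_ends_at[OF ad]
    from assms(2) show ?thesis unfolding rhs
    proof (cases rule: gensE)
      case (1 j)
      then show "normal_form (gen_basis g b) \<approx> W (normal_word i l r @ [g])"
        using cong_sym[OF ends_at_Vertex[OF ends, of j]] by (auto simp: b 2)
    next
      case (2 \<alpha>)
      show "normal_form (gen_basis g b) \<approx> W (normal_word i l r @ [g])"
      proof (cases "r = [] \<and> l \<noteq> [] \<and> hd l = \<alpha> \<and> \<alpha> \<in> assoc")
        case True
        then obtain l' where l: "l = \<alpha> # l'" by (cases l) auto
        let ?v = "normal_word (head Q \<alpha>) l' []"
        let ?T = "{\<beta> \<in> arcs Q. head Q \<beta> = head Q \<alpha> \<and> \<beta> \<noteq> \<alpha>}"
        let ?S = "{\<beta> \<in> arcs Q. head Q \<beta> = head Q \<alpha>}"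
        have ad': "admissible (head Q \<alpha>) l' []" using ad by (auto simp: l admissible_def path_start_in_verts)
        have S: "?S - {\<alpha>} = ?T" "finite ?S" "\<alpha> \<in> ?S" using 2 by auto
        have "W ?v \<otimes>\<^bsub>F\<^esub> (\<Sum>\<beta>\<in>?S. W [Ghost \<beta>, Arrow \<beta>]) \<approx> W ?v \<otimes>\<^bsub>F\<^esub> W [Vertex (head Q \<alpha>)]"
          by (rule cong_mult_left[OF leavitt_cong(8)[OF 2(2)] W_closed[OF normal_word_gens[OF ad']]])
        also have "\<dots> \<approx> W ?v"
          using normal_word_ends_at[OF ad'] by (simp add: W_mult ends_at_def)
        finally have "(\<Sum>\<beta>\<in>?S. W (?v @ [Ghost \<beta>, Arrow \<beta>])) \<approx> W ?v"
          by (simp add: F_simps pm_mult_def pm_extend_sum)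
        then have "W (?v @ [Ghost \<alpha>, Arrow \<alpha>]) + (\<Sum>\<beta>\<in>?T. W (?v @ [Ghost \<beta>, Arrow \<beta>])) \<approx> W ?v"
          by (simp add: sum.remove[OF S(2,3)] S(1))
        from cong_sym[OF cong_diff[OF this cong_refl[of "\<Sum>\<beta>\<in>?T. W (?v @ [Ghost \<beta>, Arrow \<beta>])"]]]
        have *: "W ?v - (\<Sum>\<beta>\<in>?T. W (?v @ [Ghost \<beta>, Arrow \<beta>])) \<approx> W (?v @ [Ghost \<alpha>, Arrow \<alpha>])"
          by simp
        have "normal_word (tail Q \<beta>) (\<beta> # l') [\<beta>] = ?v @ [Ghost \<beta>, Arrow \<beta>]" if "\<beta> \<in> ?T" for \<beta>
          using that by (simp add: normal_word_def)
        then have "normal_form (gen_basis g b) = W ?v - (\<Sum>\<beta>\<in>?T. W (?v @ [Ghost \<beta>, Arrow \<beta>]))"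
          using True by (simp add: b \<open>u = _\<close> 2 l pm_extend_diff pm_extend_sum)
        moreover have "normal_word i l r @ [g] = ?v @ [Ghost \<alpha>, Arrow \<alpha>]"
          using True by (simp add: normal_word_def l 2)
        ultimately show ?thesis using * by simp
      next
        case False
        show ?thesis
        proof (cases "tail Q \<alpha> = path_target i r")
          case True
          then show ?thesis using False by (auto simp: b \<open>u = _\<close> 2 normal_word_def)
        next
          case neq: False
          then show ?thesis using False cong_sym[OF ends_at_Arrow[OF ends 2(2) neq]] by (auto simp: b \<open>u = _\<close> 2)
        qed
      qed
    next
      case (3 \<alpha>)
      show "normal_form (gen_basis g b) \<approx> W (normal_word i l r @ [g])"
      proof (cases r rule: rev_cases)
        case Nil
        then show ?thesis using cong_sym[OF ends_at_Ghost[OF ends 3(2)]]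
          by (auto simp: b \<open>u = _\<close> 3 normal_word_def)
      next
        case (snoc r' \<gamma>)
        have ad': "admissible i l r'" using admissible_butlast_right[OF ad] snoc by simp
        have \<gamma>: "\<gamma> \<in> arcs Q" "tail Q \<gamma> = path_target i r'" using ad snoc by (auto simp: admissible_def)
        have "W (normal_word i l r' @ [Arrow \<gamma>, Ghost \<alpha>]) \<approx>
            (if \<gamma> = \<alpha> then W (normal_word i l r' @ [Vertex (tail Q \<gamma>)]) else 0)"
          by (rule word_cong_left_if[OF leavitt_cong(7)[OF \<gamma>(1) 3(2)] normal_word_gens[OF ad']])
        also have "\<dots> \<approx> (if \<gamma> = \<alpha> then W (normal_word i l r') else 0)"
          using normal_word_ends_at[OF ad'] \<gamma>(2) by (auto simp: ends_at_def)
        finally have *: "W (normal_word i l r' @ [Arrow \<gamma>, Ghost \<alpha>]) \<approx> (if \<gamma> = \<alpha> then W (normal_word i l r') else 0)" .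
        show ?thesis using cong_sym[OF *] by (auto simp: b \<open>u = _\<close> 3 snoc normal_word_def)
      qed
    qed
  qed
qed

lemma F_mult_extend_left: "pm_extend \<phi> x \<otimes>\<^bsub>F\<^esub> g = pm_extend (\<lambda>b. \<phi> b \<otimes>\<^bsub>F\<^esub> g) x"
  by (simp add: F_simps pm_mult_def pm_extend_comp)

lemma F_mult_extend_right: "f \<otimes>\<^bsub>F\<^esub> g = pm_extend (\<lambda>w. f \<otimes>\<^bsub>F\<^esub> W w) g"
  unfolding F_simps pm_mult_def by (subst pm_extend_swap) simp

lemma normal_form_word_act:
  assumes "w \<in> lists gens" "z \<in> plc_span"
  shows "normal_form (word_act w z) \<approx> normal_form z \<otimes>\<^bsub>F\<^esub> W w"
  using assms
proof (induction w arbitrary: z rule: list.induct)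
  case Nil
  then show ?case using F.r_one[OF normal_form_closed[of z]] by (simp add: F_simps(3))
next
  case (Cons g w)
  have g: "g \<in> gens" "w \<in> lists gens" using Cons(2) by auto
  let ?z = "pm_extend (gen_basis g) z"
  have z: "?z \<in> plc_span"
    using act_closed[OF W_closed[of "[g]"] Cons(3)] g(1) by simp
  have "normal_form ?z - normal_form z \<otimes>\<^bsub>F\<^esub> W [g] =
      pm_extend (\<lambda>b. normal_form (gen_basis g b) - normal_form_basis b \<otimes>\<^bsub>F\<^esub> W [g]) z"
    by (simp add: pm_extend_diff_fun F_mult_extend_left pm_extend_comp)
  also have "\<dots> \<in> I"
    using Cons(3) by (rule I_extend) (use normal_form_gen[OF _ g(1)] in \<open>simp add: cong_I_def\<close>)
  finally have *: "normal_form ?z \<approx> normal_form z \<otimes>\<^bsub>F\<^esub> W [g]" by (simp add: cong_I_def)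
  note closed = normal_form_closed[OF Cons(3)] W_closed[of "[g]"] W_closed[OF g(2)]
  have "normal_form (word_act (g # w) z) \<approx> normal_form ?z \<otimes>\<^bsub>F\<^esub> W w"
    using Cons(1)[OF g(2) z] by simp
  also have "\<dots> \<approx> (normal_form z \<otimes>\<^bsub>F\<^esub> W [g]) \<otimes>\<^bsub>F\<^esub> W w"
    by (rule cong_mult_right[OF * normal_form_closed[OF z]]) (use closed g in auto)
  also have "(normal_form z \<otimes>\<^bsub>F\<^esub> W [g]) \<otimes>\<^bsub>F\<^esub> W w = normal_form z \<otimes>\<^bsub>F\<^esub> W (g # w)"
    using closed g by (simp add: F.m_assoc W_mult)
  finally show ?case .
qed

text \<open>In particular, every element of the Leavitt path algebra is a combination of normal words:
  see \<open>normal_form_act_unit\<close>.\<close>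

lemma normal_form_act:
  assumes "f \<in> carrier F" "z \<in> plc_span"
  shows "normal_form (act z f) \<approx> normal_form z \<otimes>\<^bsub>F\<^esub> f"
proof -
  have "normal_form (act z f) - normal_form z \<otimes>\<^bsub>F\<^esub> f =
      pm_extend (\<lambda>w. normal_form (word_act w z) - normal_form z \<otimes>\<^bsub>F\<^esub> W w) f"
    unfolding F_mult_extend_right[of _ f] by (simp add: pm_extend_diff_fun act_eq pm_extend_comp)
  also have "\<dots> \<in> I"
    using assms(1) unfolding F_simps(1)
    by (rule I_extend) (use normal_form_word_act assms(2) in \<open>simp add: cong_I_def\<close>)
  finally show ?thesis by (simp add: cong_I_def)
qed

text \<open>The top of the complex is a free module of rank one over the Leavitt path algebra, and this
  is its generator.\<close>

definition unit_vec :: "('v, 'e, 'k) plc_vector" where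
  "unit_vec = (\<Sum>i\<in>verts Q. zeta (i, []) ((i, []), (i, [])))"

lemma unit_vec_degree: "unit_vec \<in> plc_graded 0"
  unfolding unit_vec_def
  by (rule pm_span_sum, rule pm_span_single)
    (auto simp: plc_basis_iff admissible_def proj_basis_iff plc_degree_def)

lemma unit_vec_closed: "unit_vec \<in> plc_span"
  using unit_vec_degree by (rule pm_span_mono[rotated]) auto

lemma normal_form_act_unit: assumes "f \<in> carrier F" shows "normal_form (act unit_vec f) \<approx> f"
proof -
  have n: "normal_form unit_vec = (\<Sum>i\<in>verts Q. W [Vertex i])"
    by (simp add: unit_vec_def pm_extend_sum normal_word_def)
  have "normal_form (act unit_vec f) \<approx> normal_form unit_vec \<otimes>\<^bsub>F\<^esub> f"
    by (rule normal_form_act[OF assms unit_vec_closed])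
  also have "\<dots> \<approx> W [] \<otimes>\<^bsub>F\<^esub> f"
    by (rule cong_mult_right[OF _ normal_form_closed[OF unit_vec_closed] W_closed assms])
      (use leavitt_cong(1) in \<open>auto simp: n\<close>)
  finally show ?thesis using F.l_one[OF assms] by (simp add: F_simps(3))
qed

text \<open>Since the normal form recovers \<open>f\<close> from \<open>act unit_vec f\<close>, the Leavitt path algebra acts
  faithfully. Linear independence of the normal words is thus obtained from the complex.\<close>

lemma act_unit_faithful:
  assumes "f \<in> carrier F" "act unit_vec f = 0" shows "f \<in> I"
  using normal_form_act_unit[OF assms(1)] assms(2) I_minus[of "- f"] by (simp add: cong_I_def)

definition top_part :: "('v, 'e, 'k) plc_vector \<Rightarrow> ('v, 'e, 'k) plc_vector" where
  "top_part = pm_extend (\<lambda>b. if snd (fst b) = [] then basis_vec b else 0)"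

lemma word_act_ghosts:
  "(i, l) \<in> paths Q \<Longrightarrow>
   word_act (map Ghost (rev l)) (zeta u ((path_target i l, []), (path_target i l, []))) = zeta u ((i, l), (i, []))"
  by (induction l arbitrary: i) (simp_all add: word_act_append)

lemma word_act_arrows:
  "admissible i l r \<Longrightarrow> word_act (map Arrow r) (zeta u ((i, l), (i, []))) = zeta u ((i, l), (i, r))"
proof (induction r rule: rev_induct)
  case (snoc \<alpha> r)
  have "admissible i l r" using admissible_butlast_right[OF snoc(2)] by simp
  moreover have "tail Q \<alpha> = path_target i r" "\<not> (r = [] \<and> l \<noteq> [] \<and> hd l = \<alpha> \<and> \<alpha> \<in> assoc)"
    using snoc(2) by (auto simp: admissible_def)
  ultimately show ?case using snoc(1) by (auto simp: word_act_append)
qed simp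

text \<open>Read as a word of operators, \<open>p\<^sup>*q\<close> builds up \<open>p\<close> from its end and then \<open>q\<close> from its
  start; admissibility excludes the exceptional case of the action at the first letter of
  \<open>q\<close>.\<close>

lemma act_unit_normal_form:
  assumes "z \<in> plc_span"
  shows "act unit_vec (normal_form z) = top_part z"
proof -
  have *: "act unit_vec (normal_form_basis b) = (if snd (fst b) = [] then basis_vec b else 0)"
    if b: "b \<in> plc_basis" for b
  proof -
    obtain u i l r where b: "b = (u, ((i, l), (i, r)))" and ad: "admissible i l r"
      and u: "u \<in> proj_basis Q (path_target i l)"
      using b by (rule plc_basisE)
    have p: "(i, l) \<in> paths Q" using ad by (simp add: admissible_def)
    have "word_act [Vertex j] unit_vec = zeta (j, []) ((j, []), (j, []))" if "j \<in> verts Q" for j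
      using that by (simp add: unit_vec_def pm_extend_sum sum.delta)
    then have "word_act (normal_word i l r) unit_vec = zeta (path_target i l, []) ((i, l), (i, r))"
      unfolding normal_word_def word_act_append
      by (simp add: path_target_in_verts[OF p] word_act_ghosts[OF p] word_act_arrows[OF ad] del: word_act_simps)
    then show ?thesis using u unfolding proj_basis_iff by (elim disjE bexE conjE) (auto simp: b)
  qed
  have "act unit_vec (normal_form z) = pm_extend (\<lambda>b. act unit_vec (normal_form_basis b)) z"
    by (simp add: act_eq pm_extend_comp)
  also have "\<dots> = top_part z"
    unfolding top_part_def by (rule pm_extend_cong_span[OF assms *])
  finally show ?thesis .
qed

end

section \<open>The dg bimodule\<close>

lemma hom_decomp_image:
  assumes "abelian_group C" "\<And>n. grade C n \<subseteq> carrier C" "abelian_group D" "\<And>n. grade D n \<subseteq> carrier D"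
    and closed: "\<And>x. x \<in> carrier C \<Longrightarrow> f x \<in> carrier D"
    and add: "\<And>x y. x \<in> carrier C \<Longrightarrow> y \<in> carrier C \<Longrightarrow> f (x \<oplus>\<^bsub>C\<^esub> y) = f x \<oplus>\<^bsub>D\<^esub> f y"
    and grade: "\<And>n x. x \<in> grade C n \<Longrightarrow> f x \<in> grade D n"
    and c: "hom_decomp C x c"
  shows "hom_decomp D (f x) (\<lambda>n. f (c n))"
proof -
  interpret C: abelian_group C by fact
  interpret D: abelian_group D by fact
  let ?N = "{n. c n \<noteq> \<zero>\<^bsub>C\<^esub>}"
  have zero: "f \<zero>\<^bsub>C\<^esub> = \<zero>\<^bsub>D\<^esub>"
    using add[of "\<zero>\<^bsub>C\<^esub>" "\<zero>\<^bsub>C\<^esub>"] closed[of "\<zero>\<^bsub>C\<^esub>"] D.add.r_cancel_one' by auto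
  have "c \<in> ?N \<rightarrow> carrier C" using c assms(2) by (auto simp: hom_decomp_def)
  then have "f x = finsum D (\<lambda>n. f (c n)) ?N"
    using c additive_finsum[of C D f c ?N] assms(1,3) closed add by (auto simp: hom_decomp_def)
  then show ?thesis
    using c by (intro hom_decomp_finsum[of D ?N]) (auto simp: assms(3,4) hom_decomp_def grade zero)
qed

context associated_quiver
begin

abbreviation coset :: "('v, 'e, 'k) word_vector \<Rightarrow> ('v, 'e, 'k) word_vector set" where
  "coset f \<equiv> I +>\<^bsub>F\<^esub> f"

abbreviation B :: "('k, ('v, 'e, 'k) word_vector set) dg" where
  "B \<equiv> leavitt_path_algebra (opposite_quiver Q)"

lemma coset_elements: "coset f = (\<lambda>i. i + f) ` I"
  by (auto simp: a_r_coset_def' F_simps)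

lemma coset_eq_iff: "f \<in> carrier F \<Longrightarrow> g \<in> carrier F \<Longrightarrow> coset f = coset g \<longleftrightarrow> f \<approx> g"
  using F.quotient_eq_iff_same_a_r_cos[OF ideal_I, of f g] by (simp add: cong_I_def F_minus)

lemma B_carrier: "carrier B = coset ` carrier F"
  by (auto simp: leavitt_path_algebra_def Let_def FactRing_def A_RCOSETS_def')

lemma B_mult: "f \<in> carrier F \<Longrightarrow> g \<in> carrier F \<Longrightarrow> coset f \<otimes>\<^bsub>B\<^esub> coset g = coset (f \<otimes>\<^bsub>F\<^esub> g)"
  by (simp add: leavitt_path_algebra_def Let_def FactRing_def I.rcoset_mult_add)

lemma B_add: "f \<in> carrier F \<Longrightarrow> g \<in> carrier F \<Longrightarrow> coset f \<oplus>\<^bsub>B\<^esub> coset g = coset (f + g)"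
  using I.a_rcos_sum[of f g] by (simp add: leavitt_path_algebra_def Let_def FactRing_def F_simps(5))

lemma B_one: "\<one>\<^bsub>B\<^esub> = coset (W [])"
  by (simp add: leavitt_path_algebra_def Let_def FactRing_def F_simps(3))

lemma B_zero: "\<zero>\<^bsub>B\<^esub> = coset 0"
  by (simp add: leavitt_path_algebra_def Let_def FactRing_def coset_elements)

lemma B_smult: assumes "f \<in> carrier F" shows "c \<odot>\<^bsub>B\<^esub> coset f = coset (pm_scale c f)"
proof -
  have "coset (pm_scale c f') = coset (pm_scale c f)" if "f' \<in> coset f" for f'
  proof -
    obtain i where i: "i \<in> I" "f' = i + f" using \<open>f' \<in> coset f\<close> by (auto simp: coset_elements)
    have "i \<in> carrier F" using i I_closed by blast
    then show ?thesis
      using assms i I_scale[OF i(1), of c]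
      by (subst coset_eq_iff) (auto simp: F_simps pm_span_add pm_span_scale cong_I_def pm_scale_add)
  qed
  moreover have "f \<in> coset f" using I_zero by (auto simp: coset_elements)
  ultimately have "(\<Union>f'\<in>coset f. coset (pm_scale c f')) = coset (pm_scale c f)" by blast
  then show ?thesis by (simp add: leavitt_path_algebra_def Let_def F_simps(6))
qed

lemma B_grade: "grade B n = coset ` F_graded n"
  by (simp add: leavitt_path_algebra_def Let_def)

lemma B_differential: "differential B x = \<zero>\<^bsub>B\<^esub>"
  by (simp add: leavitt_path_algebra_def Let_def)

lemma degree_subset: "F_graded n \<subseteq> carrier F"
  using pm_span_mono[of "{w \<in> lists gens. word_degree w = n}" "lists gens"] by (auto simp: F_simps)

lemma B_grade_closed: "grade B n \<subseteq> carrier B"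
  unfolding B_grade B_carrier using degree_subset by blast

lemma B_ring: "ring B"
proof -
  interpret R: ring "F Quot I" by (rule I.quotient_is_ring)
  have eq: "carrier B = carrier (F Quot I)" "mult B = mult (F Quot I)" "one B = one (F Quot I)"
    "zero B = zero (F Quot I)" "add B = add (F Quot I)"
    by (simp_all add: leavitt_path_algebra_def Let_def)
  show ?thesis
  proof (rule ringI)
    show "abelian_group B"
    proof (rule abelian_groupI)
      show "\<exists>y\<in>carrier B. y \<oplus>\<^bsub>B\<^esub> x = \<zero>\<^bsub>B\<^esub>" if "x \<in> carrier B" for x
        using that by (intro bexI[of _ "\<ominus>\<^bsub>F Quot I\<^esub> x"]) (auto simp: eq R.l_neg)
    qed (auto simp: eq R.a_ac)
    show "Group.monoid B" by (rule monoidI) (auto simp: eq R.m_assoc)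
  qed (auto simp: eq R.l_distr R.r_distr)
qed

lemma B_carrierE:
  assumes "x \<in> carrier B" obtains f where "f \<in> carrier F" "x = coset f"
  using assms by (auto simp: B_carrier)

text \<open>The ideal acts as zero, so all representatives of a residue class act in the same way and
  \<open>the_elem\<close> selects their common value.\<close>

lemma ract_coset:
  assumes "f \<in> carrier F" "z \<in> plc_span"
  shows "plc_ract Q a z (coset f) = act z f"
proof -
  have "act z ` coset f = {act z f}"
    using I_zero ideal_acts_zero[OF _ assms(2)]
    by (auto simp: coset_elements image_image act_add image_iff)
  then show ?thesis by (simp add: plc_ract_def)
qed

lemma coset_unit_faithful:
  assumes "x \<in> carrier B" "y \<in> carrier B" "plc_ract Q a unit_vec x = plc_ract Q a unit_vec y"
  shows "x = y"
proof -
  obtain f g where f: "f \<in> carrier F" "x = coset f" and g: "g \<in> carrier F" "y = coset g"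
    using assms(1,2) by (metis B_carrierE)
  have fg: "f - g \<in> carrier F" using f g by (simp add: F_simps pm_span_diff)
  have "act unit_vec (f - g) = 0"
    using assms(3) f g by (simp add: ract_coset unit_vec_closed act_diff)
  from act_unit_faithful[OF fg this] show ?thesis
    using f g by (simp add: coset_eq_iff cong_I_def)
qed

text \<open>The free algebra graded by word degree, as a source of homogeneous components for the
  quotient.\<close>

definition graded_F :: "('k, ('v, 'e) leavitt_gen list \<Rightarrow>\<^sub>0 'k) dg" where
  "graded_F = (dg_concentrated F)\<lparr>grade := (\<lambda>n. F_graded n)\<rparr>"

lemma graded_F_simps:
  "carrier graded_F = carrier F" "add graded_F = (+)" "zero graded_F = 0" "smult graded_F = pm_scale"
  "grade graded_F = (\<lambda>n. F_graded n)"
  "differential graded_F = (\<lambda>_. 0)"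
  by (simp_all add: graded_F_def dg_concentrated_def module.defs dg.defs F_simps)

lemma graded_F_space: "dg_space graded_F"
  by (rule dg_space_pm[of _ "lists gens" word_degree "\<lambda>_. 0"])
    (simp_all add: pm_space_def graded_F_simps F_simps fun_eq_iff)

text \<open>Components exist because they do in the free algebra. They are unique because
  \<open>b \<mapsto> unit_vec b\<close> is an injective graded map into the complex, where components are
  unique.\<close>

lemma B_dg_space: "dg_space B"
proof -
  interpret R: ring B by (rule B_ring)
  interpret GF: dg_space graded_F by (rule graded_F_space)
  interpret P: dg_space P by (rule P_dg_space)
  have scale: "f \<in> carrier F \<Longrightarrow> pm_scale c f \<in> carrier F" "f \<in> carrier F \<Longrightarrow> g \<in> carrier F \<Longrightarrow> f + g \<in> carrier F"
    "0 \<in> carrier F" "f \<in> carrier F \<Longrightarrow> - f \<in> carrier F" for c f g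
    by (simp_all add: F_simps pm_span_scale pm_span_add pm_span_uminus)
  have mod: "Module.module scalars B"
    by (rule moduleI[OF cring_scalars R.abelian_group_axioms])
      (auto elim!: B_carrierE simp: B_smult B_add B_carrier scale pm_scale_add_left pm_scale_add pm_scale_scale)
  interpret M: Module.module scalars B by (rule mod)
  have sub: "submodule (grade B n) scalars B" for n
  proof (rule M.submoduleI)
    fix x assume "x \<in> grade B n"
    then obtain f where f: "f \<in> F_graded n" "x = coset f"
      by (auto simp: B_grade)
    have fF: "f \<in> carrier F" using f degree_subset by blast
    have "\<ominus>\<^bsub>B\<^esub> x = coset (- f)"
      by (rule R.minus_equality) (auto simp: f(2) B_add B_zero B_carrier fF scale)
    then show "\<ominus>\<^bsub>B\<^esub> x \<in> grade B n" using f(1) pm_span_uminus by (auto simp: B_grade)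
  next
    show "grade B n \<subseteq> carrier B" by (rule B_grade_closed)
    show "\<zero>\<^bsub>B\<^esub> \<in> grade B n" by (auto simp: B_grade B_zero)
  qed (use degree_subset in \<open>auto simp: B_grade B_add B_smult subset_iff intro!: imageI pm_span_add pm_span_scale\<close>)
  have zero_grade: "\<zero>\<^bsub>B\<^esub> \<in> grade B n" for n by (auto simp: B_grade B_zero)
  show ?thesis
  proof (rule dg_spaceI[OF mod sub])
    fix x assume x: "x \<in> carrier B"
    then obtain f where f: "f \<in> carrier F" "x = coset f" by (rule B_carrierE)
    have "hom_decomp B (coset f) (\<lambda>n. coset (hom_comp graded_F f n))"
      by (rule hom_decomp_image[of graded_F])
        (use f degree_subset in \<open>auto simp: GF.abelian_group_axioms R.abelian_group_axioms B_grade
            GF.hom_decomp_hom_comp graded_F_simps B_carrier B_add\<close>)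
    then show "\<exists>c. hom_decomp B x c" using f by blast
    fix c c' assume c: "hom_decomp B x c" "hom_decomp B x c'"
    have *: "hom_decomp P (plc_ract Q a unit_vec x) (\<lambda>n. plc_ract Q a unit_vec (d n))"
      if "hom_decomp B x d" for d
    proof (rule hom_decomp_image[OF R.abelian_group_axioms B_grade_closed P.R.abelian_group_axioms _ _ _ _ that])
      show "grade P n \<subseteq> carrier P" for n using P.grade_closed by blast
      show "plc_ract Q a unit_vec y \<in> carrier P" if "y \<in> carrier B" for y
        using that by (auto elim!: B_carrierE simp: ract_coset unit_vec_closed act_closed P_simps)
      show "plc_ract Q a unit_vec (y \<oplus>\<^bsub>B\<^esub> y') = plc_ract Q a unit_vec y \<oplus>\<^bsub>P\<^esub> plc_ract Q a unit_vec y'"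
        if "y \<in> carrier B" "y' \<in> carrier B" for y y'
        using that by (auto elim!: B_carrierE simp: B_add ract_coset unit_vec_closed scale act_add P_simps)
      show "plc_ract Q a unit_vec y \<in> grade P n" if "y \<in> grade B n" for y n
        using that degree_subset[of n] act_degree[OF _ unit_vec_degree, of _ n]
        by (auto simp: B_grade ract_coset unit_vec_closed P_simps subset_iff)
    qed
    have "plc_ract Q a unit_vec x \<in> carrier P"
      using f by (simp add: ract_coset unit_vec_closed act_closed P_simps)
    then have "(\<lambda>n. plc_ract Q a unit_vec (c n)) = (\<lambda>n. plc_ract Q a unit_vec (c' n))"
      using P.hom_decomp_unique *[OF c(1)] *[OF c(2)] by blast
    moreover have "c n \<in> carrier B" "c' n \<in> carrier B" for n
      using c B_grade_closed by (auto simp: hom_decomp_def)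
    ultimately show "c = c'" by (intro ext coset_unit_faithful) (auto dest: fun_cong)
  qed (auto simp: B_differential M.smult_r_null zero_grade)
qed

lemma B_dg_algebra: "dg_algebra B"
proof -
  interpret R: ring B by (rule B_ring)
  interpret S: dg_space B by (rule B_dg_space)
  have scale: "pm_scale c f \<in> carrier F" if "f \<in> carrier F" for c f
    using that by (simp add: F_simps pm_span_scale)
  have "dg_algebra_axioms B"
  proof unfold_locales
    show "\<one>\<^bsub>B\<^esub> \<in> grade B 0"
      unfolding B_one B_grade by (rule imageI, rule pm_span_single) (simp add: word_degree_def)
    fix x y c assume "x \<in> carrier B" "y \<in> carrier B"
    then obtain f g where fg: "f \<in> carrier F" "x = coset f" "g \<in> carrier F" "y = coset g"
      by (metis B_carrierE)
    have *: "f \<otimes>\<^bsub>F\<^esub> g \<in> carrier F" using fg by simp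
    show "(c \<odot>\<^bsub>B\<^esub> x) \<otimes>\<^bsub>B\<^esub> y = c \<odot>\<^bsub>B\<^esub> (x \<otimes>\<^bsub>B\<^esub> y)" "x \<otimes>\<^bsub>B\<^esub> (c \<odot>\<^bsub>B\<^esub> y) = c \<odot>\<^bsub>B\<^esub> (x \<otimes>\<^bsub>B\<^esub> y)"
      using fg * by (simp_all add: B_smult B_mult scale)
        (simp_all add: F_simps pm_mult_scale_left pm_mult_scale_right)
  next
    fix x y m n assume "x \<in> grade B m" "y \<in> grade B n"
    then obtain f g where f: "f \<in> F_graded m" "x = coset f"
      and g: "g \<in> F_graded n" "y = coset g"
      by (auto simp: B_grade)
    have "f \<otimes>\<^bsub>F\<^esub> g \<in> F_graded (m + n)"
      unfolding F_simps(2) using _ f(1) g(1)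
      by (rule pm_mult_span) (auto simp: word_degree_def intro!: pm_span_single)
    moreover have "f \<in> carrier F" "g \<in> carrier F" using f g degree_subset by blast+
    ultimately show "x \<otimes>\<^bsub>B\<^esub> y \<in> grade B (m + n)"
      by (auto simp: f g B_mult B_grade)
  next
    fix x y m assume "x \<in> grade B m" "y \<in> carrier B"
    then show "differential B (x \<otimes>\<^bsub>B\<^esub> y) =
      (differential B x \<otimes>\<^bsub>B\<^esub> y) \<oplus>\<^bsub>B\<^esub> (koszul_sign m \<odot>\<^bsub>B\<^esub> (x \<otimes>\<^bsub>B\<^esub> differential B y))"
      by (simp add: B_differential S.grade_closed)
  qed
  then show ?thesis using B_dg_space B_ring by (simp add: dg_algebra_def)
qed

text \<open>The differential, left multiplications and the projection to the top all commute with the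
  generators on basis vectors.\<close>

lemma act_commute:
  assumes basis: "\<And>g b. g \<in> gens \<Longrightarrow> b \<in> plc_basis \<Longrightarrow>
      pm_extend \<tau> (gen_basis g b) = pm_extend (gen_basis g) (\<tau> b)"
    and "f \<in> carrier F" "z \<in> plc_span"
  shows "pm_extend \<tau> (act z f) = act (pm_extend \<tau> z) f"
proof -
  have w: "pm_extend \<tau> (word_act w z) = word_act w (pm_extend \<tau> z)" if "w \<in> lists gens" for w
    using that assms(3)
  proof (induction w arbitrary: z rule: list.induct)
    case (Cons g w)
    have g: "g \<in> gens" "w \<in> lists gens" using Cons(2) by auto
    have "pm_extend (gen_basis g) z \<in> plc_span"
      using act_closed[OF W_closed[of "[g]"] Cons(3)] g by simp
    from Cons(1)[OF g(2) this] have "pm_extend \<tau> (word_act (g # w) z) =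
        word_act w (pm_extend \<tau> (pm_extend (gen_basis g) z))" by simp
    also have "pm_extend \<tau> (pm_extend (gen_basis g) z) = pm_extend (gen_basis g) (pm_extend \<tau> z)"
      unfolding pm_extend_comp by (rule pm_extend_cong_span[OF Cons(3)]) (rule basis[OF g(1)])
    finally show ?case by simp
  qed simp
  show ?thesis
    using assms(2) unfolding act_eq pm_extend_comp F_simps
    by (rule pm_extend_cong_span) (rule w)
qed

lemma lact_act:
  assumes "x \<in> carrier A" "z \<in> plc_span" "f \<in> carrier F"
  shows "act (plc_lact Q x z) f = plc_lact Q x (act z f)"
proof -
  have "act (plc_lact Q x z) f = pm_extend (\<lambda>v. act (pm_extend (left_basis v) z) f) x"
    unfolding plc_lact_eq' by (rule act_extend)
  also have "\<dots> = pm_extend (\<lambda>v. pm_extend (left_basis v) (act z f)) x"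
    using assms(1) unfolding A_simps
  proof (rule pm_extend_cong_span)
    fix v assume "v \<in> alg_basis"
    then show "act (pm_extend (left_basis v) z) f = pm_extend (left_basis v) (act z f)"
      by (intro act_commute[symmetric] gen_basis_left[symmetric] assms(2,3))
  qed
  finally show ?thesis unfolding plc_lact_eq' .
qed

lemma lact_degree:
  fixes x :: "('v, 'e) qpath \<Rightarrow>\<^sub>0 'k" and z :: "('v, 'e, 'k) plc_vector"
  assumes "x \<in> pm_span alg_basis" "z \<in> plc_graded n"
  shows "plc_lact Q x z \<in> plc_graded n"
  unfolding plc_lact_eq' using assms(1)
proof (rule pm_span_extend)
  fix v assume v: "v \<in> alg_basis"
  show "pm_extend (left_basis v) z \<in> plc_graded n"
    using assms(2) by (rule pm_span_extend) (use left_basis_degree[OF v] in auto)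
qed

lemma lact_closed:
  fixes x :: "('v, 'e) qpath \<Rightarrow>\<^sub>0 'k" and z :: "('v, 'e, 'k) plc_vector"
  assumes "x \<in> pm_span alg_basis" "z \<in> plc_span"
  shows "plc_lact Q x z \<in> plc_span"
  unfolding plc_lact_eq' using assms(1)
proof (rule pm_span_extend)
  fix v assume v: "v \<in> alg_basis"
  show "pm_extend (left_basis v) z \<in> plc_span"
    using assms(2)
  proof (rule pm_span_extend)
    show "left_basis v b \<in> plc_span" if "b \<in> plc_basis" for b
      using pm_span_mono[OF _ left_basis_degree[OF v that], of plc_basis] by auto
  qed
qed

lemma lact_add:
  fixes x y :: "('v, 'e) qpath \<Rightarrow>\<^sub>0 'k" and z z' :: "('v, 'e, 'k) plc_vector"
  shows "plc_lact Q (x + y) z = plc_lact Q x z + plc_lact Q y z"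
    "plc_lact Q x (z + z') = plc_lact Q x z + plc_lact Q x z'"
  unfolding plc_lact_eq' by (simp_all add: pm_extend_add pm_extend_add_fun)

lemma lact_scale:
  fixes x :: "('v, 'e) qpath \<Rightarrow>\<^sub>0 'k" and z :: "('v, 'e, 'k) plc_vector"
  shows "plc_lact Q (pm_scale c x) z = pm_scale c (plc_lact Q x z)"
    "plc_lact Q x (pm_scale c z) = pm_scale c (plc_lact Q x z)"
  unfolding plc_lact_eq' by (simp_all add: pm_extend_scale pm_extend_scale_fun)

lemma lact_mult:
  fixes x :: "('v, 'e) qpath \<Rightarrow>\<^sub>0 'k" and z :: "('v, 'e, 'k) plc_vector"
  assumes "x \<in> pm_span alg_basis" "y \<in> pm_span alg_basis" "z \<in> plc_span"
  shows "plc_lact Q (pm_mult alg_mult x y) z = plc_lact Q x (plc_lact Q y z)"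
proof -
  have "plc_lact Q (pm_mult alg_mult x y) z =
      pm_extend (\<lambda>v. pm_extend (\<lambda>w. pm_extend (\<lambda>b. pm_extend (\<lambda>v'. left_basis v' b) (alg_mult v w)) z) y) x"
    unfolding plc_lact_eq' pm_mult_def pm_extend_comp by (subst pm_extend_swap) simp
  also have "\<dots> = pm_extend (\<lambda>v. pm_extend (\<lambda>w. pm_extend (\<lambda>b. pm_extend (left_basis v) (left_basis w b)) z) y) x"
    by (intro pm_extend_cong_span[OF assms(1)] pm_extend_cong_span[OF assms(2)]
        pm_extend_cong_span[OF assms(3)] left_basis_mult)
  also have "\<dots> = plc_lact Q x (plc_lact Q y z)"
    unfolding plc_lact_eq' pm_extend_comp ..
  finally show ?thesis .
qed

lemma lact_one:
  fixes z :: "('v, 'e, 'k) plc_vector"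
  assumes "z \<in> plc_span"
  shows "plc_lact Q (\<Sum>i\<in>verts Q. basis_vec (i, [])) z = z"
proof -
  have "plc_lact Q (\<Sum>i\<in>verts Q. basis_vec (i, [])) z = pm_extend basis_vec z"
    unfolding plc_lact_eq
    by (rule pm_extend_cong_span[OF assms]) (simp add: pm_extend_sum left_basis_one)
  then show ?thesis by (simp add: pm_extend_basis)
qed

lemma lact_differential:
  fixes x :: "('v, 'e) qpath \<Rightarrow>\<^sub>0 'k" and z :: "('v, 'e, 'k) plc_vector"
  assumes "x \<in> pm_span alg_basis" "z \<in> plc_span"
  shows "pm_extend differential_basis (plc_lact Q x z) = plc_lact Q x (pm_extend differential_basis z)"
  unfolding plc_lact_eq' pm_extend_comp
  by (intro pm_extend_cong_span[OF assms(1)] pm_extend_cong_span[OF assms(2)] left_basis_differential)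

lemma act_differential:
  "f \<in> carrier F \<Longrightarrow> z \<in> plc_span \<Longrightarrow>
   pm_extend differential_basis (act z f) = act (pm_extend differential_basis z) f"
  by (rule act_commute) (rule gen_basis_differential)

lemma P_dg_bimodule: "dg_bimodule A B P"
proof -
  interpret A: dg_algebra A by (rule A_dg_algebra)
  interpret B: dg_algebra B by (rule B_dg_algebra)
  interpret M: dg_space P by (rule P_dg_space)
  have d: "pm_extend differential_basis z \<in> plc_span" if "z \<in> plc_span" for z
    using M.differential_closed[of z] that by (simp add: P_simps)
  have F: "f + g \<in> carrier F" "pm_scale c f \<in> carrier F" "0 \<in> carrier F"
    if "f \<in> carrier F" "g \<in> carrier F" for c f g
    using that by (simp_all add: F_simps pm_span_add pm_span_scale)
  have F0: "0 \<in> carrier F" by (simp add: F_simps)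
  have A_graded: "m = 0 \<or> x = 0" if "x \<in> grade A m" for x m using that by (cases "m = 0") (auto simp: A_simps)
  have A_closed: "x \<in> pm_span alg_basis" if "x \<in> grade A m" for x m using that A.grade_closed by (simp add: A_simps)
  have [simp]: "plc_lact Q 0 z = 0" for z :: "('v, 'e, 'k) plc_vector" by (simp add: plc_lact_eq')
  show ?thesis
  proof unfold_locales
    fix x z m n assume "x \<in> grade A m" "z \<in> grade P n"
    then show "lact P x z \<in> grade P (m + n)"
      using A_graded[of x m] lact_degree[of x z n] A_closed[of x m] by (auto simp: P_simps)
  next
    fix x z m assume x: "x \<in> grade A m" and z: "z \<in> carrier P"
    have "pm_scale (koszul_sign m) (plc_lact Q x (pm_extend differential_basis z)) =
        plc_lact Q x (pm_extend differential_basis z)"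
      using A_graded[OF x] by (auto simp: koszul_sign_parity)
    then show "differential P (lact P x z) =
        lact P (differential A x) z \<oplus>\<^bsub>P\<^esub> (koszul_sign m \<odot>\<^bsub>P\<^esub> lact P x (differential P z))"
      using z A_closed[OF x] by (simp add: P_simps A_simps(8) lact_differential)
  next
    fix z y m n assume "z \<in> grade P m" "y \<in> grade B n"
    then show "ract P z y \<in> grade P (m + n)"
      using degree_subset[of n] act_degree[of _ n z m] M.grade_closed[of z m]
      by (auto simp: B_grade P_simps ract_coset subset_iff)
  next
    fix z y m assume "z \<in> grade P m" "y \<in> carrier B"
    then show "differential P (ract P z y) =
        ract P (differential P z) y \<oplus>\<^bsub>P\<^esub> (koszul_sign m \<odot>\<^bsub>P\<^esub> ract P z (differential B y))"
      using M.grade_closed[of z m]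
      by (auto elim!: B_carrierE simp: P_simps B_differential B_zero ract_coset F0 act_differential d)
  next
    fix z assume "z \<in> carrier P"
    then show "ract P z \<one>\<^bsub>B\<^esub> = z" using ract_coset[OF W_closed[of "[]"], of z] by (simp add: B_one P_simps)
  qed (auto elim!: B_carrierE simp: A_simps P_simps B_add B_smult B_mult ract_coset F act_closed act_add
      act_scale act_mult lact_act lact_closed lact_add lact_scale lact_mult lact_one pm_span_add pm_span_scale)
qed

end

section \<open>The contraction\<close>

context associated_quiver
begin

abbreviation plc_d :: "('v, 'e, 'k) plc_vector \<Rightarrow> ('v, 'e, 'k) plc_vector" where
  "plc_d \<equiv> pm_extend differential_basis"

abbreviation left :: "('v, 'e) qpath \<Rightarrow> ('v, 'e, 'k) plc_vector \<Rightarrow> ('v, 'e, 'k) plc_vector" where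
  "left v \<equiv> pm_extend (left_basis v)"

lemma plc_lact_basis: "plc_lact Q (basis_vec v) z = left v z"
  by (simp add: plc_lact_eq')

text \<open>Left division by an arrow, vanishing on everything that does not start with this arrow.\<close>

definition strip_basis :: "'e \<Rightarrow> ('v, 'e) plc_index \<Rightarrow> ('v, 'e, 'k) plc_vector" where
  "strip_basis \<beta> = (\<lambda>(u, pq). if snd u = [\<beta>] then zeta (fst u, []) pq else 0)"

abbreviation strip where "strip \<beta> \<equiv> pm_extend (strip_basis \<beta>)"

text \<open>The map \<open>\<beta> \<otimes> b \<mapsto> \<beta>\<^sup>*b\<close> from the radical to the top, in terms of the basis.
  The product \<open>\<beta>\<^sup>*p\<^sup>*q\<close> is again a normal word, unless \<open>p\<close> is trivial and \<open>q\<close> starts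
  with \<open>\<beta>\<close>, which is associated: then \<open>\<beta>\<^sup>*\<beta>\<close> is replaced by
  \<open>e - \<Sum> \<gamma>\<^sup>*\<gamma>\<close>.\<close>

definition contract_basis :: "('v, 'e) plc_index \<Rightarrow> ('v, 'e, 'k) plc_vector" where
  "contract_basis = (\<lambda>((t, v), ((i, l), (j, r))).
     if v = [] then 0
     else let \<beta> = hd v; h = head Q \<beta> in
       if l = [] \<and> r \<noteq> [] \<and> hd r = \<beta> \<and> \<beta> \<in> assoc
       then zeta (h, []) ((h, []), (h, tl r)) -
         (\<Sum>\<gamma>\<in>{\<gamma> \<in> arcs Q. head Q \<gamma> = h \<and> \<gamma> \<noteq> \<beta>}.
            zeta (h, []) ((tail Q \<gamma>, [\<gamma>]), (tail Q \<gamma>, \<gamma> # tl r)))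
       else zeta (h, []) ((i, l @ [\<beta>]), (j, r)))"

abbreviation "contract \<equiv> pm_extend contract_basis"

lemma strip_basis_simps [simp]:
  "strip_basis \<beta> ((t, []), pq) = 0"
  "strip_basis \<beta> ((t, [\<gamma>]), pq) = (if \<gamma> = \<beta> then zeta (t, []) pq else 0)"
  by (simp_all add: strip_basis_def)

lemma contract_basis_simps [simp]:
  "contract_basis ((t, []), pq) = 0"
  "contract_basis ((t, [\<beta>]), ((i, l), (j, r))) =
     (if l = [] \<and> r \<noteq> [] \<and> hd r = \<beta> \<and> \<beta> \<in> assoc
      then zeta (head Q \<beta>, []) ((head Q \<beta>, []), (head Q \<beta>, tl r)) -
         (\<Sum>\<gamma>\<in>{\<gamma> \<in> arcs Q. head Q \<gamma> = head Q \<beta> \<and> \<gamma> \<noteq> \<beta>}.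
            zeta (head Q \<beta>, []) ((tail Q \<gamma>, [\<gamma>]), (tail Q \<gamma>, \<gamma> # tl r)))
      else zeta (head Q \<beta>, []) ((i, l @ [\<beta>]), (j, r)))"
  by (auto simp: contract_basis_def Let_def split: prod.split)

lemma plc_basis_cases:
  assumes "b \<in> plc_basis"
  obtains (top) i l r where "b = ((path_target i l, []), ((i, l), (i, r)))" "admissible i l r"
  | (arrow) \<beta> i l r where "b = ((tail Q \<beta>, [\<beta>]), ((i, l), (i, r)))" "admissible i l r"
      "\<beta> \<in> arcs Q" "tail Q \<beta> = path_target i l"
  using assms by (elim plc_basisE) (auto simp: proj_basis_iff)

lemma top_in_plc_basis: "admissible i l r \<Longrightarrow> ((path_target i l, []), ((i, l), (i, r))) \<in> plc_basis"
  by (simp add: plc_basis_iff proj_basis_iff)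

definition top_basis :: "('v, 'e) plc_index \<Rightarrow> ('v, 'e, 'k) plc_vector" where
  "top_basis b = (if snd (fst b) = [] then basis_vec b else 0)"

lemma top_part_eq: "top_part = pm_extend top_basis"
  by (simp add: top_part_def top_basis_def[abs_def])

lemma top_basis_simps [simp]:
  "top_basis ((t, []), pq) = zeta (t, []) pq" "top_basis ((t, [\<beta>]), pq) = 0"
  by (simp_all add: top_basis_def)

lemma top_zero [simp]: "top_part 0 = 0"
  and top_diff: "top_part (x - y) = top_part x - top_part y"
  and top_add: "top_part (x + y) = top_part x + top_part y"
  and top_scale: "top_part (pm_scale c x) = pm_scale c (top_part x)"
  by (simp_all add: top_part_eq pm_extend_diff pm_extend_add pm_extend_scale)

lemma top_left_vertex: "z \<in> plc_span \<Longrightarrow> top_part (left (j, []) z) = left (j, []) (top_part z)"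
  unfolding top_part_eq pm_extend_comp
  by (erule pm_extend_cong_span, erule plc_basis_cases) auto

lemma top_left_arrow: "z \<in> plc_span \<Longrightarrow> top_part (left (t, [\<beta>]) z) = 0"
  unfolding top_part_eq pm_extend_comp
  by (erule pm_extend_eq_zero, erule plc_basis_cases) auto

lemma left_arrow_top: "z \<in> plc_span \<Longrightarrow> left (t, [\<beta>]) (top_part z) = left (t, [\<beta>]) z"
  unfolding top_part_eq pm_extend_comp
  by (erule pm_extend_cong_span, erule plc_basis_cases) auto

lemma left_target_arrow:
  "z \<in> plc_span \<Longrightarrow> left (head Q \<beta>, []) (left (t, [\<beta>]) z) = left (t, [\<beta>]) z"
  unfolding pm_extend_comp
  by (erule pm_extend_cong_span, erule plc_basis_cases) auto

lemma differential_top: "z \<in> plc_span \<Longrightarrow> plc_d (top_part z) = plc_d z"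
  unfolding top_part_eq pm_extend_comp
  by (erule pm_extend_cong_span, erule plc_basis_cases) auto

lemma differential_left_arrow: "z \<in> plc_span \<Longrightarrow> plc_d (left (t, [\<beta>]) z) = 0"
  unfolding pm_extend_comp
  by (erule pm_extend_eq_zero, erule plc_basis_cases) auto

lemma top_differential: "z \<in> plc_span \<Longrightarrow> top_part (plc_d z) = 0"
  unfolding top_part_eq pm_extend_comp
proof (erule pm_extend_eq_zero, erule plc_basis_cases)
  fix b :: "('v, 'e) plc_index" and i l r assume "b = ((path_target i l, []), ((i, l), (i, r)))"
  then show "pm_extend top_basis (differential_basis b) = 0"
    by (cases "l = []") (auto simp: pm_extend_sum)
qed auto

lemma strip_left_arrow:
  "z \<in> plc_span \<Longrightarrow>
   strip \<beta> (left (tail Q \<gamma>, [\<gamma>]) z) = (if \<gamma> = \<beta> then top_part (left (tail Q \<beta>, []) z) else 0)"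
proof -
  assume z: "z \<in> plc_span"
  have "strip \<beta> (left (tail Q \<gamma>, [\<gamma>]) z) =
      pm_extend (\<lambda>b. if \<gamma> = \<beta> then pm_extend top_basis (left_basis (tail Q \<beta>, []) b) else 0) z"
    unfolding pm_extend_comp using z
    by (rule pm_extend_cong_span, elim plc_basis_cases) auto
  then show ?thesis by (auto simp: top_part_eq pm_extend_comp)
qed

lemma left_strip:
  assumes "z \<in> plc_span"
  shows "left (tail Q \<beta>, []) (strip \<beta> z) = strip \<beta> z"
  unfolding pm_extend_comp using assms by (rule pm_extend_cong_span, elim plc_basis_cases) auto

lemma sum_left_strip:
  assumes "z \<in> plc_span"
  shows "(\<Sum>\<beta>\<in>{\<beta> \<in> arcs Q. head Q \<beta> = i}. left (tail Q \<beta>, [\<beta>]) (strip \<beta> z)) = left (i, []) (z - top_part z)"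
proof -
  have "(\<Sum>\<beta>\<in>{\<beta> \<in> arcs Q. head Q \<beta> = i}. left (tail Q \<beta>, [\<beta>]) (strip \<beta> z)) =
     pm_extend (\<lambda>b. \<Sum>\<beta>\<in>{\<beta> \<in> arcs Q. head Q \<beta> = i}. left (tail Q \<beta>, [\<beta>]) (strip_basis \<beta> b)) z"
    by (simp add: pm_extend_sum_fun pm_extend_comp)
  also have "\<dots> = pm_extend (\<lambda>b. left (i, []) (basis_vec b - top_basis b)) z"
    using assms
  proof (rule pm_extend_cong_span)
    fix b assume "b \<in> plc_basis"
    then show "(\<Sum>\<beta>\<in>{\<beta> \<in> arcs Q. head Q \<beta> = i}. left (tail Q \<beta>, [\<beta>]) (strip_basis \<beta> b)) =
        left (i, []) (basis_vec b - top_basis b)"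
    proof (cases rule: plc_basis_cases)
      case (arrow \<gamma> j l r)
      have "(\<Sum>\<beta>\<in>{\<beta> \<in> arcs Q. head Q \<beta> = i}. left (tail Q \<beta>, [\<beta>]) (strip_basis \<beta> b)) =
          (\<Sum>\<beta>\<in>{\<beta> \<in> arcs Q. head Q \<beta> = i}. if \<gamma> = \<beta> then basis_vec b else 0)"
        by (rule sum.cong) (auto simp: arrow)
      then show ?thesis using arrow by (auto simp: arrow)
    qed simp
  qed
  also have "\<dots> = left (i, []) (z - top_part z)"
    by (simp add: top_part_eq pm_extend_comp pm_extend_diff pm_extend_diff_fun)
  finally show ?thesis .
qed

lemma contract_basis_degree:
  assumes "b \<in> plc_basis"
  shows "contract_basis b \<in> plc_graded (plc_degree b - 1)"
  using assms
proof (cases rule: plc_basis_cases)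
  case (arrow \<beta> i l r)
  show ?thesis
  proof (cases "l = [] \<and> r \<noteq> [] \<and> hd r = \<beta> \<and> \<beta> \<in> assoc")
    case True
    then obtain r' where r: "r = \<beta> # r'" by (cases r) auto
    have "\<gamma> \<notin> assoc" if "\<gamma> \<in> arcs Q" "head Q \<gamma> = head Q \<beta>" "\<gamma> \<noteq> \<beta>" for \<gamma>
      using that assoc_unique True by blast
    then show ?thesis using True arrow
      by (auto simp: r plc_basis_iff plc_degree_def proj_basis_iff admissible_def path_start_in_verts
          intro!: pm_span_diff pm_span_sum pm_span_single)
  next
    case False
    have "admissible i (l @ [\<beta>]) r" using False arrow by (cases l) (auto simp: admissible_def)
    then show ?thesis using False arrow
      by (auto simp: plc_basis_iff plc_degree_def proj_basis_iff intro!: pm_span_single)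
  qed
qed simp

lemma contract_degree:
  "z \<in> plc_graded n \<Longrightarrow>
   contract z \<in> plc_graded (n - 1)"
  by (erule pm_span_extend) (use contract_basis_degree in auto)

lemma strip_degree:
  "z \<in> plc_graded n \<Longrightarrow>
   strip \<beta> z \<in> plc_graded n"
proof (erule pm_span_extend)
  fix b assume "b \<in> {b \<in> plc_basis. plc_degree b = n}"
  then show "strip_basis \<beta> b \<in> plc_graded n"
    by (elim CollectE conjE plc_basis_cases)
      (auto simp: plc_basis_iff plc_degree_def proj_basis_iff intro!: pm_span_single)
qed

lemma contract_left_vertex:
  "z \<in> plc_span \<Longrightarrow> contract (left (j, []) z) = left (j, []) (contract z)"
  unfolding pm_extend_comp
  by (erule pm_extend_cong_span, erule plc_basis_cases)
    (auto simp: pm_extend_diff pm_extend_sum)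

text \<open>Together with \<open>differential_contract\<close>: the differential is a bijection from the top onto
  the radical. At \<open>(e\<^sub>i, q)\<close> the differential is a sum over all arrows ending at \<open>i\<close>; the
  associated one contributes the original vector minus the contributions of the others.\<close>

lemma contract_differential:
  assumes "z \<in> plc_span"
  shows "contract (plc_d z) = top_part z"
  unfolding top_part_eq pm_extend_comp using assms
proof (rule pm_extend_cong_span)
  fix b assume "b \<in> plc_basis"
  then show "contract (differential_basis b) = top_basis b"
  proof (cases rule: plc_basis_cases)
    case (top i l r)
    show ?thesis
    proof (cases l rule: rev_cases)
      case (snoc l' \<beta>)
      then have "\<not> (l' = [] \<and> r \<noteq> [] \<and> hd r = \<beta> \<and> \<beta> \<in> assoc)" using top by (auto simp: admissible_def)
      then show ?thesis using snoc by (auto simp: top)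
    next
      case Nil
      let ?S = "{\<beta> \<in> arcs Q. head Q \<beta> = i}"
      have i: "i \<in> verts Q" using top path_start_in_verts by (auto simp: admissible_def)
      then have ai: "a i \<in> ?S" "a i \<in> assoc" "head Q (a i) = i"
        using choice by (auto simp: associated_choice_def associated_arrows_def)
      have S: "{\<gamma> \<in> arcs Q. head Q \<gamma> = i \<and> \<gamma> \<noteq> a i} = ?S - {a i}" by auto
      have "\<beta> \<notin> assoc" if "\<beta> \<in> ?S - {a i}" for \<beta> using that assoc_unique[of "a i" \<beta>] ai by auto
      then have "(\<Sum>\<beta>\<in>?S - {a i}. contract_basis ((tail Q \<beta>, [\<beta>]), ((tail Q \<beta>, []), (tail Q \<beta>, \<beta> # r)))) =
          (\<Sum>\<beta>\<in>?S - {a i}. zeta (i, []) ((tail Q \<beta>, [\<beta>]), (tail Q \<beta>, \<beta> # r)))"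
        by (intro sum.cong) auto
      then show ?thesis
        using ai by (simp add: top Nil pm_extend_sum pm_extend_add sum.remove[of ?S "a i"] S)
    qed
  next
    case arrow
    then show ?thesis by simp
  qed
qed

lemma differential_contract:
  assumes "z \<in> plc_span"
  shows "plc_d (contract z) = z - top_part z"
proof -
  have "plc_d (contract z) = pm_extend (\<lambda>b. basis_vec b - top_basis b) z"
    unfolding pm_extend_comp using assms
  proof (rule pm_extend_cong_span)
    fix b assume "b \<in> plc_basis"
    then show "plc_d (contract_basis b) = basis_vec b - top_basis b"
    proof (cases rule: plc_basis_cases)
      case (arrow \<beta> i l r)
      show ?thesis
      proof (cases "l = [] \<and> r \<noteq> [] \<and> hd r = \<beta> \<and> \<beta> \<in> assoc")
        case True
        then obtain r' where r: "r = \<beta> # r'" by (cases r) auto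
        let ?S = "{\<gamma> \<in> arcs Q. head Q \<gamma> = head Q \<beta>}"
        have S: "{\<gamma> \<in> arcs Q. head Q \<gamma> = head Q \<beta> \<and> \<gamma> \<noteq> \<beta>} = ?S - {\<beta>}" "finite ?S" "\<beta> \<in> ?S"
          using arrow by auto
        have "i = tail Q \<beta>" using arrow True by simp
        then show ?thesis using True
          by (simp add: arrow r pm_extend_diff pm_extend_sum S(1) sum.remove[OF S(2,3)])
      next
        case False
        then show ?thesis by (auto simp: arrow)
      qed
    qed simp
  qed
  then show ?thesis by (simp add: top_part_eq pm_extend_diff_fun pm_extend_basis)
qed

section \<open>Endomorphisms, cocycles and coboundaries\<close>

text \<open>The homogeneous \<open>A\<close>-linear maps, without extensionality and with linearity tested on the
  basis of \<open>A\<close> only.\<close>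

definition graded_endo :: "int \<Rightarrow> (('v, 'e, 'k) plc_vector \<Rightarrow> ('v, 'e, 'k) plc_vector) \<Rightarrow> bool" where
  "graded_endo n f \<longleftrightarrow>
     (\<forall>x\<in>plc_span. f x \<in> plc_span) \<and>
     (\<forall>x\<in>plc_span. \<forall>y\<in>plc_span. f (x + y) = f x + f y) \<and>
     (\<forall>c. \<forall>x\<in>plc_span. f (pm_scale c x) = pm_scale c (f x)) \<and>
     (\<forall>v\<in>alg_basis. \<forall>x\<in>plc_span. f (left v x) = left v (f x)) \<and>
     (\<forall>l. \<forall>x\<in>plc_graded l. f x \<in> plc_graded (l + n))"

lemma left_closed: "v \<in> alg_basis \<Longrightarrow> z \<in> plc_span \<Longrightarrow> left v z \<in> plc_span"
  using lact_closed[OF pm_span_single[of v alg_basis 1], of z] by (simp add: plc_lact_basis)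

lemma endo_closed: "graded_endo n f \<Longrightarrow> x \<in> plc_span \<Longrightarrow> f x \<in> plc_span"
  and endo_add: "graded_endo n f \<Longrightarrow> x \<in> plc_span \<Longrightarrow> y \<in> plc_span \<Longrightarrow> f (x + y) = f x + f y"
  and endo_scale: "graded_endo n f \<Longrightarrow> x \<in> plc_span \<Longrightarrow> f (pm_scale c x) = pm_scale c (f x)"
  and endo_left: "graded_endo n f \<Longrightarrow> v \<in> alg_basis \<Longrightarrow> x \<in> plc_span \<Longrightarrow> f (left v x) = left v (f x)"
  and endo_degree: "graded_endo n f \<Longrightarrow> x \<in> plc_graded l \<Longrightarrow>
    f x \<in> plc_graded (l + n)"
  unfolding graded_endo_def by blast+

lemma endo_zero: "graded_endo n f \<Longrightarrow> f 0 = 0"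
  using endo_scale[of n f 0 0] by simp

lemma endo_sum:
  assumes "graded_endo n f" "\<And>i. i \<in> N \<Longrightarrow> g i \<in> plc_span"
  shows "f (sum g N) = (\<Sum>i\<in>N. f (g i))"
  using assms(2)
  by (induction N rule: infinite_finite_induct)
    (auto simp: endo_zero[OF assms(1)] endo_add[OF assms(1)] pm_span_sum)

lemma endo_linear:
  assumes f: "graded_endo n f" and z: "z \<in> plc_span"
  shows "f z = pm_extend (\<lambda>b. f (basis_vec b)) z"
proof -
  have b: "basis_vec b \<in> plc_span" if "b \<in> Poly_Mapping.keys z" for b :: "('v, 'e) plc_index"
    using z that by (auto simp: pm_span_def)
  have "f z = f (\<Sum>b\<in>Poly_Mapping.keys z. pm_scale (Poly_Mapping.lookup z b) (basis_vec b))"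
    using pm_extend_basis[of z] by (simp add: pm_extend_def)
  also have "\<dots> = (\<Sum>b\<in>Poly_Mapping.keys z. f (pm_scale (Poly_Mapping.lookup z b) (basis_vec b)))"
    by (rule endo_sum[OF f]) (rule pm_span_scale[OF b])
  also have "\<dots> = pm_extend (\<lambda>b. f (basis_vec b)) z"
    unfolding pm_extend_def by (intro sum.cong refl endo_scale[OF f b])
  finally show ?thesis .
qed

lemma endo_arrow:
  assumes f: "graded_endo n f" and "admissible i l r" "\<beta> \<in> arcs Q" "tail Q \<beta> = path_target i l"
  shows "f (zeta (tail Q \<beta>, [\<beta>]) ((i, l), (i, r))) =
     left (tail Q \<beta>, [\<beta>]) (f (zeta (tail Q \<beta>, []) ((i, l), (i, r))))"
proof -
  have "zeta (tail Q \<beta>, []) ((i, l), (i, r)) \<in> plc_span"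
    using assms top_in_plc_basis by (auto intro: pm_span_single)
  moreover have "(tail Q \<beta>, [\<beta>]) \<in> alg_basis" using assms by (auto simp: alg_basis_def path_target_in_verts)
  moreover have "zeta (tail Q \<beta>, [\<beta>]) ((i, l), (i, r)) = left (tail Q \<beta>, [\<beta>]) (zeta (tail Q \<beta>, []) ((i, l), (i, r)))"
    by simp
  ultimately show ?thesis using endo_left[OF f] by metis
qed

lemma endo_vertex:
  assumes f: "graded_endo n f" and "admissible i l r"
  shows "left (path_target i l, []) (f (zeta (path_target i l, []) ((i, l), (i, r)))) =
    f (zeta (path_target i l, []) ((i, l), (i, r)))"
proof -
  have "zeta (path_target i l, []) ((i, l), (i, r)) \<in> plc_span"
    using assms top_in_plc_basis by (auto intro: pm_span_single)
  moreover have "(path_target i l, []) \<in> alg_basis"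
    using assms by (auto simp: alg_basis_def path_target_in_verts admissible_def)
  moreover have "zeta (path_target i l, []) ((i, l), (i, r)) =
      left (path_target i l, []) (zeta (path_target i l, []) ((i, l), (i, r)))"
    by simp
  ultimately show ?thesis using endo_left[OF f] by metis
qed

text \<open>A vector \<open>\<beta>\<zeta>\<close> in the radical is \<open>\<beta>\<close> times a vector in the top, so by linearity its
  image lies in the radical anyway.\<close>

lemma endo_top_zeroI:
  assumes f: "graded_endo n f" and z: "z \<in> plc_span"
    and top: "\<And>i l r. admissible i l r \<Longrightarrow> top_part (f (zeta (path_target i l, []) ((i, l), (i, r)))) = 0"
  shows "top_part (f z) = 0"
proof -
  have "top_part (f z) = pm_extend (\<lambda>b. top_part (f (basis_vec b))) z"
    unfolding endo_linear[OF f z] by (simp add: top_part_eq pm_extend_comp)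
  also have "\<dots> = 0"
    using z
  proof (rule pm_extend_eq_zero)
    fix b assume "b \<in> plc_basis"
    then show "top_part (f (basis_vec b)) = 0"
    proof (cases rule: plc_basis_cases)
      case (top i l r)
      then show ?thesis using assms(3) by simp
    next
      case (arrow \<beta> i l r)
      have "zeta (tail Q \<beta>, []) ((i, l), (i, r)) \<in> plc_span"
        using arrow top_in_plc_basis by (auto intro: pm_span_single)
      then show ?thesis
        using endo_arrow[OF f arrow(2-4)] endo_closed[OF f] by (simp add: arrow(1) top_left_arrow)
    qed
  qed
  finally show ?thesis .
qed

lemma endo_radical:
  assumes f: "graded_endo n f" and z: "z \<in> plc_span" "top_part z = 0"
  shows "top_part (f z) = 0"
proof -
  have "top_part (f z) = pm_extend (\<lambda>b. top_part (f (basis_vec b))) z"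
    unfolding endo_linear[OF f z(1)] by (simp add: top_part_eq pm_extend_comp)
  also have "\<dots> = pm_extend (\<lambda>b. top_part (f (top_basis b))) z"
    using z(1)
  proof (rule pm_extend_cong_span)
    fix b assume "b \<in> plc_basis"
    then show "top_part (f (basis_vec b)) = top_part (f (top_basis b))"
    proof (cases rule: plc_basis_cases)
      case (arrow \<beta> i l r)
      have "zeta (tail Q \<beta>, []) ((i, l), (i, r)) \<in> plc_span"
        using arrow top_in_plc_basis by (auto intro: pm_span_single)
      moreover have "f 0 = 0" using endo_zero[OF f] .
      ultimately show ?thesis
        using endo_arrow[OF f arrow(2-4)] endo_closed[OF f] by (simp add: arrow(1) top_left_arrow)
    qed simp
  qed
  also have "\<dots> = top_part (f (top_part z))"
  proof -
    have t: "top_part z \<in> plc_span" using z(2) by simp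
    have "f (top_part z) = pm_extend (\<lambda>b. f (basis_vec b)) (pm_extend top_basis z)"
      unfolding endo_linear[OF f t] by (simp add: top_part_eq)
    also have "\<dots> = pm_extend (\<lambda>b. pm_extend (\<lambda>b. f (basis_vec b)) (top_basis b)) z" by (rule pm_extend_comp)
    also have "\<dots> = pm_extend (\<lambda>b. f (top_basis b)) z"
    proof (rule pm_extend_cong_span[OF z(1)])
      fix b assume b: "b \<in> plc_basis"
      then have "top_basis b \<in> plc_span" by (auto simp: top_basis_def intro: pm_span_single)
      then show "pm_extend (\<lambda>b. f (basis_vec b)) (top_basis b) = f (top_basis b)"
        by (rule endo_linear[OF f, symmetric])
    qed
    finally show ?thesis by (simp add: top_part_eq pm_extend_comp)
  qed
  also have "\<dots> = 0" using z(2) endo_zero[OF f] by simp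
  finally show ?thesis .
qed

text \<open>A cocycle is determined, up to maps into the radical, by its values on the generators. If
  \<open>f z\<close> is in the radical, then \<open>f\<close> kills \<open>d z\<close>. Applied to \<open>z = \<zeta>\<close> at \<open>(e, q)\<close> and
  separated by arrows, this passes from \<open>q\<close> to all \<open>q\<beta>\<close>. Conversely, if the value at
  \<open>(p, q)\<close> is in the radical, then \<open>f\<close> kills \<open>d\<close> of the vector at \<open>(\<beta>p, q)\<close>; as \<open>d\<close> is
  injective on the top, the value there is in the radical too.\<close>

lemma cocycle_top_zero:
  assumes f: "graded_endo n f" and cocycle: "\<And>z. z \<in> plc_span \<Longrightarrow> plc_d (f z) = pm_scale \<epsilon> (f (plc_d z))"
    and eps: "\<epsilon> \<noteq> 0"
    and unit: "\<And>i. i \<in> verts Q \<Longrightarrow> top_part (f (zeta (i, []) ((i, []), (i, [])))) = 0"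
    and z: "z \<in> plc_span"
  shows "top_part (f z) = 0"
proof (rule endo_top_zeroI[OF f z])
  have kill: "f (plc_d z) = 0" if "z \<in> plc_span" "top_part (f z) = 0" for z
  proof -
    have "pm_scale \<epsilon> (f (plc_d z)) = 0"
      using cocycle[OF that(1)] differential_top[OF endo_closed[OF f that(1)]] that(2) by simp
    then have "pm_scale (inverse \<epsilon>) (pm_scale \<epsilon> (f (plc_d z))) = 0" by simp
    then show ?thesis using eps by (simp add: pm_scale_scale)
  qed
  fix i l r assume "admissible i l r"
  then show "top_part (f (zeta (path_target i l, []) ((i, l), (i, r)))) = 0"
  proof (induction l rule: rev_induct)
    case Nil
    then have "(i, r) \<in> paths Q" by (simp add: admissible_Nil)
    then show ?case
    proof (induction r arbitrary: i)
      case Nil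
      then show ?case using unit by simp
    next
      case (Cons \<beta> r)
      then have r: "(head Q \<beta>, r) \<in> paths Q" "\<beta> \<in> arcs Q" "i = tail Q \<beta>" by auto
      let ?S = "{\<gamma> \<in> arcs Q. head Q \<gamma> = head Q \<beta>}"
      let ?z = "zeta (head Q \<beta>, []) ((head Q \<beta>, []), (head Q \<beta>, r))"
      let ?z' = "\<lambda>\<gamma>. zeta (tail Q \<gamma>, []) ((tail Q \<gamma>, []), (tail Q \<gamma>, \<gamma> # r))"
      have z: "?z \<in> plc_span"
        using top_in_plc_basis[of "head Q \<beta>" "[]" r] r by (simp add: admissible_Nil pm_span_single)
      have ad: "admissible (tail Q \<gamma>) [] (\<gamma> # r)" if "\<gamma> \<in> ?S" for \<gamma>
        using that r by (auto simp: admissible_Nil)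
      have z': "?z' \<gamma> \<in> plc_span" if "\<gamma> \<in> ?S" for \<gamma>
        using top_in_plc_basis[OF ad[OF that]] by (simp add: pm_span_single)
      have arrow: "zeta (tail Q \<gamma>, [\<gamma>]) ((tail Q \<gamma>, []), (tail Q \<gamma>, \<gamma> # r)) \<in> plc_span"
        if "\<gamma> \<in> ?S" for \<gamma>
        using ad[OF that] that by (auto simp: plc_basis_iff proj_basis_iff intro!: pm_span_single)
      have "0 = f (plc_d ?z)" using kill[OF z] Cons.IH[OF r(1)] by simp
      also have "\<dots> = (\<Sum>\<gamma>\<in>?S. left (tail Q \<gamma>, [\<gamma>]) (f (?z' \<gamma>)))"
      proof -
        have "f (plc_d ?z) = f (\<Sum>\<gamma>\<in>?S. zeta (tail Q \<gamma>, [\<gamma>]) ((tail Q \<gamma>, []), (tail Q \<gamma>, \<gamma> # r)))"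
          by simp
        also have "\<dots> = (\<Sum>\<gamma>\<in>?S. f (zeta (tail Q \<gamma>, [\<gamma>]) ((tail Q \<gamma>, []), (tail Q \<gamma>, \<gamma> # r))))"
          by (rule endo_sum[OF f arrow])
        also have "\<dots> = (\<Sum>\<gamma>\<in>?S. left (tail Q \<gamma>, [\<gamma>]) (f (?z' \<gamma>)))"
          by (rule sum.cong) (use endo_arrow[OF f ad] in auto)
        finally show ?thesis .
      qed
      finally have "0 = strip \<beta> (\<Sum>\<gamma>\<in>?S. left (tail Q \<gamma>, [\<gamma>]) (f (?z' \<gamma>)))" by simp
      also have "\<dots> = (\<Sum>\<gamma>\<in>?S. if \<gamma> = \<beta> then top_part (left (tail Q \<beta>, []) (f (?z' \<beta>))) else 0)"
        unfolding pm_extend_sum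
        by (rule sum.cong) (use endo_closed[OF f z'] in \<open>auto simp: strip_left_arrow\<close>)
      also have "\<dots> = top_part (left (tail Q \<beta>, []) (f (?z' \<beta>)))" using r by simp
      also have "left (tail Q \<beta>, []) (f (?z' \<beta>)) = f (?z' \<beta>)"
        using endo_vertex[OF f ad[of \<beta>]] r by simp
      finally show ?case using r by simp
    qed
  next
    case (snoc \<beta> l)
    have ad: "admissible i l r" "\<beta> \<in> arcs Q" "tail Q \<beta> = path_target i l"
      using snoc(2) admissible_butlast by (auto simp: admissible_def)
    let ?z = "zeta (head Q \<beta>, []) ((i, l @ [\<beta>]), (i, r))"
    let ?z' = "zeta (tail Q \<beta>, []) ((i, l), (i, r))"
    have z: "?z \<in> plc_span" "?z' \<in> plc_span"
      using top_in_plc_basis[OF snoc(2)] top_in_plc_basis[OF ad(1)] ad by (simp_all add: pm_span_single)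
    have "f (plc_d ?z) = left (tail Q \<beta>, [\<beta>]) (f ?z')"
      using endo_arrow[OF f ad] by simp
    also have "\<dots> = left (tail Q \<beta>, [\<beta>]) (top_part (f ?z'))"
      using left_arrow_top[OF endo_closed[OF f z(2)]] by simp
    also have "\<dots> = 0" using snoc(1)[OF ad(1)] ad(3) by simp
    finally have "plc_d (f ?z) = 0" using cocycle[OF z(1)] by simp
    then show ?case using contract_differential[OF endo_closed[OF f z(1)]] by simp
  qed
qed

end

context associated_quiver
begin

text \<open>Let \<open>f\<close> have values in the radical. A map \<open>h\<close> with \<open>d h - \<epsilon> h d = f\<close> is constructed
  from its values \<open>H\<close> on the top. At \<open>(e, q)\<close> the equation reads
  \<open>\<epsilon> \<Sum> \<beta> H(e, q\<beta>) = d H(e, q) - f\<close>. It determines the values at \<open>q\<beta>\<close> from the one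
  at \<open>q\<close>, so that \<open>H(e, e)\<close> can be chosen freely, for instance as zero. The inverse of
  \<open>\<epsilon> = \<plusminus>1\<close> is \<open>\<epsilon>\<close> itself. The list is in the order of traversal, so the arrow added
  to \<open>q\<close> at its start is its first entry.\<close>

primrec homotopy_right :: "(('v, 'e, 'k) plc_vector \<Rightarrow> ('v, 'e, 'k) plc_vector) \<Rightarrow> 'k \<Rightarrow>
    'e list \<Rightarrow> ('v, 'e, 'k) plc_vector" where
  "homotopy_right f \<epsilon> [] = 0"
| "homotopy_right f \<epsilon> (\<beta> # r) = pm_scale \<epsilon> (strip \<beta>
     (plc_d (homotopy_right f \<epsilon> r) - f (zeta (head Q \<beta>, []) ((head Q \<beta>, []), (head Q \<beta>, r)))))"

text \<open>At \<open>(\<beta>p, q)\<close> the equation reads \<open>d H(\<beta>p, q) = f + \<epsilon> \<beta> H(p, q)\<close>. The right hand side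
  lies in the radical, and the contraction solves it. The recursion is on the reversed arrow list
  of \<open>p\<close>, whose head is the last arrow.\<close>

primrec homotopy_left :: "(('v, 'e, 'k) plc_vector \<Rightarrow> ('v, 'e, 'k) plc_vector) \<Rightarrow> 'k \<Rightarrow>
    'v \<Rightarrow> 'e list \<Rightarrow> 'e list \<Rightarrow> ('v, 'e, 'k) plc_vector" where
  "homotopy_left f \<epsilon> i r [] = homotopy_right f \<epsilon> r"
| "homotopy_left f \<epsilon> i r (\<beta> # l) = contract
     (f (zeta (head Q \<beta>, []) ((i, rev (\<beta> # l)), (i, r))) +
      pm_scale \<epsilon> (left (tail Q \<beta>, [\<beta>]) (homotopy_left f \<epsilon> i r l)))"

abbreviation homotopy_value where
  "homotopy_value f \<epsilon> i l r \<equiv> homotopy_left f \<epsilon> i r (rev l)"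

definition homotopy_basis :: "(('v, 'e, 'k) plc_vector \<Rightarrow> ('v, 'e, 'k) plc_vector) \<Rightarrow> 'k \<Rightarrow>
    ('v, 'e) plc_index \<Rightarrow> ('v, 'e, 'k) plc_vector" where
  "homotopy_basis f \<epsilon> = (\<lambda>(u, ((i, l), (j, r))). left u (homotopy_value f \<epsilon> i l r))"

lemma plc_graded_span: "z \<in> plc_graded n \<Longrightarrow> z \<in> plc_span"
  by (rule pm_span_mono[rotated]) auto

lemma differential_graded: "z \<in> plc_graded n \<Longrightarrow> plc_d z \<in> plc_graded (n + 1)"
  by (erule pm_span_extend) (use differential_basis_degree in auto)

lemma left_graded: "v \<in> alg_basis \<Longrightarrow> z \<in> plc_graded n \<Longrightarrow> left v z \<in> plc_graded n"
  using lact_degree[OF pm_span_single[of v alg_basis 1], of z n] by (simp add: plc_lact_basis)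

lemma left_differential: "v \<in> alg_basis \<Longrightarrow> z \<in> plc_span \<Longrightarrow> left v (plc_d z) = plc_d (left v z)"
  using lact_differential[OF pm_span_single[of v alg_basis 1], of z] by (simp add: plc_lact_basis)

context
  fixes f :: "('v, 'e, 'k) plc_vector \<Rightarrow> ('v, 'e, 'k) plc_vector" and n :: int and \<epsilon> :: 'k
  assumes f: "graded_endo n f" and eps: "\<epsilon> * \<epsilon> = 1"
    and top_zero: "\<And>z. z \<in> plc_span \<Longrightarrow> top_part (f z) = 0"
begin

lemma zeta_top_graded:
  "admissible i l r \<Longrightarrow> zeta (path_target i l, []) ((i, l), (i, r)) \<in> plc_graded (int (length r) - int (length l))"
  using top_in_plc_basis by (intro pm_span_single) (simp add: plc_degree_def)

lemma homotopy_right_valid: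
  "(i, r) \<in> paths Q \<Longrightarrow> homotopy_right f \<epsilon> r \<in> plc_graded (int (length r) + (n - 1)) \<and>
     left (i, []) (homotopy_right f \<epsilon> r) = homotopy_right f \<epsilon> r"
proof (induction r arbitrary: i)
  case (Cons \<beta> r)
  then have r: "(head Q \<beta>, r) \<in> paths Q" "\<beta> \<in> arcs Q" "i = tail Q \<beta>" by auto
  let ?x = "plc_d (homotopy_right f \<epsilon> r) - f (zeta (head Q \<beta>, []) ((head Q \<beta>, []), (head Q \<beta>, r)))"
  have x: "?x \<in> plc_graded (int (length r) + n)"
    using differential_graded[of "homotopy_right f \<epsilon> r" "int (length r) + (n - 1)"] Cons.IH[OF r(1)]
      endo_degree[OF f zeta_top_graded[of "head Q \<beta>" "[]" r]] r(1)
    by (intro pm_span_diff) (auto simp: admissible_Nil)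
  show ?case
    using strip_degree[OF x, of \<beta>] left_strip[OF plc_graded_span[OF x], of \<beta>]
    by (simp add: pm_span_scale pm_extend_scale r(3) algebra_simps)
qed simp

lemma homotopy_value_valid:
  "admissible i l r \<Longrightarrow>
     homotopy_value f \<epsilon> i l r \<in> plc_graded (int (length r) - int (length l) + (n - 1)) \<and>
     left (path_target i l, []) (homotopy_value f \<epsilon> i l r) = homotopy_value f \<epsilon> i l r"
proof (induction l rule: rev_induct)
  case Nil
  then show ?case using homotopy_right_valid[of i r] by (simp add: admissible_Nil)
next
  case (snoc \<beta> l)
  have ad: "admissible i l r" "\<beta> \<in> arcs Q" "tail Q \<beta> = path_target i l"
    using snoc(2) admissible_butlast by (auto simp: admissible_def)
  let ?z = "zeta (head Q \<beta>, []) ((i, l @ [\<beta>]), (i, r))"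
  let ?y = "left (tail Q \<beta>, [\<beta>]) (homotopy_value f \<epsilon> i l r)"
  let ?m = "int (length r) - int (length l) + (n - 1)"
  have h: "homotopy_value f \<epsilon> i l r \<in> plc_graded ?m" using snoc(1)[OF ad(1)] by simp
  have v: "(tail Q \<beta>, [\<beta>]) \<in> alg_basis" using ad by (auto simp: alg_basis_def)
  have y: "?y \<in> plc_graded ?m" by (rule left_graded[OF v h])
  have fz: "f ?z \<in> plc_graded ?m" using endo_degree[OF f zeta_top_graded[OF snoc(2)]] by (simp add: algebra_simps)
  have x: "f ?z + pm_scale \<epsilon> ?y \<in> plc_graded ?m" by (intro pm_span_add pm_span_scale y fz)
  have "left (head Q \<beta>, []) (f ?z) = f ?z" using endo_vertex[OF f snoc(2)] by simp
  then have "left (head Q \<beta>, []) (f ?z + pm_scale \<epsilon> ?y) = f ?z + pm_scale \<epsilon> ?y"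
    using left_target_arrow[OF plc_graded_span[OF h]] by (simp add: pm_extend_add pm_extend_scale)
  then show ?case
    using contract_degree[OF x] contract_left_vertex[OF plc_graded_span[OF x], of "head Q \<beta>"]
    by (simp add: algebra_simps)
qed

abbreviation homotopy where "homotopy \<equiv> pm_extend (homotopy_basis f \<epsilon>)"

text \<open>The map is \<open>A\<close>-linear because its value at \<open>u\<zeta>\<close> is \<open>u\<close> times a fixed element.\<close>

lemma homotopy_basis_left:
  assumes "v \<in> alg_basis" "b \<in> plc_basis"
  shows "homotopy (left_basis v b) = left v (homotopy_basis f \<epsilon> b)"
proof -
  obtain u i l r where b: "b = (u, ((i, l), (i, r)))" "admissible i l r" "u \<in> proj_basis Q (path_target i l)"
    using assms(2) by (rule plc_basisE)
  let ?H = "homotopy_value f \<epsilon> i l r"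
  have H: "?H \<in> plc_span" using homotopy_value_valid[OF b(2)] plc_graded_span by blast
  have u: "u \<in> alg_basis" using b(2,3) path_target_in_verts
    by (auto simp: proj_basis_iff alg_basis_def admissible_def)
  have "homotopy (left_basis v b) = plc_lact Q (alg_mult v u) ?H"
    by (auto simp: b(1) left_basis_def alg_mult_def homotopy_basis_def plc_lact_basis plc_lact_eq')
  also have "\<dots> = plc_lact Q (pm_mult alg_mult (basis_vec v) (basis_vec u)) ?H"
    by (simp add: pm_mult_single)
  also have "\<dots> = left v (left u ?H)"
    using lact_mult[OF pm_span_single[OF assms(1), of 1] pm_span_single[OF u, of 1] H]
    by (simp add: plc_lact_basis)
  finally show ?thesis by (simp add: b(1) homotopy_basis_def)
qed

lemma homotopy_basis_degree:
  assumes "b \<in> plc_basis"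
  shows "homotopy_basis f \<epsilon> b \<in> plc_graded (plc_degree b + (n - 1))"
proof -
  obtain u i l r where b: "b = (u, ((i, l), (i, r)))" "admissible i l r" "u \<in> proj_basis Q (path_target i l)"
    using assms by (rule plc_basisE)
  have u: "u \<in> alg_basis" using b(2,3) path_target_in_verts
    by (auto simp: proj_basis_iff alg_basis_def admissible_def)
  show ?thesis
    using left_graded[OF u] homotopy_value_valid[OF b(2)] by (simp add: b(1) homotopy_basis_def plc_degree_def)
qed

lemma homotopy_graded_endo: "graded_endo (n - 1) homotopy"
  unfolding graded_endo_def
proof (intro conjI ballI allI)
  fix x assume x: "x \<in> plc_span"
  show "homotopy x \<in> plc_span"
    using x by (rule pm_span_extend) (rule plc_graded_span[OF homotopy_basis_degree])
  fix v assume v: "v \<in> alg_basis"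
  show "homotopy (left v x) = left v (homotopy x)"
    unfolding pm_extend_comp by (rule pm_extend_cong_span[OF x]) (rule homotopy_basis_left[OF v])
next
  fix l x assume "x \<in> plc_graded l"
  then show "homotopy x \<in> plc_graded (l + (n - 1))"
    by (rule pm_span_extend) (use homotopy_basis_degree in auto)
qed (simp_all add: pm_extend_add pm_extend_scale)

text \<open>On the radical both terms on the left vanish, and so does \<open>f\<close>, since its values on the top
  are in the radical and the radical has square zero. On the top the two cases are the recursion
  equations; for \<open>(e\<^sub>i, q)\<close> the arrow components of an element of the radical add up to it.\<close>

lemma homotopy_equation:
  assumes "z \<in> plc_span"
  shows "plc_d (homotopy z) - pm_scale \<epsilon> (homotopy (plc_d z)) = f z"
proof -
  have "plc_d (homotopy_basis f \<epsilon> b) - pm_scale \<epsilon> (homotopy (differential_basis b)) = f (basis_vec b)"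
    if "b \<in> plc_basis" for b
    using that
  proof (cases rule: plc_basis_cases)
    case (arrow \<beta> i l r)
    have z: "zeta (tail Q \<beta>, []) ((i, l), (i, r)) \<in> plc_span"
      using top_in_plc_basis[OF arrow(2)] arrow(4) by (simp add: pm_span_single)
    have "f (basis_vec b) = left (tail Q \<beta>, [\<beta>]) (top_part (f (zeta (tail Q \<beta>, []) ((i, l), (i, r)))))"
      using endo_arrow[OF f arrow(2-4)] left_arrow_top[OF endo_closed[OF f z]] by (simp add: arrow(1))
    then have "f (basis_vec b) = 0" using top_zero[OF z] by simp
    moreover have "homotopy_value f \<epsilon> i l r \<in> plc_span"
      using homotopy_value_valid[OF arrow(2)] plc_graded_span by blast
    ultimately show ?thesis by (simp add: arrow(1) homotopy_basis_def differential_left_arrow)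
  next
    case (top i l r)
    let ?z = "zeta (path_target i l, []) ((i, l), (i, r))"
    have z: "?z \<in> plc_span" using top_in_plc_basis[OF top(2)] by (simp add: pm_span_single)
    have hb: "homotopy_basis f \<epsilon> b = homotopy_value f \<epsilon> i l r"
      using homotopy_value_valid[OF top(2)] by (simp add: top(1) homotopy_basis_def)
    show ?thesis
    proof (cases l rule: rev_cases)
      case (snoc l' \<beta>)
      have ad: "admissible i l' r" "\<beta> \<in> arcs Q" "tail Q \<beta> = path_target i l'"
        using top(2) admissible_butlast by (auto simp: admissible_def snoc)
      let ?H = "homotopy_value f \<epsilon> i l' r"
      let ?x = "f ?z + pm_scale \<epsilon> (left (tail Q \<beta>, [\<beta>]) ?H)"
      have H: "?H \<in> plc_span" using homotopy_value_valid[OF ad(1)] plc_graded_span by blast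
      have v: "(tail Q \<beta>, [\<beta>]) \<in> alg_basis" using ad by (auto simp: alg_basis_def)
      have x: "?x \<in> plc_span" by (intro pm_span_add pm_span_scale endo_closed[OF f z] left_closed[OF v H])
      have "top_part ?x = 0"
        using top_zero[OF z] top_left_arrow[OF H] by (simp add: top_add top_scale)
      then have "plc_d (homotopy_value f \<epsilon> i l r) = ?x"
        using differential_contract[OF x] by (simp add: snoc)
      moreover have "homotopy (differential_basis b) = left (tail Q \<beta>, [\<beta>]) ?H"
        by (simp add: top(1) snoc homotopy_basis_def)
      ultimately show ?thesis by (simp add: hb) (simp add: top(1))
    next
      case Nil
      let ?H = "homotopy_right f \<epsilon> r"
      let ?x = "plc_d ?H - f ?z"
      let ?S = "{\<beta> \<in> arcs Q. head Q \<beta> = i}"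
      have p: "(i, r) \<in> paths Q" "i \<in> verts Q" using top(2) path_start_in_verts by (auto simp: admissible_def)
      have H: "?H \<in> plc_span" "left (i, []) ?H = ?H"
        using homotopy_right_valid[OF p(1)] plc_graded_span by blast+
      have dH: "plc_d ?H \<in> plc_span"
        using differential_graded homotopy_right_valid[OF p(1)] plc_graded_span by blast
      have x: "?x \<in> plc_span" by (rule pm_span_diff[OF dH endo_closed[OF f z]])
      have v: "(i, []) \<in> alg_basis" using p by (simp add: alg_basis_def)
      have "top_part ?x = 0" using top_differential[OF H(1)] top_zero[OF z] by (simp add: top_diff)
      moreover have "left (i, []) ?x = ?x"
        using endo_vertex[OF f top(2)] left_differential[OF v H(1)] H(2) by (simp add: pm_extend_diff Nil)
      ultimately have *: "(\<Sum>\<beta>\<in>?S. left (tail Q \<beta>, [\<beta>]) (strip \<beta> ?x)) = ?x"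
        using sum_left_strip[OF x, of i] by simp
      have "homotopy (differential_basis b) =
          (\<Sum>\<beta>\<in>?S. left (tail Q \<beta>, [\<beta>]) (pm_scale \<epsilon> (strip \<beta> ?x)))"
        unfolding top(1) Nil by (auto simp: pm_extend_sum homotopy_basis_def intro!: sum.cong)
      also have "\<dots> = pm_scale \<epsilon> ?x"
        by (simp only: pm_extend_scale flip: pm_scale_sum) (simp only: *)
      finally show ?thesis
        by (simp add: hb Nil pm_scale_scale eps) (simp add: top(1) Nil)
    qed
  qed
  then have "pm_extend (\<lambda>b. plc_d (homotopy_basis f \<epsilon> b) - pm_scale \<epsilon> (homotopy (differential_basis b))) z =
      pm_extend (\<lambda>b. f (basis_vec b)) z"
    by (rule pm_extend_cong_span[OF assms])
  then show ?thesis
    using endo_linear[OF f assms] by (simp add: pm_extend_diff_fun pm_extend_scale_fun pm_extend_comp)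
qed

end

lemma act_top_part:
  assumes "f \<in> carrier F" "z \<in> plc_span"
  shows "top_part (act z f) = act (top_part z) f"
  unfolding top_part_eq
proof (rule act_commute[OF _ assms])
  fix g b assume b: "b \<in> plc_basis"
  then obtain u i l r where *: "b = (u, ((i, l), (i, r)))" by (rule plc_basisE)
  have **: "top_basis (u, pq) = (if snd u = [] then zeta u pq else 0)" for pq by (simp add: top_basis_def)
  show "pm_extend top_basis (gen_basis g b) = pm_extend (gen_basis g) (top_basis b)"
    by (cases g; cases "r = []") (auto simp: * ** pm_extend_diff pm_extend_sum)
qed

lemma top_unit_vec: "top_part unit_vec = unit_vec"
  by (simp add: unit_vec_def top_part_eq pm_extend_sum)

lemma left_unit_vec: "i \<in> verts Q \<Longrightarrow> left (i, []) unit_vec = zeta (i, []) ((i, []), (i, []))"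
  by (simp add: unit_vec_def pm_extend_sum)

lemma graded_endo_iff:
  "f \<in> dg_End_grade A P n \<longleftrightarrow> f \<in> extensional plc_span \<and> graded_endo n f"
proof -
  have lin: "(\<forall>m. \<forall>x\<in>grade A m. \<forall>z\<in>plc_span. f (plc_lact Q x z) = pm_scale (koszul_sign (n * m)) (plc_lact Q x (f z)))
     \<longleftrightarrow> (\<forall>v\<in>alg_basis. \<forall>z\<in>plc_span. f (left v z) = left v (f z))" (is "?L \<longleftrightarrow> ?R")
    if add: "\<forall>x\<in>plc_span. \<forall>y\<in>plc_span. f (x + y) = f x + f y"
    and scale: "\<forall>c. \<forall>x\<in>plc_span. f (pm_scale c x) = pm_scale c (f x)"
  proof
    assume L: ?L
    show ?R
    proof (intro ballI)
      fix v z assume v: "v \<in> alg_basis" and z: "z \<in> plc_span"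
      have "basis_vec v \<in> grade A 0" using v by (simp add: A_simps pm_span_single)
      then show "f (left v z) = left v (f z)"
        using L z by (force simp: koszul_sign_parity plc_lact_basis)
    qed
  next
    assume R: ?R
    have zero: "f 0 = 0" using scale[rule_format, of 0 0] by simp
    have sum: "f (sum g N) = (\<Sum>i\<in>N. f (g i))" if "\<And>i. i \<in> N \<Longrightarrow> g i \<in> plc_span"
      for g and N :: "('v, 'e) qpath set"
      using that by (induction N rule: infinite_finite_induct) (auto simp: zero add pm_span_sum)
    show ?L
    proof (intro allI ballI)
      fix m x z assume x: "x \<in> grade A m" and z: "z \<in> plc_span"
      show "f (plc_lact Q x z) = pm_scale (koszul_sign (n * m)) (plc_lact Q x (f z))"
      proof (cases "m = 0")
        case True
        have v: "v \<in> alg_basis" if "v \<in> Poly_Mapping.keys x" for v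
          using x that by (auto simp: A_simps pm_span_def True)
        have "f (plc_lact Q x z) =
            f (\<Sum>v\<in>Poly_Mapping.keys x. pm_scale (Poly_Mapping.lookup x v) (left v z))"
          by (simp only: plc_lact_eq' pm_extend_def[of _ x])
        also have "\<dots> = (\<Sum>v\<in>Poly_Mapping.keys x. f (pm_scale (Poly_Mapping.lookup x v) (left v z)))"
          by (rule sum) (rule pm_span_scale[OF left_closed[OF v z]])
        also have "\<dots> = (\<Sum>v\<in>Poly_Mapping.keys x. pm_scale (Poly_Mapping.lookup x v) (left v (f z)))"
          by (rule sum.cong) (use scale R z v left_closed[OF v z] in auto)
        also have "\<dots> = plc_lact Q x (f z)"
          by (simp only: plc_lact_eq' pm_extend_def[of _ x])
        finally show ?thesis by (simp add: True koszul_sign_parity)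
      next
        case False
        then have "x = 0" using x by (simp add: A_simps)
        then show ?thesis by (simp add: plc_lact_eq' zero)
      qed
    qed
  qed
  show ?thesis
    unfolding dg_End_grade_def graded_endo_def mem_Collect_eq P_simps
    using lin by blast
qed

text \<open>Injectivity: a coboundary maps the top into the radical, whereas right multiplication by
  \<open>b\<close> maps \<open>unit_vec\<close> to the element \<open>unit_vec b\<close> of the top, which vanishes only for
  \<open>b = 0\<close>. Surjectivity: for a cocycle \<open>y\<close> choose \<open>b\<close> such that \<open>unit_vec b\<close> is the
  top part of \<open>y unit_vec\<close>. Then \<open>y\<close> minus right multiplication by \<open>b\<close> is a cocycle with
  values in the radical, hence a coboundary.\<close>

lemma right_mult_quasi_iso: "dg_quasi_iso_elementwise B (dg_opposite (dg_End A P)) (right_mult_map B P)"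
proof -
  interpret M: dg_bimodule A B P by (rule P_dg_bimodule)
  interpret E: dg_algebra M.E by (rule M.End_dg_algebra)
  have cob: "coboundaries (dg_opposite M.E) n = M.commutator (n - 1) ` M.End_grade (n - 1)" for n
    by (auto simp: coboundaries_def dg_opposite_simps M.End_record(7) M.End_differential_homogeneous)
  have comm: "M.commutator n f z = plc_d (f z) - pm_scale (koszul_sign n) (f (plc_d z))"
    if "f \<in> M.End_grade n" "z \<in> plc_span" for f n z
  proof -
    have "pm_scale (- koszul_sign n) x = - pm_scale (koszul_sign n) x" for x :: "('v, 'e, 'k) plc_vector"
      by (rule poly_mapping_eqI) (simp add: lookup_uminus)
    then show ?thesis
      using M.commutator_apply[OF M.End_grade_carrier[OF that(1)], of z n] that(2) by (simp add: P_simps)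
  qed
  have unit_grade: "unit_vec \<in> grade P 0" using unit_vec_degree by (simp add: P_simps)
  have rmult_unit: "M.rmult b unit_vec = plc_ract Q a unit_vec b" if "b \<in> grade B n" for b n
    using M.rmult_homogeneous[OF that unit_grade] M.ract_closed[of unit_vec b] M.B.grade_closed[OF that] unit_vec_closed
    by (simp add: koszul_sign_parity P_simps)
  have d_closed: "plc_d z \<in> plc_span" if "z \<in> plc_span" for z
    using that M.differential_closed[of z] by (simp add: P_simps)
  show ?thesis
    unfolding dg_quasi_iso_elementwise_def
  proof (intro conjI allI ballI impI)
    show "dg_algebra_hom B (dg_opposite M.E) M.rmult" by (rule M.right_mult_dg_algebra_hom)
  next
    fix n x assume "x \<in> cocycles B n" and "M.rmult x \<in> coboundaries (dg_opposite M.E) n"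
    then obtain h where x: "x \<in> grade B n" and h: "h \<in> M.End_grade (n - 1)" "M.rmult x = M.commutator (n - 1) h"
      by (auto simp: cocycles_def cob)
    note he = h(1)[unfolded graded_endo_iff, THEN conjunct2]
    obtain g where g: "g \<in> carrier F" "x = coset g"
      using x B_grade_closed B_carrierE by blast
    let ?y = "plc_ract Q a unit_vec x"
    have y: "?y = act unit_vec g" using g by (simp add: ract_coset unit_vec_closed)
    have "?y = plc_d (h unit_vec) - pm_scale (koszul_sign (n - 1)) (h (plc_d unit_vec))"
      using rmult_unit[OF x] comm[OF h(1) unit_vec_closed] h(2) by simp
    then have "top_part ?y = 0"
      using top_differential[OF endo_closed[OF he unit_vec_closed]]
        endo_radical[OF he d_closed[OF unit_vec_closed] top_differential[OF unit_vec_closed]]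
      by (simp add: top_diff top_scale)
    moreover have "top_part ?y = ?y"
      unfolding y act_top_part[OF g(1) unit_vec_closed] top_unit_vec ..
    ultimately have "act unit_vec g = 0" using y by simp
    then have "g \<in> I" by (rule act_unit_faithful[OF g(1)])
    then have "x = \<zero>\<^bsub>B\<^esub>"
      using g by (simp add: B_zero coset_eq_iff cong_I_def F_simps)
    then show "x \<in> coboundaries B n" using M.B.zero_coboundary by simp
  next
    fix n y assume "y \<in> cocycles (dg_opposite M.E) n"
    then have y: "y \<in> M.End_grade n" "M.commutator n y = \<zero>\<^bsub>M.U\<^esub>"
      by (auto simp: cocycles_def dg_opposite_simps M.End_record(4,7) M.End_differential_homogeneous)
    \<comment> \<open>\<open>unit_vec\<close> has degree zero, so no sign occurs in the comparison of values there\<close>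
    let ?b = "coset (normal_form (y unit_vec))"
    have yu: "y unit_vec \<in> plc_graded n" "y unit_vec \<in> plc_span"
      using M.End_gradeD(6)[OF y(1) unit_grade] plc_graded_span by (auto simp: P_simps)
    have b: "?b \<in> grade B n" unfolding B_grade by (rule imageI) (rule normal_form_degree[OF yu(1)])
    have bc: "?b \<in> cocycles B n" using b by (simp add: cocycles_def B_differential)
    note rb = M.rmult_grade[OF b]
    let ?g = "y \<oplus>\<^bsub>M.U\<^esub> ((- 1) \<odot>\<^bsub>M.U\<^esub> M.rmult ?b)"
    have g: "?g \<in> M.End_grade n" by (intro M.End_grade_add M.End_grade_smult y(1) rb)
    note ge = g[unfolded graded_endo_iff, THEN conjunct2]
    have g_apply: "?g z = y z - M.rmult ?b z" if "z \<in> plc_span" for z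
      using that by (simp add: P_simps pm_scale_minus_1)
    have "M.commutator n (M.rmult ?b) = \<zero>\<^bsub>M.U\<^esub>"
    proof -
      interpret r: dg_algebra_hom B "dg_opposite M.E" M.rmult by (rule M.right_mult_dg_algebra_hom)
      show ?thesis
        using r.hom_cocycle[OF bc]
        by (simp add: cocycles_def dg_opposite_simps M.End_record(4,7) M.End_differential_homogeneous[OF rb])
    qed
    then have cocycle: "plc_d (?g z) = pm_scale (koszul_sign n) (?g (plc_d z))" if "z \<in> plc_span" for z
      using comm[OF y(1) that] comm[OF rb that] y(2) that d_closed[OF that]
      by (simp add: P_simps pm_extend_add pm_scale_add pm_scale_minus_1 pm_extend_diff pm_scale_diff)
    have "M.rmult ?b unit_vec = top_part (y unit_vec)"
      using rmult_unit[OF b] by (simp add: ract_coset normal_form_closed yu unit_vec_closed act_unit_normal_form)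
    moreover have "top_part (top_part (y unit_vec)) = top_part (y unit_vec)"
      using act_top_part[OF normal_form_closed[OF yu(2)] unit_vec_closed]
      by (simp add: top_unit_vec act_unit_normal_form[OF yu(2)])
    ultimately have g_unit: "top_part (?g unit_vec) = 0"
      by (simp add: g_apply unit_vec_closed top_diff)
    have unit: "top_part (?g (zeta (i, []) ((i, []), (i, [])))) = 0" if "i \<in> verts Q" for i
    proof -
      have v: "(i, []) \<in> alg_basis" using that by (simp add: alg_basis_def)
      have "?g (zeta (i, []) ((i, []), (i, []))) = left (i, []) (?g unit_vec)"
        using endo_left[OF ge v unit_vec_closed] left_unit_vec[OF that] by simp
      then show ?thesis
        using top_left_vertex[OF endo_closed[OF ge unit_vec_closed], of i] g_unit by simp
    qed
    have top: "top_part (?g z) = 0" if "z \<in> plc_span" for z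
      by (rule cocycle_top_zero[OF ge cocycle _ unit that]) (simp_all add: koszul_sign_parity)
    let ?e = "koszul_sign (n - 1) :: 'k"
    let ?h = "\<lambda>z\<in>plc_span. pm_extend (homotopy_basis ?g ?e) z"
    have e: "?e * ?e = 1" by simp
    have "graded_endo (n - 1) ?h"
      using homotopy_graded_endo[OF ge e top]
      by (simp add: graded_endo_def pm_span_add pm_span_scale left_closed plc_graded_span)
    then have h: "?h \<in> M.End_grade (n - 1)" by (simp add: graded_endo_iff)
    have "M.commutator (n - 1) ?h = ?g"
    proof (rule M.End_eqI)
      show "M.commutator (n - 1) ?h \<in> carrier M.U" "?g \<in> carrier M.U"
        using M.End_grade_carrier[OF M.commutator_grade[OF h]] M.End_grade_carrier[OF g] by auto
      fix z assume "z \<in> carrier P"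
      then have z: "z \<in> plc_span" by (simp add: P_simps)
      show "M.commutator (n - 1) ?h z = ?g z"
        using comm[OF h z] homotopy_equation[OF ge e top z] z d_closed[OF z] by simp
    qed
    then have w: "?g \<in> coboundaries (dg_opposite M.E) n" unfolding cob using h by (metis image_eqI)
    have "y = ?g \<oplus>\<^bsub>M.U\<^esub> M.rmult ?b"
    proof (rule M.End_eqI)
      show "y \<in> carrier M.U" "?g \<oplus>\<^bsub>M.U\<^esub> M.rmult ?b \<in> carrier M.U"
        using M.End_grade_carrier[OF y(1)] M.End_grade_carrier[OF M.End_grade_add[OF g rb]] by auto
      fix z assume "z \<in> carrier P"
      then show "y z = (?g \<oplus>\<^bsub>M.U\<^esub> M.rmult ?b) z" using g_apply[of z] by (simp add: P_simps)
    qed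
    then show "\<exists>x\<in>cocycles B n. \<exists>w\<in>coboundaries (dg_opposite M.E) n. y = w \<oplus>\<^bsub>dg_opposite M.E\<^esub> M.rmult x"
      using bc w by (intro bexI[of _ ?b] bexI[of _ ?g]) (simp_all add: dg_opposite_simps M.End_record(5))
  qed
qed

end

theorem theorem5p2:
  fixes Q :: "('v, 'e) pre_digraph" and a :: "'v \<Rightarrow> 'e"
    and A :: "('k::field, ('v, 'e) qpath \<Rightarrow>\<^sub>0 'k) dg"
    and B :: "('k, (('v, 'e) leavitt_gen list \<Rightarrow>\<^sub>0 'k) set) dg"
    and P :: "('k, ('v, 'e) qpath \<Rightarrow>\<^sub>0 'k, (('v, 'e) leavitt_gen list \<Rightarrow>\<^sub>0 'k) set,
               ('v, 'e) plc_index \<Rightarrow>\<^sub>0 'k) dg_bimod"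
  assumes "fin_digraph Q"
    and "\<forall>i\<in>verts Q. \<exists>\<alpha>\<in>arcs Q. head Q \<alpha> = i"
    and "associated_choice Q a"
    and "A = dg_concentrated (rad_square_zero_algebra Q)"
    and "B = leavitt_path_algebra (opposite_quiver Q)"
    and "P = projective_leavitt_complex Q a"
  shows "right_quasi_balanced A B P \<and>
         dg_quasi_isomorphic (dg_opposite (dg_End A P)) B"
proof -
  interpret associated_quiver Q a "TYPE('k)"
    using assms(1,3) by (simp add: associated_quiver_def associated_quiver_axioms_def)
  show ?thesis
    unfolding assms(4-6) right_quasi_balanced_def
    using P_dg_bimodule dg_quasi_isoI[OF right_mult_quasi_iso] dg_quasi_isomorphicI[OF right_mult_quasi_iso]
    by blast
qed

end
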